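(* Let $k$ be the number of sites, $\alpha\in(0,1)$ the accuracy parameter with $k\le 1/\alpha^2$, $\delta\in(0,1)$ the failure probability, and $N$ the total number of items. There is a randomized distributed count-tracking mechanism $\mathcal{M}$ (the round-based protocol described in the context) with the following guarantee against every adaptive adversary. With probability at least $1-\delta$, at every time step the server's output is within a factor $1\pm\alpha$ of the total number of items received by all sites so far. The total communication is $O\!\left(\frac{C\sqrt{k}\log N}{\alpha}\right)$ words, where $$C=\sqrt{\left(\left(\log\sqrt{k}\right)^{1.5}+1\right)\cdot\log\left(\frac{8\sqrt{k}\log N}{\alpha\delta}\right)}.$$
   Context: Distributed count tracking model. There are $k$ sites and one server, with a point-to-point channel between the server and each site. Communication is instantaneous, and cost is counted in words, where any integer less than $N$ fits in one word. Time proceeds in discrete steps. At each step an adversary either skips, or picks a site $i$ and sends it one new item. The server outputs an answer $a_t$ after each step. The adversary is adaptive: its choice at step $t$ may depend on all previous items and all previous outputs of the server. The goal is for the server to output, at all times simultaneously, a $(1\pm\alpha)$-approximation of the total number of items received so far. The mechanism runs in rounds. Each round starts with the exact current count $N_0$ known to all parties and uses fresh randomness. Site $i$ in a round: - It draws $k'=Ck$ i.i.d. thresholds $r_{i1},\dots,r_{ik'}$ uniform on $\{1,\dots,\Delta\}$, where $\Delta=\alpha N_0/(8C\sqrt{k})$. - It counts the items it receives in the round, dividing them into consecutive blocks of $\Delta$ items. - In block $j$, it sends one bit to the server the first time its offset within the block exceeds $r_{ij}$. - If the block index exceeds $k'$, it signals the server to end the round. Server in a round: - It sets $\varepsilon=C/\sqrt{k}$,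 $T=2C\sqrt{k}$, and a noisy threshold $\hat T=T+\mathsf{Lap}(4/\varepsilon)$. - It runs phases $j=1,2,\dots$. In phase $j$ it counts the bits received in that phase, $c_j$. While $c_j<\hat T$ it keeps outputting its previous estimate, which is initially $N_0$. - When $c_j\ge\hat T$, it feeds $c_j$ as the $j$-th input to a binary-mechanism private counter with horizon $\sqrt{k}$ and privacy parameter $\varepsilon/4$. It obtains a noisy prefix sum $\hat b_j$, outputs $N_0+\Delta\hat b_j$, draws a fresh threshold $\hat T$, and moves to phase $j+1$. - After $\sqrt{k}$ phases, or when signalled by a site, it collects all exact local counts, computes the true total, broadcasts it, and starts a new round. The per-round failure parameter $\beta$ is set to $\delta$ divided by $\sqrt{k}$ times the number of rounds, and the number of rounds is $O(\log N/(\alpha\sqrt{k}))$. $\mathsf{Lap}(b)$ denotes the Laplace distribution with density $\frac{1}{2b}e^{-|x|/b}$. *)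

theory Defs
  imports "HOL-Probability.Probability"
begin

text \<open>All logarithms are to base 2.  The protocol is parameterized by the number \<open>k\<close> of
  sites, the accuracy \<open>\<alpha>\<close> and the number \<open>C\<close>; the latter is instantiated by
  \<open>C_param\<close>, which depends on the number \<open>N\<close> of items and the failure probability \<open>\<delta>\<close>.
  Quantities that have to be integers are rounded: the block length and the horizon
  \<open>sqrt k\<close> downwards, the number of blocks \<open>C k\<close> upwards.\<close>

definition C_param :: "nat \<Rightarrow> real \<Rightarrow> real \<Rightarrow> nat \<Rightarrow> real" where
  "C_param k \<alpha> \<delta> N =
     sqrt (((log 2 (sqrt (real k))) powr (3/2) + 1) *
           log 2 (8 * sqrt (real k) * log 2 (real N) / (\<alpha> * \<delta>)))"

definition priv :: "nat \<Rightarrow> real \<Rightarrow> real" where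
  "priv k C = C / sqrt (real k)"

definition horizon :: "nat \<Rightarrow> nat" where
  "horizon k = nat \<lfloor>sqrt (real k)\<rfloor>"

definition block_len :: "nat \<Rightarrow> real \<Rightarrow> real \<Rightarrow> nat \<Rightarrow> nat" where
  "block_len k \<alpha> C n0 = nat \<lfloor>\<alpha> * real n0 / (8 * C * sqrt (real k))\<rfloor>"

definition num_blocks :: "nat \<Rightarrow> real \<Rightarrow> nat" where
  "num_blocks k C = nat \<lceil>C * real k\<rceil>"

definition laplace :: "real \<Rightarrow> real measure" where
  "laplace b = density lborel (\<lambda>x. ennreal (exp (- \<bar>x\<bar> / b) / (2 * b)))"

text \<open>The binary mechanism with horizon \<open>h\<close> keeps one noisy sum for every dyadic interval;
  an index lies in at most \<open>bm_levels h\<close> dyadic intervals contained in \<open>{1..h}\<close>, so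
  with privacy parameter \<open>e\<close> every noisy sum gets noise of scale \<open>bm_levels h / e\<close>.
  The prefix \<open>{1..j}\<close> is the disjoint union of the dyadic intervals that belong to the
  binary digits 1 of \<open>j\<close>; here \<open>x i\<close> is the \<open>i\<close>-th input and \<open>\<eta> l q\<close>
  the noise of \<open>dyadic l q\<close>, which is shared by all prefixes that use this interval.\<close>

definition bm_levels :: "nat \<Rightarrow> nat" where
  "bm_levels h = nat \<lfloor>log 2 (real h)\<rfloor> + 1"

definition dyadic :: "nat \<Rightarrow> nat \<Rightarrow> nat set" where
  "dyadic l q = {q * 2 ^ l <.. (q + 1) * 2 ^ l}"

definition bm_prefix :: "nat \<Rightarrow> (nat \<Rightarrow> nat \<Rightarrow> real) \<Rightarrow> (nat \<Rightarrow> nat) \<Rightarrow> nat \<Rightarrow> real" where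
  "bm_prefix h \<eta> x j =
     (\<Sum>l | l < bm_levels h \<and> odd (j div 2 ^ l).
        (\<Sum>i\<in>dyadic l (j div 2 ^ l - 1). real (x i)) + \<eta> l (j div 2 ^ l - 1))"

text \<open>All random draws are collected in a tape of independent entries, indexed by the
  round \<open>m\<close> for which they are drawn:
  \<^item> \<open>(m, i, j, d)\<close>: the threshold of site \<open>i\<close> for block \<open>j\<close>, uniform on \<open>{1..d}\<close>;
    the round reads only the entries in which \<open>d\<close> is its block length, so these are fresh
    uniform draws although the block length depends on the past (no entry with \<open>d = 0\<close>
    is ever read);
  \<^item> \<open>(m, j)\<close>: the noise of the server's threshold in phase \<open>j\<close>;
  \<^item> \<open>(m, l, q)\<close>: the noise of \<open>dyadic l q\<close> in the binary mechanism.\<close>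

type_synonym tape =
  "(nat \<times> nat \<times> nat \<times> nat \<Rightarrow> nat) \<times> (nat \<times> nat \<Rightarrow> real) \<times> (nat \<times> nat \<times> nat \<Rightarrow> real)"

definition tape_measure :: "nat \<Rightarrow> real \<Rightarrow> tape measure" where
  "tape_measure k C =
     (\<Pi>\<^sub>M (m, i, j, d)\<in>UNIV. measure_pmf (pmf_of_set {1..d})) \<Otimes>\<^sub>M
     (\<Pi>\<^sub>M (m, j)\<in>UNIV. laplace (4 / priv k C)) \<Otimes>\<^sub>M
     (\<Pi>\<^sub>M (m, l, q)\<in>UNIV. laplace (real (bm_levels (horizon k)) / (priv k C / 4)))"

text \<open>\<open>Item\<close> is used only before the first round: the block length of a round has to be
  positive, and until the count \<open>n0\<close> is large enough for that, every item is forwarded to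
  the server.\<close>

datatype msg = Item | Bit | End_Round

text \<open>The message of a site upon its \<open>n\<close>-th item of the round that started with count
  \<open>n0\<close>, where \<open>r j\<close> is its threshold for block \<open>j\<close>.  The offset of an item within
  its block ranges over \<open>{1..d}\<close>, as do the thresholds, and the bit is sent when the offset
  reaches the threshold; hence it has been sent with probability \<open>o / d\<close> after
  \<open>o\<close> items of the block, and surely at the end of the block.  (With a strict comparison the threshold \<open>d\<close> would
  never lead to a bit.)\<close>

definition site_msg ::
  "nat \<Rightarrow> real \<Rightarrow> real \<Rightarrow> nat \<Rightarrow> (nat \<Rightarrow> nat) \<Rightarrow> nat \<Rightarrow> msg option" where
  "site_msg k \<alpha> C n0 r n =
     (let d = block_len k \<alpha> C n0; j = (n - 1) div d + 1; off = (n - 1) mod d + 1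
      in if d = 0 then Some Item
         else if j > num_blocks k C then Some End_Round
         else if off = r j then Some Bit
         else None)"

record conf =
  rnd :: nat
  start_count :: nat          \<comment> \<open>exact count at the start of the round\<close>
  local_count :: "nat \<Rightarrow> nat" \<comment> \<open>items of the round, for every site\<close>
  phase :: nat
  bit_count :: nat            \<comment> \<open>bits received in the phase\<close>
  counter_in :: "nat \<Rightarrow> nat"  \<comment> \<open>inputs of the private counter, indexed by phase\<close>
  answer :: real
  words :: nat                \<comment> \<open>total communication so far\<close>

definition init_conf :: conf where
  "init_conf = \<lparr>rnd = 0, start_count = 0, local_count = (\<lambda>_. 0), phase = 1, bit_count = 0,
     counter_in = (\<lambda>_. 0), answer = 0, words = 0\<rparr>"

text \<open>Collecting the local counts takes a request and a reply for every site, and the new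
  count is then sent to every site.\<close>

definition restart :: "nat \<Rightarrow> conf \<Rightarrow> conf" where
  "restart k s =
     (let n = start_count s + (\<Sum>i<k. local_count s i)
      in s\<lparr>rnd := rnd s + 1, start_count := n, local_count := (\<lambda>_. 0), phase := 1,
           bit_count := 0, counter_in := (\<lambda>_. 0), answer := real n, words := words s + 3 * k\<rparr>)"

text \<open>An item before the first round; the first round starts, with a broadcast of the
  count, as soon as the block length is positive.\<close>

definition forward :: "nat \<Rightarrow> real \<Rightarrow> real \<Rightarrow> conf \<Rightarrow> conf" where
  "forward k \<alpha> C s =
     (let n = start_count s + 1
      in s\<lparr>start_count := n, answer := real n,
           words := words s + 1 + (if block_len k \<alpha> C n > 0 then k else 0)\<rparr>)"

text \<open>The server compares its counter with the noisy threshold once in every time step.\<close>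

definition check_phase :: "nat \<Rightarrow> real \<Rightarrow> real \<Rightarrow> tape \<Rightarrow> conf \<Rightarrow> conf" where
  "check_phase k \<alpha> C \<omega> s =
     (case \<omega> of (thr, lapT, lapB) \<Rightarrow>
        if real (bit_count s) < 2 * C * sqrt (real k) + lapT (rnd s, phase s) then s
        else
          (let x = (counter_in s)(phase s := bit_count s);
               b = bm_prefix (horizon k) (\<lambda>l q. lapB (rnd s, l, q)) x (phase s);
               s' = s\<lparr>phase := phase s + 1, bit_count := 0, counter_in := x,
                      answer := real (start_count s)
                                + real (block_len k \<alpha> C (start_count s)) * b\<rparr>
           in if phase s' > horizon k then restart k s' else s'))"

definition step :: "nat \<Rightarrow> real \<Rightarrow> real \<Rightarrow> tape \<Rightarrow> nat option \<Rightarrow> conf \<Rightarrow> conf" where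
  "step k \<alpha> C \<omega> a s =
     (if block_len k \<alpha> C (start_count s) = 0
      then (case a of None \<Rightarrow> s | Some i \<Rightarrow> forward k \<alpha> C s)
      else
        (case a of
           None \<Rightarrow> check_phase k \<alpha> C \<omega> s
         | Some i \<Rightarrow>
             (let n = local_count s i + 1;
                  s' = s\<lparr>local_count := (local_count s)(i := n)\<rparr>
              in case site_msg k \<alpha> C (start_count s) (\<lambda>j. fst \<omega> (rnd s, i, j,
                          block_len k \<alpha> C (start_count s))) n of
                   None \<Rightarrow> check_phase k \<alpha> C \<omega> s'
                 | Some End_Round \<Rightarrow> restart k (s'\<lparr>words := words s' + 1\<rparr>)
                 | Some _ \<Rightarrow> check_phase k \<alpha> C \<omega>
                     (s'\<lparr>bit_count := bit_count s' + 1, words := words s' + 1\<rparr>))))"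

text \<open>A history assigns to every past time step the choice of the adversary and the answer
  of the server in this step.\<close>

type_synonym history = "nat \<Rightarrow> nat option \<times> real"

definition history_space :: "nat \<Rightarrow> history measure" where
  "history_space t = (\<Pi>\<^sub>M s\<in>{..<t}. count_space UNIV \<Otimes>\<^sub>M borel)"

definition item_count :: "history \<Rightarrow> nat \<Rightarrow> nat" where
  "item_count h t = card {s. s < t \<and> fst (h s) \<noteq> None}"

text \<open>The choice of the adversary in step \<open>t\<close> is a measurable function of the history
  before \<open>t\<close> and of private coins drawn from \<open>S\<close>; it sends at most \<open>N\<close> items.\<close>

definition adversary ::
  "nat \<Rightarrow> nat \<Rightarrow> real measure \<Rightarrow> (nat \<Rightarrow> real \<times> history \<Rightarrow> nat option) \<Rightarrow> bool" where
  "adversary k N S adv \<longleftrightarrow>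
     prob_space S \<and> sets S = sets borel \<and>
     (\<forall>t. adv t \<in> S \<Otimes>\<^sub>M history_space t \<rightarrow>\<^sub>M count_space UNIV) \<and>
     (\<forall>t z h i. adv t (z, h) = Some i \<longrightarrow> i < k) \<and>
     (\<forall>t z h. item_count h t \<ge> N \<longrightarrow> adv t (z, h) = None)"

text \<open>Configuration and history after \<open>t\<close> steps.  The history handed to the adversary is
  \<open>undefined\<close> from time \<open>t\<close> on, as required by \<open>history_space t\<close>.\<close>

primrec run ::
  "nat \<Rightarrow> real \<Rightarrow> real \<Rightarrow> (nat \<Rightarrow> real \<times> history \<Rightarrow> nat option) \<Rightarrow> real \<Rightarrow> tape \<Rightarrow> nat
   \<Rightarrow> conf \<times> history" where
  "run k \<alpha> C adv z \<omega> 0 = (init_conf, \<lambda>_. undefined)"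
| "run k \<alpha> C adv z \<omega> (Suc t) =
     (case run k \<alpha> C adv z \<omega> t of (s, h) \<Rightarrow>
        let a = adv t (z, h); s' = step k \<alpha> C \<omega> a s
        in (s', h(t := (a, answer s'))))"

definition run_conf where
  "run_conf k \<alpha> C adv z \<omega> t = fst (run k \<alpha> C adv z \<omega> t)"

definition run_items where
  "run_items k \<alpha> C adv z \<omega> t = item_count (snd (run k \<alpha> C adv z \<omega> t)) t"

end

(*
  Within a round, the adversary sees a bit of a site only through the times at which phases end and
  through the noisy prefix sums. If one threshold of a site is changed, its bit moves from one phase
  to another; shifting the two noisy thresholds of the server and the noise of the dyadic intervals
  that separate these phases hides this, and changes probabilities by a factor of at most exp(priv).
  The exception is a site whose item ends a phase, but there are at most sqrt k of these per
  round. Hence, given everything that the adversary has seen, the bits of the unfinished blocks are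
  almost independent with almost the right bias, and a moment generating function argument, with one
  factor per threshold, shows that bits times block length and items differ by at most C sqrt k
  blocks, up to an exponentially small probability. This is applied at the first time of a phase at
  which the answer is inaccurate; so a union bound over phases, not over time steps, is enough.
  If k is at most C^2, then the number of sites bounds the difference trivially. The remaining
  error consists of independent Laplace variables with fixed indices. Finally, a round whose
  noisy thresholds have sum at least 2k multiplies the count by 1 + alpha sqrt k / (16 C), which
  bounds the number of rounds, and a logarithmic potential of the count at the start of a round
  bounds the number of bits.
*)
theory Submission
  imports Defs
begin

subsection \<open>The Laplace distribution\<close>

text \<open>Adaptivity is the obstacle: how far a site has come in its block may depend on earlier
  answers, so offsets and thresholds are not independent. No joint conditional law is computed. On
  every event that depends only on the view and on the other thresholds, the values of one threshold
  have weights within a factor \<open>exp eps\<close> of each other. This statement about one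
  coordinate suffices to remove the factors of a moment generating function one after the other. An
  item that ends a phase is exempted for this reason: if its bit is taken away and the threshold
  lowered by one, the phase can already end before the item arrives. The constant 8 in the block
  length is the error budget in units of \<open>C * sk\<close>: 7 for the noise of a prefix sum plus
  1 for the deviation limits overestimates, while 2 for the threshold, 1 for the deviation and 5 for
  the difference of the two noises limits underestimates. The failure probability is split into
  \<delta>/2 for noise, \<delta>/4 for deviations and \<delta>/4 for short rounds. Explicit numbers
  are unavoidable, because for small \<open>k\<close> there is no asymptotic slack.\<close>

lemma nn_integral_exp_tail:
  fixes a c :: real
  assumes "c > 0"
  shows "(\<integral>\<^sup>+x. ennreal (exp (- c * x)) * indicator {a..} x \<partial>lborel) = ennreal (exp (- c * a) / c)"
proof -
  have "(\<integral>\<^sup>+x. ennreal (exp (- c * x)) * indicator {a..} x \<partial>lborel) =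
      ennreal (0 - (- exp (- c * a) / c))"
  proof (rule nn_integral_FTC_atLeast)
    have "((\<lambda>x. exp (- c * x)) \<longlongrightarrow> 0) at_top"
      using assms
      by (intro filterlim_compose[OF exp_at_bot]
            filterlim_tendsto_neg_mult_at_bot[OF tendsto_const _ filterlim_ident]) auto
    from tendsto_divide[OF tendsto_minus[OF this] tendsto_const[of c]]
    show "((\<lambda>x. - exp (- c * x) / c) \<longlongrightarrow> 0) at_top" using assms by simp
  qed (use assms in \<open>auto intro!: derivative_eq_intros\<close>)
  thus ?thesis by simp
qed

lemma space_laplace [simp]: "space (laplace b) = UNIV"
  and sets_laplace [simp, measurable_cong]: "sets (laplace b) = sets borel"
  by (simp_all add: laplace_def)

lemma nn_integral_laplace:
  assumes [measurable]: "g \<in> borel_measurable borel"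
  shows "(\<integral>\<^sup>+x. g x \<partial>laplace b) =
    (\<integral>\<^sup>+x. ennreal (exp (- \<bar>x\<bar> / b) / (2 * b)) * g x \<partial>lborel)"
  unfolding laplace_def by (rule nn_integral_density) auto

lemma nn_integral_laplace_minus:
  assumes [measurable]: "g \<in> borel_measurable borel"
  shows "(\<integral>\<^sup>+x. g (- x) \<partial>laplace b) = (\<integral>\<^sup>+x. g x \<partial>laplace b)"
proof -
  have "(\<integral>\<^sup>+x. g x \<partial>laplace b) =
      (\<integral>\<^sup>+x. ennreal (exp (- \<bar>x\<bar> / b) / (2 * b)) * g x \<partial>distr lborel borel uminus)"
    by (simp add: nn_integral_laplace lborel_distr_uminus)
  also have "\<dots> = (\<integral>\<^sup>+x. g (- x) \<partial>laplace b)"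
    by (subst nn_integral_distr) (auto simp: nn_integral_laplace)
  finally show ?thesis ..
qed

text \<open>Each half line is an exponential integral. The left half is the mirror image of the
  right half with the opposite sign of \<theta>, and
  \<open>1 / (2 * (1 - \<theta> * b)) + 1 / (2 * (1 + \<theta> * b))\<close> is the result.\<close>

lemma laplace_mgf:
  assumes "b > 0" "\<bar>\<theta>\<bar> * b < 1"
  shows "(\<integral>\<^sup>+x. ennreal (exp (\<theta> * x)) \<partial>laplace b) = ennreal (1 / (1 - (\<theta> * b)\<^sup>2))"
proof -
  have half: "(\<integral>\<^sup>+x. ennreal (exp (t * x)) * indicator {0..} x \<partial>laplace b) = ennreal (1 / (2 * (1 - t * b)))"
    if "\<bar>t\<bar> * b < 1" for t
  proof -
    have tb: "t * b < 1" using that assms(1) by (smt (verit) mult_right_mono)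
    have c: "1 / b - t > 0" using tb assms(1) by (simp add: field_simps)
    have "(\<integral>\<^sup>+x. ennreal (exp (t * x)) * indicator {0..} x \<partial>laplace b) =
        (\<integral>\<^sup>+x. ennreal (1 / (2 * b)) * (ennreal (exp (- (1 / b - t) * x)) * indicator {0..} x) \<partial>lborel)"
      using assms(1)
      by (auto simp: nn_integral_laplace ennreal_mult'[symmetric] exp_add[symmetric] field_simps
               intro!: nn_integral_cong split: split_indicator)
    also have "\<dots> = ennreal (1 / (2 * b)) * ennreal (exp (- (1 / b - t) * 0) / (1 / b - t))"
      by (subst nn_integral_cmult, measurable) (simp only: nn_integral_exp_tail[OF c])
    also have "\<dots> = ennreal (1 / (2 * (1 - t * b)))"
      using assms(1) c by (simp add: ennreal_mult'[symmetric] field_simps)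
    finally show ?thesis .
  qed
  have "(\<integral>\<^sup>+x. ennreal (exp (\<theta> * x)) \<partial>laplace b) =
      (\<integral>\<^sup>+x. ennreal (exp (\<theta> * x)) * indicator {0..} x + ennreal (exp (\<theta> * x)) * indicator {..<0} x \<partial>laplace b)"
    by (intro nn_integral_cong) (auto split: split_indicator)
  also have "\<dots> = (\<integral>\<^sup>+x. ennreal (exp (\<theta> * x)) * indicator {0..} x \<partial>laplace b) +
       (\<integral>\<^sup>+x. ennreal (exp (\<theta> * x)) * indicator {..<0} x \<partial>laplace b)"
    by (rule nn_integral_add) auto
  also have "(\<integral>\<^sup>+x. ennreal (exp (\<theta> * x)) * indicator {..<0} x \<partial>laplace b) =
       (\<integral>\<^sup>+x. ennreal (exp (- \<theta> * x)) * indicator {0<..} x \<partial>laplace b)"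
    by (subst nn_integral_laplace_minus[symmetric]) (auto intro!: nn_integral_cong split: split_indicator)
  \<comment> \<open>\<open>half\<close> concerns the closed half line; the two differ by the null
    set of the point 0.\<close>
  also have "\<dots> = (\<integral>\<^sup>+x. ennreal (exp (- \<theta> * x)) * indicator {0..} x \<partial>laplace b)"
    unfolding laplace_def
    by (intro nn_integral_cong_AE, subst AE_density)
       (auto intro: AE_mp[OF AE_lborel_singleton[of 0]] split: split_indicator)
  also note half[of \<theta>]
  also note half[of "- \<theta>"]
  also have "ennreal (1 / (2 * (1 - \<theta> * b))) + ennreal (1 / (2 * (1 - - \<theta> * b))) =
      ennreal (1 / (1 - (\<theta> * b)\<^sup>2))"
  proof -
    have *: "\<bar>\<theta> * b\<bar> < 1" using assms by (simp add: abs_mult)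
    hence "1 - \<theta> * b > 0" "1 + \<theta> * b > 0" by linarith+
    moreover have "1 - (\<theta> * b)\<^sup>2 = (1 - \<theta> * b) * (1 + \<theta> * b)"
      by (simp add: power2_eq_square algebra_simps)
    ultimately show ?thesis
      by (subst ennreal_plus[symmetric]) (auto simp: divide_simps, simp add: algebra_simps)
  qed
  finally show ?thesis using assms by simp
qed

lemma prob_space_laplace:
  assumes "b > 0" shows "prob_space (laplace b)"
proof
  show "emeasure (laplace b) (space (laplace b)) = 1"
    using laplace_mgf[of b 0] assms by simp
qed

lemma laplace_tail:
  assumes "b > 0" "y \<ge> 0"
  shows "emeasure (laplace b) {y<..} \<le> ennreal (exp (- y / b) / 2)"
proof -
  have "emeasure (laplace b) {y<..} = (\<integral>\<^sup>+x. indicator {y<..} x \<partial>laplace b)"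
    by simp
  also have "\<dots> \<le> (\<integral>\<^sup>+x. ennreal (1 / (2 * b)) * (ennreal (exp (- (1 / b) * x)) * indicator {y..} x) \<partial>lborel)"
    using assms
    by (subst nn_integral_laplace)
       (auto simp: ennreal_mult'[symmetric] intro!: nn_integral_mono split: split_indicator)
  also have "\<dots> = ennreal (1 / (2 * b)) * ennreal (exp (- (1 / b) * y) / (1 / b))"
    using assms by (subst nn_integral_cmult) (simp_all add: nn_integral_exp_tail[of "1 / b", simplified])
  also have "\<dots> = ennreal (exp (- y / b) / 2)"
    using assms by (simp add: ennreal_mult'[symmetric])
  finally show ?thesis .
qed

text \<open>This holds with constant 1 up to and including the critical rate \<open>1 / b\<close>,
  and for every real \<open>y\<close>. A Chernoff bound would cost a factor that diverges at the
  critical rate.\<close>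

lemma laplace_tail':
  assumes "b > 0" "0 \<le> \<theta>" "\<theta> \<le> 1 / b"
  shows "emeasure (laplace b) {y<..} \<le> ennreal (exp (- \<theta> * y))"
proof (cases "y \<ge> 0")
  case True
  have "\<theta> * y \<le> 1 / b * y" by (rule mult_right_mono) (use assms True in auto)
  hence "exp (- y / b) \<le> exp (- \<theta> * y)" by simp
  hence "exp (- y / b) / 2 \<le> exp (- \<theta> * y)"
    using exp_gt_zero[of "- y / b"] by linarith
  thus ?thesis using laplace_tail[OF assms(1) True] by (metis order_trans ennreal_leI)
next
  case False
  have "emeasure (laplace b) {y<..} \<le> 1"
    using prob_space.emeasure_le_1[OF prob_space_laplace[OF assms(1)]] .
  also have "1 \<le> ennreal (exp (- \<theta> * y))"
    using False assms by (simp add: mult_nonneg_nonpos)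
  finally show ?thesis .
qed

text \<open>The privacy of the Laplace mechanism: by the triangle inequality the density at
  \<open>x\<close> is at most \<open>exp (\<bar>v\<bar> / b)\<close> times the density at
  \<open>v + x\<close>.\<close>

lemma nn_integral_laplace_shift:
  assumes "b > 0" and [measurable]: "g \<in> borel_measurable borel"
  shows "(\<integral>\<^sup>+x. g (x + v) \<partial>laplace b) \<le> ennreal (exp (\<bar>v\<bar> / b)) * (\<integral>\<^sup>+x. g x \<partial>laplace b)"
proof -
  have "(\<integral>\<^sup>+x. g x \<partial>laplace b) =
      (\<integral>\<^sup>+x. ennreal (exp (- \<bar>x\<bar> / b) / (2 * b)) * g x \<partial>distr lborel borel ((+) v))"
    by (simp add: nn_integral_laplace lborel_distr_plus)
  also have "\<dots> = (\<integral>\<^sup>+x. ennreal (exp (- \<bar>v + x\<bar> / b) / (2 * b)) * g (v + x) \<partial>lborel)"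
    by (subst nn_integral_distr) auto
  finally have *: "(\<integral>\<^sup>+x. g x \<partial>laplace b) = \<dots>" .
  have "(\<integral>\<^sup>+x. g (x + v) \<partial>laplace b) = (\<integral>\<^sup>+x. ennreal (exp (- \<bar>x\<bar> / b) / (2 * b)) * g (x + v) \<partial>lborel)"
    by (simp add: nn_integral_laplace)
  also have "\<dots> \<le> (\<integral>\<^sup>+x. ennreal (exp (\<bar>v\<bar> / b)) *
      (ennreal (exp (- \<bar>v + x\<bar> / b) / (2 * b)) * g (v + x)) \<partial>lborel)"
  proof (intro nn_integral_mono)
    fix x :: real
    have "- \<bar>x\<bar> / b \<le> (\<bar>v\<bar> + - \<bar>v + x\<bar>) / b"
      using assms(1) by (intro divide_right_mono) auto
    hence "exp (- \<bar>x\<bar> / b) \<le> exp (\<bar>v\<bar> / b) * exp (- \<bar>v + x\<bar> / b)"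
      by (simp add: exp_add[symmetric] add_divide_distrib diff_divide_distrib)
    hence "exp (- \<bar>x\<bar> / b) / (2 * b) \<le> exp (\<bar>v\<bar> / b) * (exp (- \<bar>v + x\<bar> / b) / (2 * b))"
      using assms(1) by (simp add: divide_right_mono)
    hence "ennreal (exp (- \<bar>x\<bar> / b) / (2 * b)) \<le> ennreal (exp (\<bar>v\<bar> / b)) * ennreal (exp (- \<bar>v + x\<bar> / b) / (2 * b))"
      by (subst ennreal_mult'[symmetric]) (auto intro: ennreal_leI)
    from mult_right_mono[OF this, of "g (x + v)"]
    show "ennreal (exp (- \<bar>x\<bar> / b) / (2 * b)) * g (x + v)
         \<le> ennreal (exp (\<bar>v\<bar> / b)) * (ennreal (exp (- \<bar>v + x\<bar> / b) / (2 * b)) * g (v + x))"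
      by (simp add: add.commute mult.assoc)
  qed
  also have "\<dots> = ennreal (exp (\<bar>v\<bar> / b)) * (\<integral>\<^sup>+x. g x \<partial>laplace b)"
    unfolding * by (rule nn_integral_cmult) auto
  finally show ?thesis .
qed

subsection \<open>Resampling and shifting coordinates of a product measure\<close>

text \<open>Overwriting one coordinate by an independent copy leaves the product measure unchanged.
  So one coordinate can be integrated first, although the index set is infinite and \<open>g\<close>
  reads all coordinates.\<close>

lemma nn_integral_PiM_resample:
  assumes M: "\<And>i. prob_space (M i)" and [measurable]: "g \<in> borel_measurable (PiM UNIV M)"
  shows "(\<integral>\<^sup>+w. g w \<partial>PiM UNIV M) = (\<integral>\<^sup>+w. (\<integral>\<^sup>+x. g (w(i := x)) \<partial>M i) \<partial>PiM UNIV M)"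
proof -
  interpret Mi: prob_space "M i" by (rule M)
  interpret P: prob_space "PiM UNIV M" by (rule prob_space_PiM) (rule M)
  interpret pair_sigma_finite "M i" "PiM UNIV M" ..
  have eq: "distr (M i \<Otimes>\<^sub>M PiM UNIV M) (PiM UNIV M) (\<lambda>(x, X). X(i := x)) = PiM UNIV M"
    using distr_pair_PiM_eq_PiM[of UNIV M i] M by simp
  have [measurable]: "(\<lambda>(x, X). X(i := x)) \<in> M i \<Otimes>\<^sub>M PiM UNIV M \<rightarrow>\<^sub>M PiM UNIV M"
    using measurable_fun_upd[where I = UNIV and J = UNIV and M = M and i = i and f = snd and h = fst
        and N = "M i \<Otimes>\<^sub>M PiM UNIV M"]
    by (simp add: case_prod_beta')
  have "(\<integral>\<^sup>+w. g w \<partial>PiM UNIV M) = (\<integral>\<^sup>+y. g ((\<lambda>(x, X). X(i := x)) y) \<partial>(M i \<Otimes>\<^sub>M PiM UNIV M))"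
    by (subst eq[symmetric], subst nn_integral_distr) auto
  also have "\<dots> = (\<integral>\<^sup>+y. (\<lambda>(x, X). g (X(i := x))) y \<partial>(M i \<Otimes>\<^sub>M PiM UNIV M))"
    by (intro nn_integral_cong) (auto simp: case_prod_beta)
  also have "\<dots> = (\<integral>\<^sup>+w. (\<integral>\<^sup>+x. g (w(i := x)) \<partial>M i) \<partial>PiM UNIV M)"
    by (subst nn_integral_snd[symmetric])  (auto simp: case_prod_beta')
  finally show ?thesis .
qed

lemma nn_integral_PiM_prod:
  assumes M: "\<And>i. prob_space (M i)" and "finite J"
    and [measurable]: "\<And>i. i \<in> J \<Longrightarrow> f i \<in> borel_measurable (M i)"
  shows "(\<integral>\<^sup>+w. (\<Prod>i\<in>J. f i (w i)) \<partial>PiM UNIV M) = (\<Prod>i\<in>J. (\<integral>\<^sup>+x. f i x \<partial>M i))"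
  using assms(2,3)
proof (induction J)
  case empty
  interpret prob_space "PiM UNIV M" by (rule prob_space_PiM) (rule M)
  show ?case by (simp add: emeasure_space_1)
next
  case (insert i J)
  note [measurable] = insert.prems
  have "(\<integral>\<^sup>+w. (\<Prod>q\<in>insert i J. f q (w q)) \<partial>PiM UNIV M) =
      (\<integral>\<^sup>+w. (\<integral>\<^sup>+x. f i x * (\<Prod>q\<in>J. f q (w q)) \<partial>M i) \<partial>PiM UNIV M)"
  proof (subst nn_integral_PiM_resample[OF M, where i = i])
    show "(\<lambda>w. \<Prod>q\<in>insert i J. f q (w q)) \<in> borel_measurable (PiM UNIV M)"
      using insert.prems by measurable
    show "(\<integral>\<^sup>+ w. \<integral>\<^sup>+ x. (\<Prod>q\<in>insert i J. f q ((w(i := x)) q)) \<partial>M i \<partial>PiM UNIV M) =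
        (\<integral>\<^sup>+w. (\<integral>\<^sup>+x. f i x * (\<Prod>q\<in>J. f q (w q)) \<partial>M i) \<partial>PiM UNIV M)"
      using insert.hyps by (intro nn_integral_cong) (auto intro!: prod.cong arg_cong2[where f = "(*)"])
  qed
  also have "\<dots> = (\<integral>\<^sup>+w. (\<integral>\<^sup>+x. f i x \<partial>M i) * (\<Prod>q\<in>J. f q (w q)) \<partial>PiM UNIV M)"
    by (intro nn_integral_cong nn_integral_multc insert.prems) auto
  also have "\<dots> = (\<integral>\<^sup>+x. f i x \<partial>M i) * (\<integral>\<^sup>+w. (\<Prod>q\<in>J. f q (w q)) \<partial>PiM UNIV M)"
    using insert.prems by (intro nn_integral_cmult) measurable
  also have "\<dots> = (\<Prod>q\<in>insert i J. (\<integral>\<^sup>+x. f q x \<partial>M q))"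
    using insert by simp
  finally show ?case .
qed

lemma nn_integral_PiM_laplace_shift1:
  assumes b: "b > 0" and g[measurable]: "g \<in> borel_measurable (PiM UNIV (\<lambda>_. laplace b))"
  shows "(\<integral>\<^sup>+w. g (w(i := w i + v)) \<partial>PiM UNIV (\<lambda>_. laplace b))
    \<le> ennreal (exp (\<bar>v\<bar> / b)) * (\<integral>\<^sup>+w. g w \<partial>PiM UNIV (\<lambda>_. laplace b))"
proof -
  let ?P = "PiM UNIV (\<lambda>_. laplace b)"
  note pr = prob_space_laplace[OF b]
  have upd[measurable]: "(\<lambda>w. w(i := w i + v)) \<in> ?P \<rightarrow>\<^sub>M ?P"
    using measurable_fun_upd[where I = UNIV and J = UNIV and M = "\<lambda>_. laplace b" and i = i and f = "\<lambda>x. x" and h = "\<lambda>w. w i + v"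
        and N = ?P] by simp
  have upd2: "(\<lambda>x. w(i := x)) \<in> laplace b \<rightarrow>\<^sub>M ?P" if "w \<in> space ?P" for w
    by (rule measurable_fun_upd[where J = UNIV]) (use that in auto)
  have "(\<integral>\<^sup>+w. g (w(i := w i + v)) \<partial>?P) = (\<integral>\<^sup>+w. (\<integral>\<^sup>+x. g (w(i := x + v)) \<partial>laplace b) \<partial>?P)"
    by (subst nn_integral_PiM_resample[OF pr, where i = i]) (auto simp del: fun_upd_apply simp: fun_upd_same)
  also have "\<dots> \<le> (\<integral>\<^sup>+w. ennreal (exp (\<bar>v\<bar> / b)) * (\<integral>\<^sup>+x. g (w(i := x)) \<partial>laplace b) \<partial>?P)"
  proof (intro nn_integral_mono)
    fix w :: "'a \<Rightarrow> real" assume w: "w \<in> space ?P"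
    have "(\<lambda>x. g (w(i := x))) \<in> borel_measurable (laplace b)"
      using measurable_compose[OF upd2[OF w] g] .
    hence "(\<lambda>x. g (w(i := x))) \<in> borel_measurable borel" by (simp add: laplace_def)
    from nn_integral_laplace_shift[OF b this, of v]
    show "(\<integral>\<^sup>+ x. g (w(i := x + v)) \<partial>laplace b) \<le> ennreal (exp (\<bar>v\<bar> / b)) * (\<integral>\<^sup>+x. g (w(i := x)) \<partial>laplace b)" .
  qed
  also have "\<dots> = ennreal (exp (\<bar>v\<bar> / b)) * (\<integral>\<^sup>+w. (\<integral>\<^sup>+x. g (w(i := x)) \<partial>laplace b) \<partial>?P)"
  proof (rule nn_integral_cmult)
    interpret sigma_finite_measure "laplace b"
      using pr by (rule prob_space_imp_sigma_finite)
    have "(\<lambda>(w, x). g (w(i := x))) \<in> borel_measurable (?P \<Otimes>\<^sub>M laplace b)"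
      unfolding case_prod_beta'
      by (rule measurable_compose[OF _ g], rule measurable_fun_upd[where J = UNIV]) auto
    thus "(\<lambda>w. \<integral>\<^sup>+ x. g (w(i := x)) \<partial>laplace b) \<in> borel_measurable ?P"
      by (rule borel_measurable_nn_integral)
  qed
  also have "(\<integral>\<^sup>+w. (\<integral>\<^sup>+x. g (w(i := x)) \<partial>laplace b) \<partial>?P) = (\<integral>\<^sup>+w. g w \<partial>?P)"
    by (rule nn_integral_PiM_resample[OF pr, symmetric]) simp
  finally show ?thesis .
qed

lemma nn_integral_PiM_laplace_shift:
  assumes b: "b > 0" and "finite J" and "\<And>q. q \<notin> J \<Longrightarrow> s q = 0"
    and "g \<in> borel_measurable (PiM UNIV (\<lambda>_. laplace b))"
  shows "(\<integral>\<^sup>+w. g (\<lambda>q. w q + s q) \<partial>PiM UNIV (\<lambda>_. laplace b))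
    \<le> ennreal (exp ((\<Sum>q\<in>J. \<bar>s q\<bar>) / b)) * (\<integral>\<^sup>+w. g w \<partial>PiM UNIV (\<lambda>_. laplace b))"
  using assms(2-4)
proof (induction J arbitrary: s g)
  case empty
  have "s = (\<lambda>_. 0)" using empty.prems by auto
  thus ?case by simp
next
  case (insert i J)
  let ?P = "PiM UNIV (\<lambda>_. laplace b)"
  note g[measurable] = insert.prems(2)
  define s' where "s' = s(i := 0)"
  have upd[measurable]: "(\<lambda>w. w(i := w i + s i)) \<in> ?P \<rightarrow>\<^sub>M ?P"
    using measurable_fun_upd[where I = UNIV and J = UNIV and M = "\<lambda>_. laplace b" and i = i and f = "\<lambda>x. x" and h = "\<lambda>w. w i + s i"
        and N = ?P] by simp
  have eq: "(\<lambda>q. w q + s q) = (\<lambda>w. w(i := w i + s i)) (\<lambda>q. w q + s' q)" for w :: "'a \<Rightarrow> real"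
    by (auto simp: s'_def)
  have "(\<integral>\<^sup>+w. g (\<lambda>q. w q + s q) \<partial>?P) = (\<integral>\<^sup>+w. (\<lambda>w. g (w(i := w i + s i))) (\<lambda>q. w q + s' q) \<partial>?P)"
    by (subst eq) simp
  also have "\<dots> \<le> ennreal (exp ((\<Sum>q\<in>J. \<bar>s' q\<bar>) / b)) * (\<integral>\<^sup>+w. g (w(i := w i + s i)) \<partial>?P)"
  proof (rule insert.IH)
    show "s' q = 0" if "q \<notin> J" for q
      using that insert.prems(1)[of q] by (auto simp: s'_def)
    show "(\<lambda>w. g (w(i := w i + s i))) \<in> borel_measurable ?P"
      by (rule measurable_compose[OF upd g])
  qed
  also have "(\<Sum>q\<in>J. \<bar>s' q\<bar>) = (\<Sum>q\<in>J. \<bar>s q\<bar>)"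
    using insert.hyps by (intro sum.cong) (auto simp: s'_def)
  also have "ennreal (exp ((\<Sum>q\<in>J. \<bar>s q\<bar>) / b)) * (\<integral>\<^sup>+w. g (w(i := w i + s i)) \<partial>?P) \<le>
      ennreal (exp ((\<Sum>q\<in>J. \<bar>s q\<bar>) / b)) * (ennreal (exp (\<bar>s i\<bar> / b)) * (\<integral>\<^sup>+w. g w \<partial>?P))"
    by (intro mult_left_mono nn_integral_PiM_laplace_shift1 b) auto
  also have "\<dots> = ennreal (exp ((\<Sum>q\<in>insert i J. \<bar>s q\<bar>) / b)) * (\<integral>\<^sup>+w. g w \<partial>?P)"
    using insert.hyps by (simp add: mult.assoc[symmetric] ennreal_mult'[symmetric] exp_add[symmetric] add_divide_distrib add.commute)
  finally show ?case .
qed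

text \<open>The variable \<open>q0\<close> is integrated first, by its tail bound; only the
  variables in \<open>J\<close> pay a moment generating factor. Thus one factor is saved, and a
  single variable may use the critical rate \<theta> = 1/b. The sign \<open>\<sigma>\<close> serves
  both tails.\<close>

lemma laplace_sum_tail:
  fixes b :: real
  assumes b: "b > 0" "0 \<le> \<theta>" "\<theta> \<le> 1 / b" "\<sigma> = 1 \<or> \<sigma> = -1"
    and "finite J" "q0 \<notin> J" "J \<noteq> {} \<Longrightarrow> \<theta> * b < 1"
  shows "emeasure (PiM UNIV (\<lambda>_. laplace b)) {w. s < (\<Sum>q\<in>insert q0 J. \<sigma> * w q)} \<le>
    ennreal (exp (- \<theta> * s) * (1 / (1 - (\<theta> * b)\<^sup>2)) ^ card J)"
proof -
  let ?P = "PiM UNIV (\<lambda>_. laplace b)"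
  note pr = prob_space_laplace[OF b(1)]
  let ?A = "{w. s < (\<Sum>q\<in>insert q0 J. \<sigma> * w q)}"
  have "?A = {w \<in> space ?P. s < (\<Sum>q\<in>insert q0 J. \<sigma> * w q)}"
    by (auto simp: space_PiM)
  also have "\<dots> \<in> sets ?P" by measurable
  finally have A[measurable]: "?A \<in> sets ?P" .
  have "emeasure ?P ?A = (\<integral>\<^sup>+w. indicator ?A w \<partial>?P)" by simp
  also have "\<dots> = (\<integral>\<^sup>+w. (\<integral>\<^sup>+x. indicator ?A (w(q0 := x)) \<partial>laplace b) \<partial>?P)"
    by (rule nn_integral_PiM_resample[OF pr]) measurable
  also have "\<dots> \<le> (\<integral>\<^sup>+w. ennreal (exp (- \<theta> * s)) * (\<Prod>q\<in>J. ennreal (exp ((\<theta> * \<sigma>) * w q))) \<partial>?P)"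
  proof (intro nn_integral_mono)
    fix w :: "'a \<Rightarrow> real"
    let ?y = "s - (\<Sum>q\<in>J. \<sigma> * w q)"
    have sm: "(\<Sum>q\<in>J. \<sigma> * (w(q0 := x)) q) = (\<Sum>q\<in>J. \<sigma> * w q)" for x
      using assms by (intro sum.cong) auto
    have ind: "indicator ?A (w(q0 := x)) = (indicator {?y<..} (\<sigma> * x) :: ennreal)" for x
      using assms by (auto simp: indicator_def sm simp del: fun_upd_apply simp: fun_upd_same)
    have "(\<integral>\<^sup>+x. indicator ?A (w(q0 := x)) \<partial>laplace b) = (\<integral>\<^sup>+x. indicator {?y<..} (\<sigma> * x) \<partial>laplace b)"
      by (simp only: ind)
    also have "\<dots> = (\<integral>\<^sup>+x. indicator {?y<..} x \<partial>laplace b)"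
      using b(4) nn_integral_laplace_minus[of "indicator {?y<..}" b] by auto
    also have "\<dots> = emeasure (laplace b) {?y<..}" by simp
    also have "\<dots> \<le> ennreal (exp (- \<theta> * ?y))" by (rule laplace_tail') (use b in auto)
    also have "exp (- \<theta> * ?y) = exp (- \<theta> * s) * (\<Prod>q\<in>J. exp ((\<theta> * \<sigma>) * w q))"
      using assms by (simp add: exp_sum[symmetric] exp_add[symmetric] sum_distrib_left sum_negf algebra_simps)
    also have "ennreal \<dots> = ennreal (exp (- \<theta> * s)) * (\<Prod>q\<in>J. ennreal (exp ((\<theta> * \<sigma>) * w q)))"
      by (simp add: ennreal_mult' prod_ennreal prod_nonneg)
    finally show "(\<integral>\<^sup>+x. indicator ?A (w(q0 := x)) \<partial>laplace b) \<le> \<dots>" .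
  qed
  also have "\<dots> = ennreal (exp (- \<theta> * s)) * (\<integral>\<^sup>+w. (\<Prod>q\<in>J. ennreal (exp ((\<theta> * \<sigma>) * w q))) \<partial>?P)"
    by (rule nn_integral_cmult) measurable
  also have "(\<integral>\<^sup>+w. (\<Prod>q\<in>J. ennreal (exp ((\<theta> * \<sigma>) * w q))) \<partial>?P) =
      (\<Prod>q\<in>J. (\<integral>\<^sup>+x. ennreal (exp ((\<theta> * \<sigma>) * x)) \<partial>laplace b))"
    by (rule nn_integral_PiM_prod[OF pr \<open>finite J\<close>]) measurable
  also have "\<dots> = (\<Prod>q\<in>J. ennreal (1 / (1 - (\<theta> * b)\<^sup>2)))"
  proof (intro prod.cong refl)
    fix q assume "q \<in> J"
    hence "\<theta> * b < 1" using assms by auto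
    hence "\<bar>\<theta> * \<sigma>\<bar> * b < 1" using b by auto
    from laplace_mgf[OF b(1) this]
    show "(\<integral>\<^sup>+x. ennreal (exp ((\<theta> * \<sigma>) * x)) \<partial>laplace b) = ennreal (1 / (1 - (\<theta> * b)\<^sup>2))"
      using b(4) by auto
  qed
  also have "ennreal (exp (- \<theta> * s)) * \<dots> = ennreal (exp (- \<theta> * s) * (1 / (1 - (\<theta> * b)\<^sup>2)) ^ card J)"
  proof -
    have "1 / (1 - (\<theta> * b)\<^sup>2) \<ge> 0" if "J \<noteq> {}"
    proof -
      have "0 \<le> \<theta> * b" "\<theta> * b < 1" using assms that by auto
      hence "(\<theta> * b)\<^sup>2 < 1" by (simp add: power_less_one_iff abs_square_less_1)
      thus ?thesis by simp
    qed
    thus ?thesis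
      by (cases "J = {}") (simp_all add: ennreal_mult' ennreal_power)
  qed
  finally show ?thesis .
qed

subsection \<open>Deterministic analysis of a run\<close>

text \<open>Read from the lowest digit upwards, the intervals of the digits 1 tile
  \<open>{1..j}\<close> from right to left: after \<open>L\<close> digits they cover everything
  above \<open>j\<close> rounded down to a multiple of \<open>2 ^ L\<close>.\<close>

lemma dyadic_sum:
  fixes x :: "nat \<Rightarrow> 'a::comm_monoid_add"
  shows "(\<Sum>l | l < L \<and> odd (j div 2 ^ l). \<Sum>i\<in>dyadic l (j div 2 ^ l - 1). x i) =
    (\<Sum>i\<in>{j div 2 ^ L * 2 ^ L<..j}. x i)"
proof (induction L)
  case 0
  show ?case by simp
next
  case (Suc L)
  define q where "q = j div 2 ^ L"
  have q2: "j div 2 ^ Suc L = q div 2"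
    unfolding q_def by (metis div_mult2_eq power_Suc2)
  show ?case
  proof (cases "odd q")
    case True
    then obtain r where r: "q = 2 * r + 1" by (elim oddE)
    have eq: "{l. l < Suc L \<and> odd (j div 2 ^ l)} = insert L {l. l < L \<and> odd (j div 2 ^ l)}"
      using True by (auto simp: q_def less_Suc_eq)
    have le: "q * 2 ^ L \<le> j" unfolding q_def by (metis div_times_less_eq_dividend)
    have d: "dyadic L (q - 1) = {q div 2 * 2 ^ Suc L<..q * 2 ^ L}"
      by (simp add: dyadic_def r algebra_simps)
    have "(\<Sum>l | l < Suc L \<and> odd (j div 2 ^ l). \<Sum>i\<in>dyadic l (j div 2 ^ l - 1). x i) =
        sum x {q div 2 * 2 ^ Suc L<..q * 2 ^ L} + sum x {q * 2 ^ L<..j}"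
      unfolding eq using Suc.IH by (subst sum.insert) (auto simp: q_def[symmetric] d[simplified])
    also have "\<dots> = sum x ({q div 2 * 2 ^ Suc L<..q * 2 ^ L} \<union> {q * 2 ^ L<..j})"
      by (rule sum.union_disjoint[symmetric]) auto
    also have "{q div 2 * 2 ^ Suc L<..q * 2 ^ L} \<union> {q * 2 ^ L<..j} = {q div 2 * 2 ^ Suc L<..j}"
      using le by (auto simp: r algebra_simps)
    finally show ?thesis unfolding q2 .
  next
    case False
    then obtain r where r: "q = 2 * r" by (auto elim: evenE)
    have eq: "{l. l < Suc L \<and> odd (j div 2 ^ l)} = {l. l < L \<and> odd (j div 2 ^ l)}"
      using False by (auto simp: q_def less_Suc_eq)
    have "q div 2 * 2 ^ Suc L = q * 2 ^ L" by (simp add: r)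
    thus ?thesis unfolding eq q2 using Suc.IH unfolding q_def by (simp only:)
  qed
qed

lemma less_two_power_bm_levels:
  assumes "1 \<le> h" "j \<le> h" shows "j < 2 ^ bm_levels h"
proof -
  have "log 2 (real h) < real (bm_levels h)"
    unfolding bm_levels_def using assms by (simp add: zero_le_log_cancel_iff) linarith
  hence "real h < 2 powr real (bm_levels h)"
    using assms by (simp add: log_less_iff)
  also have "\<dots> = real (2 ^ bm_levels h)" by (simp add: powr_realpow)
  finally have "h < 2 ^ bm_levels h" by (simp only: of_nat_less_iff)
  thus ?thesis using assms by linarith
qed

text \<open>The noise part of the \<open>j\<close>-th prefix sum of round \<open>m\<close>. It does
  not depend on the inputs, so for fixed \<open>m\<close> and \<open>j\<close> it is a sum of
  independent Laplace variables with fixed indices.\<close>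

definition xi :: "nat \<Rightarrow> tape \<Rightarrow> nat \<Rightarrow> nat \<Rightarrow> real" where
  "xi h w m j = (\<Sum>l | l < bm_levels h \<and> odd (j div 2 ^ l). snd (snd w) (m, l, j div 2 ^ l - 1))"

lemma bm_prefix_eq:
  assumes "1 \<le> h" "j \<le> h"
  shows "bm_prefix h (\<lambda>l q. snd (snd w) (m, l, q)) x j = real (\<Sum>i\<in>{1..j}. x i) + xi h w m j"
proof -
  have "{j div 2 ^ bm_levels h * 2 ^ bm_levels h<..j} = {1..j}"
    using less_two_power_bm_levels[OF assms] by auto
  thus ?thesis
    using dyadic_sum[where L = "bm_levels h" and j = j and x = "\<lambda>i. real (x i)"]
    by (simp add: bm_prefix_def xi_def sum.distrib)
qed

definition hit :: "tape \<Rightarrow> nat \<Rightarrow> nat \<Rightarrow> nat \<Rightarrow> nat \<Rightarrow> bool" where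
  "hit w m d i n \<longleftrightarrow> (n - 1) mod d + 1 = fst w (m, i, (n - 1) div d + 1, d)"

definition total :: "nat \<Rightarrow> conf \<Rightarrow> nat" where
  "total k s = start_count s + (\<Sum>i<k. local_count s i)"

section \<open>Runs of the protocol for fixed coins of the adversary\<close>

locale tracking =
  fixes k :: nat and \<alpha> C :: real and adv :: "nat \<Rightarrow> real \<times> history \<Rightarrow> nat option" and z :: real
  assumes k_pos: "1 \<le> k" and \<alpha>_pos: "0 < \<alpha>" and C_ge1: "1 \<le> C"
    and adv_less: "\<And>t h i. adv t (z, h) = Some i \<Longrightarrow> i < k"
begin

definition conf :: "tape \<Rightarrow> nat \<Rightarrow> conf" where "conf w t = run_conf k \<alpha> C adv z w t"
definition hist :: "tape \<Rightarrow> nat \<Rightarrow> history" where "hist w t = snd (run k \<alpha> C adv z w t)"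
definition act :: "tape \<Rightarrow> nat \<Rightarrow> nat option" where "act w t = adv t (z, hist w t)"

definition blen :: "conf \<Rightarrow> nat" where "blen s = block_len k \<alpha> C (start_count s)"
text \<open>The noisy threshold T-hat of phase \<open>j\<close> in round \<open>m\<close>.\<close>

definition that :: "tape \<Rightarrow> nat \<Rightarrow> nat \<Rightarrow> real" where
  "that w m j = 2 * C * sqrt (real k) + fst (snd w) (m, j)"

abbreviation "hz \<equiv> horizon k"
abbreviation "nb \<equiv> num_blocks k C"

lemma conf_0: "conf w 0 = init_conf" and hist_0: "hist w 0 = (\<lambda>_. undefined)"
  by (simp_all add: conf_def run_conf_def hist_def)

lemma conf_Suc: "conf w (Suc t) = step k \<alpha> C w (act w t) (conf w t)"
  and hist_Suc: "hist w (Suc t) = (hist w t)(t := (act w t, answer (conf w (Suc t))))"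
  by (simp_all add: conf_def run_conf_def hist_def act_def split_beta Let_def)

lemma hz_pos: "1 \<le> hz"
  using k_pos by (simp add: horizon_def le_nat_iff le_floor_iff)

lemma act_less: "act w t = Some i \<Longrightarrow> i < k"
  unfolding act_def by (rule adv_less)

definition ends :: "nat option \<Rightarrow> conf \<Rightarrow> bool" where
  "ends a s \<longleftrightarrow> (\<exists>i. a = Some i \<and> nb < local_count s i div blen s + 1)"

definition bump :: "nat option \<Rightarrow> conf \<Rightarrow> conf" where
  "bump a s = (case a of None \<Rightarrow> s
     | Some i \<Rightarrow> s\<lparr>local_count := (local_count s)(i := local_count s i + 1)\<rparr>)"

definition sent :: "tape \<Rightarrow> nat option \<Rightarrow> conf \<Rightarrow> nat" where
  "sent w a s = (case a of None \<Rightarrow> 0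
     | Some i \<Rightarrow> if hit w (rnd s) (blen s) i (local_count s i + 1) then 1 else 0)"

definition recv :: "tape \<Rightarrow> nat option \<Rightarrow> conf \<Rightarrow> conf" where
  "recv w a s = (bump a s)\<lparr>bit_count := bit_count s + sent w a s, words := words s + sent w a s\<rparr>"

definition next_phase :: "tape \<Rightarrow> conf \<Rightarrow> conf" where
  "next_phase w s = (let x = (counter_in s)(phase s := bit_count s) in
     s\<lparr>phase := phase s + 1, bit_count := 0, counter_in := x,
       answer := real (start_count s) + real (blen s) *
         bm_prefix hz (\<lambda>l q. snd (snd w) (rnd s, l, q)) x (phase s)\<rparr>)"

lemma restart_cong:
  "start_count s = start_count s' \<Longrightarrow> local_count s = local_count s' \<Longrightarrow> rnd s = rnd s' \<Longrightarrow>
    words s = words s' \<Longrightarrow> restart k s = restart k s'"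
  by (simp add: restart_def Let_def)

lemma restart_next_phase: "restart k (next_phase w s) = restart k s"
  by (rule restart_cong) (simp_all add: next_phase_def Let_def)

lemma check_phase_eq: "check_phase k \<alpha> C w s =
   (if real (bit_count s) < that w (rnd s) (phase s) then s
    else if phase s < hz then next_phase w s else restart k s)"
proof (cases w)
  case (fields thr lT lB)
  have *: "s\<lparr>phase := Suc (phase s), bit_count := 0, counter_in := (counter_in s)(phase s := bit_count s),
       answer := real (start_count s) + real (block_len k \<alpha> C (start_count s)) *
         bm_prefix hz (\<lambda>l q. lB (rnd s, l, q)) ((counter_in s)(phase s := bit_count s)) (phase s)\<rparr> =
      next_phase w s"
    by (simp add: next_phase_def fields blen_def Let_def)
  show ?thesis
    using restart_next_phase[of w s]
    by (auto simp: check_phase_def that_def fields Let_def *[unfolded fields, simplified])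
qed

lemma step_eq: "step k \<alpha> C w a s =
   (if blen s = 0 then (case a of None \<Rightarrow> s | Some i \<Rightarrow> forward k \<alpha> C s)
    else if ends a s then restart k ((bump a s)\<lparr>words := words s + 1\<rparr>)
    else check_phase k \<alpha> C w (recv w a s))"
proof (cases "blen s = 0")
  case True thus ?thesis by (simp add: step_def blen_def)
next
  case False
  have *: "s\<lparr>bit_count := bit_count s + 0, words := words s + 0\<rparr> = s" for s :: conf by simp
  show ?thesis
  proof (cases a)
    case None
    thus ?thesis using False by (simp add: step_def ends_def recv_def bump_def sent_def blen_def)
  next
    case (Some i)
    thus ?thesis using False
      by (auto simp: step_def ends_def recv_def bump_def sent_def blen_def site_msg_def Let_def hit_def)
  qed
qed

lemma recv_simps [simp]:
  "rnd (recv w a s) = rnd s" "start_count (recv w a s) = start_count s"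
  "phase (recv w a s) = phase s" "counter_in (recv w a s) = counter_in s"
  "answer (recv w a s) = answer s" "blen (recv w a s) = blen s"
  "local_count (recv w a s) = local_count (bump a s)"
  "bit_count (recv w a s) = bit_count s + sent w a s" "words (recv w a s) = words s + sent w a s"
  by (simp_all add: recv_def bump_def blen_def split: option.splits)

lemma bump_simps [simp]:
  "rnd (bump a s) = rnd s" "start_count (bump a s) = start_count s"
  "phase (bump a s) = phase s" "counter_in (bump a s) = counter_in s"
  "answer (bump a s) = answer s" "blen (bump a s) = blen s" "bit_count (bump a s) = bit_count s"
  "words (bump a s) = words s"
  "local_count (bump a s) i = local_count s i + (if a = Some i then 1 else 0)"
  by (auto simp: bump_def blen_def split: option.splits)

text \<open>The case split behind all invariants. A round that ends with its last phase restarts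
  from the state before \<open>next_phase\<close>; by \<open>restart_next_phase\<close> the result
  is the same.\<close>

lemma step_cases:
  assumes "blen s = 0 \<Longrightarrow> a = None \<Longrightarrow> P s"
    and "\<And>i. blen s = 0 \<Longrightarrow> a = Some i \<Longrightarrow> P (forward k \<alpha> C s)"
    and "\<And>i. 0 < blen s \<Longrightarrow> a = Some i \<Longrightarrow> nb < local_count s i div blen s + 1 \<Longrightarrow>
           P (restart k ((bump a s)\<lparr>words := words s + 1\<rparr>))"
    and "0 < blen s \<Longrightarrow> \<not> ends a s \<Longrightarrow>
           real (bit_count (recv w a s)) < that w (rnd s) (phase s) \<Longrightarrow> P (recv w a s)"
    and "0 < blen s \<Longrightarrow> \<not> ends a s \<Longrightarrow> real (bit_count (recv w a s)) \<ge> that w (rnd s) (phase s) \<Longrightarrow>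
           phase s < hz \<Longrightarrow> P (next_phase w (recv w a s))"
    and "0 < blen s \<Longrightarrow> \<not> ends a s \<Longrightarrow> real (bit_count (recv w a s)) \<ge> that w (rnd s) (phase s) \<Longrightarrow>
           phase s \<ge> hz \<Longrightarrow> P (restart k (recv w a s))"
  shows "P (step k \<alpha> C w a s)"
proof -
  consider "blen s = 0" "a = None" | i where "blen s = 0" "a = Some i"
    | i where "0 < blen s" "a = Some i" "nb < local_count s i div blen s + 1"
    | "0 < blen s" "\<not> ends a s"
    unfolding ends_def by (cases a) fastforce+
  thus ?thesis
  proof cases
    case 4
    thus ?thesis using assms(4-6) unfolding step_eq check_phase_eq
      by (auto simp: not_less simp del: recv_simps(7-9))
  qed (use assms(1-3) in \<open>auto simp: step_eq ends_def\<close>)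
qed

lemma next_phase_simps [simp]:
  "rnd (next_phase w s) = rnd s" "start_count (next_phase w s) = start_count s"
  "phase (next_phase w s) = phase s + 1"
  "counter_in (next_phase w s) = (counter_in s)(phase s := bit_count s)"
  "local_count (next_phase w s) = local_count s" "blen (next_phase w s) = blen s"
  "bit_count (next_phase w s) = 0" "words (next_phase w s) = words s"
  "answer (next_phase w s) = real (start_count s) + real (blen s) *
         bm_prefix hz (\<lambda>l q. snd (snd w) (rnd s, l, q)) ((counter_in s)(phase s := bit_count s)) (phase s)"
  by (simp_all add: next_phase_def blen_def Let_def)

lemma restart_simps [simp]:
  "rnd (restart k s) = rnd s + 1" "start_count (restart k s) = total k s"
  "local_count (restart k s) = (\<lambda>_. 0)" "phase (restart k s) = 1" "bit_count (restart k s) = 0"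
  "counter_in (restart k s) = (\<lambda>_. 0)" "answer (restart k s) = real (total k s)"
  "words (restart k s) = words s + 3 * k"
  by (simp_all add: restart_def total_def Let_def)

lemma forward_simps [simp]:
  "rnd (forward k \<alpha> C s) = rnd s" "start_count (forward k \<alpha> C s) = start_count s + 1"
  "local_count (forward k \<alpha> C s) = local_count s" "phase (forward k \<alpha> C s) = phase s"
  "bit_count (forward k \<alpha> C s) = bit_count s" "counter_in (forward k \<alpha> C s) = counter_in s"
  "answer (forward k \<alpha> C s) = real (start_count s + 1)"
  "words (forward k \<alpha> C s) = words s + 1 + (if block_len k \<alpha> C (start_count s + 1) > 0 then k else 0)"
  by (simp_all add: forward_def Let_def)

lemma init_simps [simp]:
  "rnd init_conf = 0" "start_count init_conf = 0" "local_count init_conf = (\<lambda>_. 0)"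
  "phase init_conf = 1" "bit_count init_conf = 0" "counter_in init_conf = (\<lambda>_. 0)"
  "answer init_conf = 0" "words init_conf = 0"
  by (simp_all add: init_conf_def)

lemma total_recv [simp]: "total k (recv w a s) = total k (bump a s)"
  by (simp add: total_def)

lemma total_words [simp]: "total k (s\<lparr>words := x\<rparr>) = total k s"
  by (simp add: total_def)

lemma total_next_phase [simp]: "total k (next_phase w s) = total k s"
  by (simp add: total_def)

lemma total_restart [simp]: "total k (restart k s) = total k s"
  by (simp add: total_def)

lemma total_bump:
  assumes "\<And>i. a = Some i \<Longrightarrow> i < k"
  shows "total k (bump a s) = total k s + (if a = None then 0 else 1)"
  using assms by (cases a) (auto simp: total_def sum.distrib)

lemma total_step:
  assumes "\<And>i. a = Some i \<Longrightarrow> i < k"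
  shows "total k (step k \<alpha> C w a s) = total k s + (if a = None then 0 else 1)"
  by (rule step_cases[where s = s and a = a and w = w])
     (simp_all add: total_bump[OF assms], simp_all add: total_def)

lemma block_len_mono: "n \<le> n' \<Longrightarrow> block_len k \<alpha> C n \<le> block_len k \<alpha> C n'"
  unfolding block_len_def using \<alpha>_pos C_ge1
  by (intro nat_mono floor_mono divide_right_mono mult_left_mono) auto

lemma start_le_total: "start_count s \<le> total k s"
  by (simp add: total_def)

text \<open>The bits of the round, computed from the tape and the local counts without reference to
  phases; \<open>inv\<close> equates this with what the server has counted.\<close>

definition received :: "tape \<Rightarrow> conf \<Rightarrow> nat" where
  "received w s = (\<Sum>i<k. card {n \<in> {1..local_count s i}. hit w (rnd s) (blen s) i n})"

lemma received_cong:
  "local_count s = local_count s' \<Longrightarrow> rnd s = rnd s' \<Longrightarrow> start_count s = start_count s' \<Longrightarrow>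
   received w s = received w s'"
  by (simp add: received_def blen_def)

lemma received_recv:
  assumes "\<And>i. a = Some i \<Longrightarrow> i < k"
  shows "received w (recv w a s) = received w s + sent w a s"
proof (cases a)
  case None
  thus ?thesis by (simp add: received_def sent_def)
next
  case (Some i)
  let ?H = "\<lambda>i. {n \<in> {1..local_count s i}. hit w (rnd s) (blen s) i n}"
  have eq: "card {n \<in> {1..local_count (recv w a s) i'}. hit w (rnd s) (blen s) i' n} =
     card (?H i') + (if i' = i then sent w a s else 0)" for i'
  proof (cases "i' = i")
    case True
    have "{n \<in> {1..Suc (local_count s i)}. hit w (rnd s) (blen s) i n} =
        (if hit w (rnd s) (blen s) i (Suc (local_count s i)) then insert (Suc (local_count s i)) (?H i) else ?H i)"
      by (auto simp: le_Suc_eq)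
    thus ?thesis using True Some by (simp add: sent_def)
  qed (use Some in simp)
  have "i < k" using assms Some by simp
  thus ?thesis by (simp only: received_def eq sum.distrib recv_simps(1,6)) simp
qed

text \<open>At most one bit arrives per step, so a counter input exceeds its threshold by at most
  one bit; a negative threshold is met without any bit, hence \<open>max 0\<close> and
  \<open>+ 1\<close>. For the same reason the bit count need not be below the threshold while it is
  0, as in a fresh phase.\<close>

definition inv :: "tape \<Rightarrow> conf \<Rightarrow> bool" where
  "inv w s \<longleftrightarrow> 1 \<le> phase s \<and> phase s \<le> hz \<and> (\<forall>i\<ge>k. local_count s i = 0) \<and>
    (\<forall>i. local_count s i \<le> nb * blen s) \<and>
    (blen s = 0 \<longrightarrow> rnd s = 0 \<and> phase s = 1 \<and> words s = start_count s) \<and>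
    bit_count s + (\<Sum>q\<in>{1..<phase s}. counter_in s q) = received w s \<and>
    (\<forall>q\<in>{1..<phase s}. that w (rnd s) q \<le> real (counter_in s q) \<and>
         real (counter_in s q) \<le> max 0 (that w (rnd s) q) + 1) \<and>
    (bit_count s = 0 \<or> real (bit_count s) < that w (rnd s) (phase s)) \<and>
    answer s = real (start_count s) + real (blen s) *
       (real (\<Sum>q\<in>{1..<phase s}. counter_in s q) + xi hz w (rnd s) (phase s - 1))"

lemma xi_0 [simp]: "xi h w m 0 = 0"
  by (simp add: xi_def)

lemma inv_restart: "inv w (restart k s)" if "block_len k \<alpha> C (total k s) > 0"
  using hz_pos that by (simp add: inv_def received_def blen_def)

lemma inv_step:
  assumes I: "inv w s" and a: "\<And>i. a = Some i \<Longrightarrow> i < k"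
  shows "inv w (step k \<alpha> C w a s)"
proof (rule step_cases[where s = s and a = a and w = w],
    goal_cases idle forward end_round stay next_phase end_phases)
  case idle
  thus ?case using I by simp
next
  case (forward i)
  hence "local_count s = (\<lambda>_. 0)" using I by (auto simp: inv_def)
  moreover have "block_len k \<alpha> C (start_count s) = 0" using forward by (simp add: blen_def)
  ultimately show ?case using forward I by (auto simp: inv_def received_def blen_def)
next
  case (end_round i)
  \<comment> \<open>The count never decreases, so the block length stays positive and a restart
    never leads back to forwarding.\<close>
  have "blen s \<le> block_len k \<alpha> C (total k (bump a s))"
    unfolding blen_def by (intro block_len_mono) (use start_le_total[of "bump a s"] in simp)
  thus ?case using end_round by (intro inv_restart) simp
next
  case end_phases
  have "blen s \<le> block_len k \<alpha> C (total k (recv w a s))"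
    unfolding blen_def by (intro block_len_mono) (use start_le_total[of "bump a s"] in simp)
  thus ?case using end_phases by (intro inv_restart) simp
next
  case stay
  have lc: "local_count (bump a s) i \<le> nb * blen s" for i
  proof (cases "a = Some i")
    case True
    hence "local_count s i div blen s < nb" using stay by (auto simp: ends_def)
    hence "local_count s i < nb * blen s" using stay by (simp add: div_less_iff_less_mult)
    thus ?thesis using True by simp
  qed (use I in \<open>auto simp: inv_def\<close>)
  show ?case using I stay a lc received_recv[OF a, where w = w and s = s] unfolding inv_def by auto
next
  case next_phase
  have lc: "local_count (bump a s) i \<le> nb * blen s" for i
  proof (cases "a = Some i")
    case True
    hence "local_count s i div blen s < nb" using next_phase by (auto simp: ends_def)
    hence "local_count s i < nb * blen s" using next_phase by (simp add: div_less_iff_less_mult)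
    thus ?thesis using True by simp
  qed (use I in \<open>auto simp: inv_def\<close>)
  let ?s = "next_phase w (recv w a s)"
  have p: "1 \<le> phase s" using I by (simp add: inv_def)
  have iv: "{1..<phase ?s} = insert (phase s) {1..<phase s}" using p by auto
  have sm: "(\<Sum>q\<in>{1..<phase ?s}. counter_in ?s q) = bit_count s + sent w a s + (\<Sum>q\<in>{1..<phase s}. counter_in s q)"
    unfolding iv by (subst sum.insert) auto
  have "received w ?s = received w (recv w a s)" by (rule received_cong) simp_all
  hence rc: "received w ?s = received w s + sent w a s"
    using received_recv[OF a, where w = w and s = s] by simp
  have sent: "sent w a s \<le> 1" by (simp add: sent_def split: option.splits)
  have b: "real (bit_count s + sent w a s) \<le> max 0 (that w (rnd s) (phase s)) + 1"
    using I sent unfolding inv_def by auto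
  have ivv: "{1..phase s} = {1..<phase ?s}" by auto
  have ans: "answer ?s = real (start_count ?s) + real (blen ?s) *
       (real (\<Sum>q\<in>{1..<phase ?s}. counter_in ?s q) + xi hz w (rnd ?s) (phase ?s - 1))"
    using next_phase hz_pos by (simp add: bm_prefix_eq ivv[simplified])
  show ?case
    unfolding inv_def ans
    using I next_phase a lc b sm rc p unfolding inv_def by (auto simp: less_Suc_eq)
qed

lemma inv_conf: "inv w (conf w t)"
proof (induction t)
  case 0
  show ?case using hz_pos by (simp add: conf_0 inv_def received_def)
next
  case (Suc t)
  thus ?case unfolding conf_Suc by (rule inv_step) (rule act_less)
qed

text \<open>The count over the history, which limits the adversary and is to be approximated, is
  translated into the exact count contained in the configuration.\<close>

lemma card_items: "item_count (hist w t) t = total k (conf w t)"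
proof -
  have "{s. s < t \<and> fst (hist w t s) \<noteq> None} = {s. s < t \<and> act w s \<noteq> None}" for t
  proof -
    have "s < t \<Longrightarrow> fst (hist w t s) = act w s" for s
      by (induction t) (auto simp: hist_Suc less_Suc_eq)
    thus ?thesis by auto
  qed
  hence "item_count (hist w t) t = card {s. s < t \<and> act w s \<noteq> None}"
    by (simp add: item_count_def)
  also have "\<dots> = total k (conf w t)"
  proof (induction t)
    case 0
    show ?case by (simp add: conf_0 total_def)
  next
    case (Suc t)
    have "{s. s < Suc t \<and> act w s \<noteq> None} =
      (if act w t = None then {s. s < t \<and> act w s \<noteq> None} else insert t {s. s < t \<and> act w s \<noteq> None})"
      by (auto simp: less_Suc_eq)
    thus ?case using Suc total_step[OF act_less[of w t], where s = "conf w t" and w = w] by (simp add: conf_Suc)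
  qed
  finally show ?thesis .
qed

subsection \<open>Monotonicity within a round\<close>

lemma rnd_step: "rnd s \<le> rnd (step k \<alpha> C w a s)"
  by (rule step_cases[where s = s and a = a and w = w]) simp_all

lemma rnd_mono: "u \<le> v \<Longrightarrow> rnd (conf w u) \<le> rnd (conf w v)"
  by (rule lift_Suc_mono_le[of "\<lambda>u. rnd (conf w u)"]) (simp_all add: conf_Suc rnd_step)

lemma in_round_cases:
  assumes "rnd (conf w (Suc u)) = rnd (conf w u)" "0 < blen (conf w u)"
  obtains (stay) "\<not> ends (act w u) (conf w u)" "conf w (Suc u) = recv w (act w u) (conf w u)"
      "real (bit_count (recv w (act w u) (conf w u))) < that w (rnd (conf w u)) (phase (conf w u))"
    | (next_phase) "\<not> ends (act w u) (conf w u)" "conf w (Suc u) = next_phase w (recv w (act w u) (conf w u))"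
      "real (bit_count (recv w (act w u) (conf w u))) \<ge> that w (rnd (conf w u)) (phase (conf w u))"
      "phase (conf w u) < hz"
  using assms unfolding conf_Suc step_eq check_phase_eq
  by (auto simp: not_less split: if_splits)

lemma idle_or_in_round:
  assumes "blen (conf w u) = 0"
  shows "rnd (conf w u) = 0" "phase (conf w u) = 1" "local_count (conf w u) i = 0"
    "rnd (conf w (Suc u)) = 0" "phase (conf w (Suc u)) = 1" "local_count (conf w (Suc u)) i = 0"
    "bit_count (conf w u) = 0" "bit_count (conf w (Suc u)) = 0"
proof -
  have I: "inv w (conf w u)" by (rule inv_conf)
  show *: "rnd (conf w u) = 0" "phase (conf w u) = 1" "local_count (conf w u) i = 0" for i
    using I assms by (auto simp: inv_def)
  show b: "bit_count (conf w u) = 0"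
    using I * unfolding inv_def received_def by auto
  show "rnd (conf w (Suc u)) = 0" "phase (conf w (Suc u)) = 1" "local_count (conf w (Suc u)) i = 0"
    "bit_count (conf w (Suc u)) = 0"
    using assms * b by (auto simp: conf_Suc step_eq split: option.splits)
qed

lemma in_round_Suc:
  assumes "rnd (conf w (Suc u)) = rnd (conf w u)"
  shows "phase (conf w u) \<le> phase (conf w (Suc u))"
    "local_count (conf w u) i \<le> local_count (conf w (Suc u)) i"
    "0 < blen (conf w u) \<Longrightarrow> start_count (conf w (Suc u)) = start_count (conf w u)"
    "phase (conf w (Suc u)) = phase (conf w u) \<Longrightarrow> bit_count (conf w u) \<le> bit_count (conf w (Suc u))"
proof -
  have "phase (conf w u) \<le> phase (conf w (Suc u)) \<and>
    local_count (conf w u) i \<le> local_count (conf w (Suc u)) i \<and>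
    (0 < blen (conf w u) \<longrightarrow> start_count (conf w (Suc u)) = start_count (conf w u)) \<and>
    (phase (conf w (Suc u)) = phase (conf w u) \<longrightarrow> bit_count (conf w u) \<le> bit_count (conf w (Suc u)))"
  proof (cases "blen (conf w u) = 0")
    case True
    thus ?thesis using idle_or_in_round[OF True] by simp
  next
    case False
    hence "0 < blen (conf w u)" by simp
    from in_round_cases[OF assms this] show ?thesis by cases simp_all
  qed
  thus "phase (conf w u) \<le> phase (conf w (Suc u))"
    "local_count (conf w u) i \<le> local_count (conf w (Suc u)) i"
    "0 < blen (conf w u) \<Longrightarrow> start_count (conf w (Suc u)) = start_count (conf w u)"
    "phase (conf w (Suc u)) = phase (conf w u) \<Longrightarrow> bit_count (conf w u) \<le> bit_count (conf w (Suc u))"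
    by auto
qed

lemma in_round_mono:
  assumes "u \<le> v" "rnd (conf w u) = rnd (conf w v)"
  shows "phase (conf w u) \<le> phase (conf w v)"
    "local_count (conf w u) i \<le> local_count (conf w v) i"
    "0 < blen (conf w u) \<Longrightarrow> start_count (conf w v) = start_count (conf w u)"
    "phase (conf w v) = phase (conf w u) \<Longrightarrow> bit_count (conf w u) \<le> bit_count (conf w v)"
proof -
  have "phase (conf w u) \<le> phase (conf w v) \<and>
    local_count (conf w u) i \<le> local_count (conf w v) i \<and>
    (0 < blen (conf w u) \<longrightarrow> start_count (conf w v) = start_count (conf w u)) \<and>
    (phase (conf w v) = phase (conf w u) \<longrightarrow> bit_count (conf w u) \<le> bit_count (conf w v))"
    using assms
  proof (induction rule: inc_induct)
    case base
    show ?case by simp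
  next
    case (step n)
    have "rnd (conf w n) \<le> rnd (conf w (Suc n))" "rnd (conf w (Suc n)) \<le> rnd (conf w v)"
      using step.hyps by (auto intro: rnd_mono)
    hence eq: "rnd (conf w (Suc n)) = rnd (conf w n)" "rnd (conf w (Suc n)) = rnd (conf w v)"
      using step.prems by linarith+
    have IH: "phase (conf w (Suc n)) \<le> phase (conf w v)"
      "local_count (conf w (Suc n)) i \<le> local_count (conf w v) i"
      "0 < blen (conf w (Suc n)) \<Longrightarrow> start_count (conf w v) = start_count (conf w (Suc n))"
      "phase (conf w v) = phase (conf w (Suc n)) \<Longrightarrow> bit_count (conf w (Suc n)) \<le> bit_count (conf w v)"
      using step.IH[OF eq(2)] by auto
    have bl: "0 < blen (conf w n) \<Longrightarrow> 0 < blen (conf w (Suc n))"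
      using in_round_Suc(3)[OF eq(1)] by (simp add: blen_def)
    note S = in_round_Suc(1,3,4)[OF eq(1)] in_round_Suc(2)[OF eq(1), of i]
    have "bit_count (conf w n) \<le> bit_count (conf w v)" if "phase (conf w v) = phase (conf w n)"
    proof -
      have "phase (conf w (Suc n)) = phase (conf w n)" using that S(1) IH(1) by linarith
      thus ?thesis using S(3) IH(4) that by simp
    qed
    moreover have "start_count (conf w v) = start_count (conf w n)" if "0 < blen (conf w n)"
      using S(2)[OF that] IH(3)[OF bl[OF that]] by simp
    ultimately show ?case
      using S(1,4) IH(1,2) by auto
  qed
  thus "phase (conf w u) \<le> phase (conf w v)"
    "local_count (conf w u) i \<le> local_count (conf w v) i"
    "0 < blen (conf w u) \<Longrightarrow> start_count (conf w v) = start_count (conf w u)"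
    "phase (conf w v) = phase (conf w u) \<Longrightarrow> bit_count (conf w u) \<le> bit_count (conf w v)"
    by auto
qed

section \<open>Phases in which given items arrive\<close>

definition cross :: "tape \<Rightarrow> nat \<Rightarrow> nat \<Rightarrow> nat \<Rightarrow> nat \<Rightarrow> bool" where
  "cross w m i n u \<longleftrightarrow> rnd (conf w u) = m \<and> local_count (conf w u) i < n \<and>
     n \<le> local_count (conf w (Suc u)) i"

text \<open>The value 0 stands for an item that does not arrive before \<open>t\<close>. Phases
  start at 1, so noise with phase index 0 is never read.\<close>

definition cross_phase :: "nat \<Rightarrow> nat \<Rightarrow> nat \<Rightarrow> nat \<Rightarrow> tape \<Rightarrow> nat" where
  "cross_phase t m i n w =
     (if \<exists>u<t. cross w m i n u then phase (conf w (LEAST u. cross w m i n u)) else 0)"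

text \<open>The phase change is visible at the arrival of an item of block \<open>b\<close>, so the
  coupling cannot hide the threshold of this block. A change of round is not counted, because later
  only times \<open>t\<close> that lie in round \<open>m\<close> are considered.\<close>

definition leaked :: "nat \<Rightarrow> nat \<Rightarrow> nat \<Rightarrow> nat \<Rightarrow> tape \<Rightarrow> bool" where
  "leaked t m i b w \<longleftrightarrow> (\<exists>u<t. rnd (conf w u) = m \<and> rnd (conf w (Suc u)) = m \<and>
     phase (conf w (Suc u)) \<noteq> phase (conf w u) \<and> act w u = Some i \<and>
     local_count (conf w u) i div blen (conf w u) + 1 = b)"

lemma rnd_Suc_restart:
  assumes "rnd (conf w (Suc u)) \<noteq> rnd (conf w u)"
  shows "local_count (conf w (Suc u)) i = 0" "bit_count (conf w (Suc u)) = 0"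
    "phase (conf w (Suc u)) = 1"
  using assms unfolding conf_Suc step_eq check_phase_eq by (auto split: option.splits if_splits)

lemma cross_in_round:
  assumes "cross w m i n u" "1 \<le> n"
  shows "rnd (conf w (Suc u)) = m"
  using assms rnd_Suc_restart(1)[of w u i] unfolding cross_def by fastforce

text \<open>Local counts do not decrease within a round. This makes the \<open>LEAST\<close> in
  \<open>cross_phase\<close> unambiguous.\<close>

lemma cross_unique:
  assumes "cross w m i n u" "cross w m i n v" "1 \<le> n"
  shows "u = v"
proof -
  have False if "cross w m i n u" "cross w m i n v" "u < v" for u v
  proof -
    have "local_count (conf w (Suc u)) i \<le> local_count (conf w v) i"
      using that cross_in_round[OF that(1) assms(3)]
      by (intro in_round_mono(2)) (auto simp: cross_def)
    thus False using that by (auto simp: cross_def)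
  qed
  thus ?thesis using assms by (metis linorder_neqE_nat)
qed

lemma cross_phase_eq:
  assumes "cross w m i n u" "u < t" "1 \<le> n"
  shows "cross_phase t m i n w = phase (conf w u)"
proof -
  have "(LEAST u. cross w m i n u) = u"
    using assms(1) cross_unique[OF assms(1) _ assms(3)] by (intro Least_equality) fastforce+
  thus ?thesis using assms by (auto simp: cross_phase_def)
qed

lemma cross_exists:
  assumes "1 \<le> n" "n \<le> local_count (conf w u) i"
  shows "\<exists>v<u. cross w (rnd (conf w u)) i n v"
  using assms(2)
proof (induction u)
  case 0
  thus ?case using assms(1) by (simp add: conf_0)
next
  case (Suc u)
  have eq: "rnd (conf w (Suc u)) = rnd (conf w u)"
    using rnd_Suc_restart(1)[of w u i] Suc.prems assms(1) by fastforce
  show ?case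
  proof (cases "n \<le> local_count (conf w u) i")
    case True
    thus ?thesis using Suc.IH eq by (auto intro: less_SucI)
  next
    case False
    hence "cross w (rnd (conf w (Suc u))) i n u" using Suc.prems eq by (simp add: cross_def)
    thus ?thesis by blast
  qed
qed

lemma cross_phase_le: "cross_phase t m i n w \<le> hz"
  using inv_conf[of w] by (auto simp: cross_phase_def inv_def)

lemma cross_act:
  assumes "cross w m i n u" "1 \<le> n" "0 < blen (conf w u)"
  shows "act w u = Some i" "n = local_count (conf w u) i + 1" "\<not> ends (act w u) (conf w u)"
    "local_count (conf w (Suc u)) i = n"
proof -
  have "rnd (conf w (Suc u)) = rnd (conf w u)"
    using cross_in_round[OF assms(1,2)] assms(1) by (simp add: cross_def)
  from in_round_cases[OF this assms(3)]
  have "act w u = Some i \<and> n = local_count (conf w u) i + 1 \<and> \<not> ends (act w u) (conf w u) \<and>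
     local_count (conf w (Suc u)) i = n"
    using assms(1) by cases (auto simp: cross_def split: if_splits)
  thus "act w u = Some i" "n = local_count (conf w u) i + 1" "\<not> ends (act w u) (conf w u)"
    "local_count (conf w (Suc u)) i = n" by auto
qed

subsection \<open>Coupling of tapes that differ in one threshold\<close>

text \<open>The erased fields are those in which two coupled runs differ once a bit has moved; none
  of them is shown to the adversary.\<close>

definition vis :: "conf \<Rightarrow> conf" where
  "vis s = s\<lparr>bit_count := 0, counter_in := (\<lambda>_. 0), words := 0\<rparr>"

lemma vis_eq_iff: "vis s = vis s' \<longleftrightarrow> rnd s = rnd s' \<and> start_count s = start_count s' \<and>
    local_count s = local_count s' \<and> phase s = phase s' \<and> answer s = answer s'"
  by (cases s; cases s') (auto simp: vis_def)

definition same_view :: "nat \<Rightarrow> tape \<Rightarrow> tape \<Rightarrow> bool" where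
  "same_view t w w' \<longleftrightarrow> (\<forall>u\<le>t. vis (conf w u) = vis (conf w' u) \<and> hist w u = hist w' u)"

text \<open>If the bit of a site for one block moves from phase \<open>a\<close> to phase \<open>p\<close>, then shifting the
  thresholds of these two phases and the noise of the dyadic intervals that contain exactly one of
  them hides the change; index 0 stands for a bit that is not sent.\<close>

definition thr_shift :: "nat \<Rightarrow> nat \<Rightarrow> nat \<Rightarrow> nat \<times> nat \<Rightarrow> real" where
  "thr_shift m a p = (\<lambda>(m', q). if m' = m then of_bool (q = p) - of_bool (q = a) else 0)"

definition bin_shift :: "nat \<Rightarrow> nat \<Rightarrow> nat \<Rightarrow> nat \<Rightarrow> nat \<times> nat \<times> nat \<Rightarrow> real" where
  "bin_shift h m a p = (\<lambda>(m', l, q). if m' = m \<and> l < bm_levels h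
     then of_bool (a \<in> dyadic l q) - of_bool (p \<in> dyadic l q) else 0)"

definition noise_shift :: "nat \<Rightarrow> nat \<Rightarrow> nat \<Rightarrow> tape \<Rightarrow> tape" where
  "noise_shift m a p w = (fst w, (\<lambda>q. fst (snd w) q + thr_shift m a p q),
     (\<lambda>q. snd (snd w) q + bin_shift hz m a p q))"

definition set_thr :: "nat \<times> nat \<times> nat \<times> nat \<Rightarrow> nat \<Rightarrow> tape \<Rightarrow> tape" where
  "set_thr c x w = ((fst w)(c := x), snd w)"

text \<open>In every dyadic interval the inputs change by the indicator of \<open>p\<close> minus
  that of \<open>a\<close>, and \<open>bin_shift\<close> is exactly the opposite. The hypothesis is
  additive because the inputs are natural numbers.\<close>

lemma bm_prefix_shift:
  assumes "\<And>q. q \<in> {1..j} \<Longrightarrow> x' q + of_bool (a = q) = x q + of_bool (p = q)"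
    and "snd (snd w') = (\<lambda>q. snd (snd w) q + bin_shift h m a p q)"
  shows "bm_prefix h (\<lambda>l q. snd (snd w') (m, l, q)) x' j = bm_prefix h (\<lambda>l q. snd (snd w) (m, l, q)) x j"
  unfolding bm_prefix_def
proof (intro sum.cong refl)
  fix l assume l: "l \<in> {l. l < bm_levels h \<and> odd (j div 2 ^ l)}"
  let ?D = "dyadic l (j div 2 ^ l - 1)"
  have sub: "?D \<subseteq> {1..j}"
  proof -
    have "1 \<le> j div 2 ^ l" using l by (cases "j div 2 ^ l") auto
    hence "?D = {(j div 2 ^ l - 1) * 2 ^ l <.. j div 2 ^ l * 2 ^ l}" by (simp add: dyadic_def)
    moreover have "v \<le> j" if "v \<le> j div 2 ^ l * 2 ^ l" for v
      by (rule order_trans[OF that div_times_less_eq_dividend])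
    ultimately show ?thesis by (simp add: subset_eq)
  qed
  have fin: "finite ?D" by (simp add: dyadic_def)
  have "(\<Sum>i\<in>?D. x' i + of_bool (a = i)) = (\<Sum>i\<in>?D. x i + of_bool (p = i))"
    by (rule sum.cong[OF refl], rule assms(1)) (use sub in blast)
  moreover have "(\<Sum>i\<in>?D. of_bool (v = i)) = (of_bool (v \<in> ?D) :: nat)" for v
    unfolding of_bool_def by (rule sum.delta'[OF fin])
  ultimately have "(\<Sum>i\<in>?D. x' i) + of_bool (a \<in> ?D) = (\<Sum>i\<in>?D. x i) + of_bool (p \<in> ?D)"
    by (simp only: sum.distrib)
  from arg_cong[OF this, of real]
  have "real (\<Sum>i\<in>?D. x' i) + of_bool (a \<in> ?D) = real (\<Sum>i\<in>?D. x i) + of_bool (p \<in> ?D)"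
    by (simp only: of_nat_add of_nat_of_bool)
  moreover have "bin_shift h m a p (m, l, j div 2 ^ l - 1) = of_bool (a \<in> ?D) - of_bool (p \<in> ?D)"
    using l by (simp add: bin_shift_def)
  ultimately show "(\<Sum>i\<in>?D. real (x' i)) + snd (snd w') (m, l, j div 2 ^ l - 1) =
     (\<Sum>i\<in>?D. real (x i)) + snd (snd w) (m, l, j div 2 ^ l - 1)"
    unfolding assms(2) by (simp only: of_nat_sum)
qed

text \<open>Replacing the threshold \<open>x\<close> by \<open>y\<close> moves the bit of the block
  from the item \<open>nx\<close> to the item \<open>ny\<close>, hence from phase \<open>a\<close>
  to phase \<open>p\<close>. Both phases are read off the run on \<open>w\<close>, before anything
  is shifted. What has to be excluded by induction over time is a phase that ends at different times
  in the two runs.\<close>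

lemma coupling:
  fixes m i b d x y t :: nat and w :: tape
  defines "nx \<equiv> (b - 1) * d + x" and "ny \<equiv> (b - 1) * d + y"
  defines "a \<equiv> cross_phase t m i nx w" and "p \<equiv> cross_phase t m i ny w"
  defines "w' \<equiv> noise_shift m a p (set_thr (m, i, b, d) y w)"
  assumes rt: "rnd (conf w t) = m" and bt: "blen (conf w t) = d" and d: "0 < d"
    and x: "x \<in> {1..d}" and y: "y \<in> {1..d}" and b: "1 \<le> b"
    and thr: "fst w (m, i, b, d) = x" and nl: "\<not> leaked t m i b w"
  shows "same_view t w w'"
proof -
  have n1: "1 \<le> nx" "1 \<le> ny" using x y by (auto simp: nx_def ny_def)
  \<comment> \<open>Before round \<open>m\<close> the configurations agree completely. Within round
    \<open>m\<close> the hidden counters differ by the moved bit, but only from the arrival of the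
    respective item on.\<close>
  define R where "R u \<longleftrightarrow> vis (conf w u) = vis (conf w' u) \<and> hist w u = hist w' u \<and>
    (rnd (conf w u) < m \<longrightarrow> conf w u = conf w' u) \<and>
    (rnd (conf w u) = m \<longrightarrow>
      bit_count (conf w' u) + of_bool (nx \<le> local_count (conf w u) i \<and> a = phase (conf w u)) =
      bit_count (conf w u) + of_bool (ny \<le> local_count (conf w u) i \<and> p = phase (conf w u)) \<and>
      (\<forall>q\<in>{1..<phase (conf w u)}. counter_in (conf w' u) q + of_bool (a = q) =
          counter_in (conf w u) q + of_bool (p = q)))" for u
  have fw': "fst w' = (fst w)((m, i, b, d) := y)" by (simp add: w'_def noise_shift_def set_thr_def)
  have tw': "that w' m' q = that w m' q + thr_shift m a p (m', q)" for m' q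
    by (simp add: w'_def noise_shift_def set_thr_def that_def)
  have lw': "snd (snd w') = (\<lambda>q. snd (snd w) q + bin_shift hz m a p q)"
    by (simp add: w'_def noise_shift_def set_thr_def)
  have step_before: "step k \<alpha> C w' ac s = step k \<alpha> C w ac s" if "rnd s \<noteq> m" for ac s
  proof -
    have "hit w' (rnd s) d' i' n = hit w (rnd s) d' i' n" for d' i' n
      using that by (simp add: hit_def fw')
    hence "recv w' ac s = recv w ac s" by (simp add: recv_def sent_def split: option.splits)
    moreover have "check_phase k \<alpha> C w' s' = check_phase k \<alpha> C w s'" if "rnd s' = rnd s" for s'
      using that \<open>rnd s \<noteq> m\<close>
      by (simp add: check_phase_eq tw' thr_shift_def next_phase_def lw' bin_shift_def)
    ultimately show ?thesis by (simp add: step_eq)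
  qed
  have "R u" if "u \<le> t" for u using that
  proof (induction u)
    case 0
    show ?case using n1 by (simp add: R_def conf_0 hist_0)
  next
    case (Suc u)
    hence IH: "R u" by simp
    let ?s = "conf w u" and ?s' = "conf w' u"
    have vis: "vis ?s = vis ?s'" and hst: "hist w u = hist w' u" using IH by (auto simp: R_def)
    have acts: "act w' u = act w u" by (simp add: act_def hst)
    have r_le: "rnd ?s \<le> m" "rnd (conf w (Suc u)) \<le> m"
      using rnd_mono[of u t w] rnd_mono[of "Suc u" t w] Suc.prems rt by auto
    show ?case
    proof (cases "rnd ?s = m")
      case False
      hence eq: "conf w u = conf w' u" and lt: "rnd ?s < m" using IH r_le by (auto simp: R_def)
      have eq': "conf w (Suc u) = conf w' (Suc u)"
        using step_before[of ?s] lt by (simp add: conf_Suc acts eq[symmetric])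
      have z: "phase (conf w (Suc u)) = 1 \<and> local_count (conf w (Suc u)) i = 0"
        if "rnd (conf w (Suc u)) = m"
        using rnd_Suc_restart(1,3)[of w u] that lt by auto
      show ?thesis using z n1 hst acts unfolding R_def by (auto simp: eq'[symmetric] hist_Suc)
    next
      case rm: True
      show ?thesis
      proof (cases "blen ?s = 0")
        case True
        note z = idle_or_in_round[OF True]
        have "blen ?s' = 0" using True vis by (simp add: vis_eq_iff blen_def)
        note z' = idle_or_in_round[OF this]
        have "vis (conf w (Suc u)) = vis (conf w' (Suc u))"
          using True \<open>blen ?s' = 0\<close> vis by (auto simp: conf_Suc step_eq acts vis_eq_iff split: option.splits)
        moreover have "m = 0" using z rm by simp
        ultimately show ?thesis
          using z(4-6,8) z'(4-6,8) n1 hst acts by (simp add: R_def hist_Suc vis_eq_iff)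
      next
        case False
        hence bl: "0 < blen ?s" by simp
        have rm': "rnd (conf w (Suc u)) = m"
          using r_le rnd_mono[of u "Suc u" w] rm by simp
        have st: "start_count (conf w t) = start_count ?s"
          using in_round_mono(3)[of u t w] bl Suc.prems rm rt by auto
        hence bd: "blen ?s = d" using bt by (simp add: blen_def)
        have bd': "blen ?s' = d" using bd vis by (simp add: vis_eq_iff blen_def)
        let ?ac = "act w u" and ?f = "phase ?s"
        let ?r = "recv w ?ac ?s" and ?r' = "recv w' ?ac ?s'"
        let ?lc = "local_count (bump ?ac ?s) i"
        have v: "rnd ?s' = m" "start_count ?s' = start_count ?s" "local_count ?s' = local_count ?s"
          "phase ?s' = phase ?s" "answer ?s' = answer ?s"
          using vis rm by (auto simp: vis_eq_iff)
        have lcb': "local_count (bump ?ac ?s') = local_count (bump ?ac ?s)" using v by auto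
        have rS: "rnd (conf w (Suc u)) = rnd ?s" using rm rm' by simp
        have ne: "\<not> ends ?ac ?s"
          by (rule in_round_cases[OF rS bl])
        have ne': "\<not> ends ?ac ?s'" using ne v bd bd' by (simp add: ends_def)
        have lcS: "local_count (conf w (Suc u)) = local_count (bump ?ac ?s)"
          by (rule in_round_cases[OF rS bl]) simp_all
        let ?dx = "of_bool (?ac = Some i \<and> local_count ?s i + 1 = nx) :: nat"
        let ?dy = "of_bool (?ac = Some i \<and> local_count ?s i + 1 = ny) :: nat"
        have blk: "(n - 1) mod d + 1 = v \<longleftrightarrow> n = (b - 1) * d + v"
          if "(n - 1) div d + 1 = b" "1 \<le> n" "v \<in> {1..d}" for n v
        proof -
          have "n - 1 = (b - 1) * d + (n - 1) mod d"
            using that(1) div_mult_mod_eq[of "n - 1" d] by auto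
          thus ?thesis using that(2,3) by auto
        qed
        have blk': "((b - 1) * d + v - 1) div d + 1 = b" if "v \<in> {1..d}" for v
        proof -
          have "(b - 1) * d + v - 1 = (v - 1) + (b - 1) * d" using that by auto
          moreover have "v - 1 < d" using that by auto
          ultimately have "((b - 1) * d + v - 1) div d = b - 1" by simp
          thus ?thesis using b by simp
        qed
        have sent: "sent w' ?ac ?s' + ?dx = sent w ?ac ?s + ?dy"
        proof (cases "?ac = Some i")
          case True
          let ?n = "local_count ?s i + 1"
          show ?thesis
          proof (cases "(?n - 1) div d + 1 = b")
            case in_b: True
            hence "hit w m d i ?n \<longleftrightarrow> ?n = nx" "hit w' m d i ?n \<longleftrightarrow> ?n = ny"
              using blk[of ?n x] blk[of ?n y] x y thr by (simp_all add: hit_def fw' nx_def ny_def)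
            thus ?thesis using True v rm bd bd' by (simp add: sent_def)
          next
            case not_b: False
            have "?n \<noteq> nx" "?n \<noteq> ny" using not_b blk'[OF x] blk'[OF y] unfolding nx_def ny_def by metis+
            moreover have "hit w m d i ?n \<longleftrightarrow> hit w' m d i ?n"
              using not_b by (auto simp: hit_def fw')
            ultimately show ?thesis using True v rm bd bd' by (simp add: sent_def)
          qed
        next
          case False
          hence "sent w' ?ac ?s' = sent w ?ac ?s"
            using v rm bd bd' by (auto simp: sent_def hit_def fw' split: option.splits)
          thus ?thesis using False by simp
        qed
        have crx: "cross w m i n u \<longleftrightarrow> ?ac = Some i \<and> local_count ?s i + 1 = n" for n
          using rm by (auto simp: cross_def lcS split: if_splits)
        have u_t: "u < t" using Suc.prems by simp
        have ax: "a = ?f" if "?ac = Some i \<and> local_count ?s i + 1 = nx"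
          using cross_phase_eq[of w m i nx u t] crx that n1 u_t by (simp add: a_def)
        have py: "p = ?f" if "?ac = Some i \<and> local_count ?s i + 1 = ny"
          using cross_phase_eq[of w m i ny u t] crx that n1 u_t by (simp add: p_def)
        have splitx: "of_bool (nx \<le> ?lc \<and> a = ?f) = of_bool (nx \<le> local_count ?s i \<and> a = ?f) + ?dx"
          using ax by (auto simp: of_bool_def)
        have splity: "of_bool (ny \<le> ?lc \<and> p = ?f) = of_bool (ny \<le> local_count ?s i \<and> p = ?f) + ?dy"
          using py by (auto simp: of_bool_def)
        have bits: "bit_count ?r' + of_bool (nx \<le> ?lc \<and> a = ?f) = bit_count ?r + of_bool (ny \<le> ?lc \<and> p = ?f)"
        proof -
          have "bit_count ?s' + of_bool (nx \<le> local_count ?s i \<and> a = ?f) =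
              bit_count ?s + of_bool (ny \<le> local_count ?s i \<and> p = ?f)"
            using IH rm unfolding R_def by blast
          thus ?thesis unfolding splitx splity recv_simps using sent by linarith
        qed
        have cin: "counter_in ?s' q + of_bool (a = q) = counter_in ?s q + of_bool (p = q)"
          if "q \<in> {1..<?f}" for q
          using IH rm that unfolding R_def by blast
        have f1: "1 \<le> ?f" using inv_conf[of w u] by (simp add: inv_def)
        \<comment> \<open>As \<open>?f\<close> is at least 1, it is not the default value of
          \<open>cross_phase\<close>, so the item does arrive, and it arrives later in the current
          phase.\<close>
        have future: "\<exists>v. u < v \<and> v < t \<and> cross w m i n v \<and> phase (conf w v) = ?f"
          if "cross_phase t m i n w = ?f" "?lc < n" "1 \<le> n" for n
        proof -
          have "\<exists>v<t. cross w m i n v"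
          proof (rule ccontr)
            assume "\<not> ?thesis"
            hence "cross_phase t m i n w = 0" by (simp only: cross_phase_def if_False)
            thus False using that f1 by simp
          qed
          then obtain v where v: "v < t" "cross w m i n v" by blast
          have pv: "phase (conf w v) = ?f" using cross_phase_eq[OF v(2,1)] that by simp
          have "u < v"
          proof (rule ccontr)
            assume "\<not> u < v"
            hence "Suc v \<le> Suc u" by simp
            hence "local_count (conf w (Suc v)) i \<le> local_count (conf w (Suc u)) i"
              using cross_in_round[OF v(2) that(3)] rm' by (intro in_round_mono(2)) auto
            thus False using v(2) that(2) by (simp add: cross_def lcS)
          qed
          thus ?thesis using v pv by blast
        qed
        have no_end: "conf w (Suc u) = ?r \<and> real (bit_count ?r) < that w m ?f"
          if "u < v" "v < t" "rnd (conf w v) = m" "phase (conf w v) = ?f" for v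
        proof -
          have "phase (conf w (Suc u)) \<le> ?f"
            using in_round_mono(1)[of "Suc u" v w] that rm' by simp
          moreover
          from in_round_cases[OF rS bl]
          have "conf w (Suc u) = ?r \<and> real (bit_count ?r) < that w m ?f \<or> conf w (Suc u) = next_phase w ?r"
            by cases (use rm in simp_all)
          ultimately show ?thesis by auto
        qed
        have that': "that w' m ?f = that w m ?f + of_bool (p = ?f) - of_bool (a = ?f)"
          by (auto simp: tw' thr_shift_def)
        \<comment> \<open>In \<open>none\<close> counter and threshold have changed by the same
          amount. In \<open>fy\<close> the counter of the shifted run lies one further below its
          threshold. The critical case is \<open>fx\<close>: the threshold is already lowered
          although the bit that pays for it is still to come.\<close>
        consider (none) "a = ?f \<longrightarrow> nx \<le> ?lc" "p = ?f \<longrightarrow> ny \<le> ?lc"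
          | (fx) "a = ?f" "?lc < nx" | (fy) "p = ?f" "?lc < ny" "a = ?f \<longrightarrow> nx \<le> ?lc"
          by (meson not_le)
        hence test: "(real (bit_count ?r') < that w' m ?f \<longleftrightarrow> real (bit_count ?r) < that w m ?f) \<and>
           (real (bit_count ?r) < that w m ?f \<or> ((a = ?f \<longrightarrow> nx \<le> ?lc) \<and> (p = ?f \<longrightarrow> ny \<le> ?lc)))"
        proof cases
          case none
          have "bit_count ?r' + of_bool (a = ?f) = bit_count ?r + of_bool (p = ?f)"
            using bits none by (auto simp: of_bool_def)
          from arg_cong[OF this, of real]
          have "real (bit_count ?r') + of_bool (a = ?f) = real (bit_count ?r) + of_bool (p = ?f)"
            by (simp only: of_nat_add of_nat_of_bool)
          thus ?thesis using that' none by auto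
        next
          case fx
          obtain v where v: "u < v" "v < t" "cross w m i nx v" "phase (conf w v) = ?f"
            using future[of nx] fx n1 unfolding a_def by blast
          have rv: "rnd (conf w v) = m" using v(3) by (simp add: cross_def)
          have ne0: "conf w (Suc u) = ?r" "real (bit_count ?r) < that w m ?f"
            using no_end[OF v(1,2) rv v(4)] by auto
          have blv: "blen (conf w v) = d"
            using in_round_mono(3)[of v t w] in_round_mono(3)[of u v w] v rv rm rt bl bd
            by (simp add: blen_def)
          have rSv: "rnd (conf w (Suc v)) = m" by (rule cross_in_round[OF v(3) n1(1)])
          note cv = cross_act[OF v(3) n1(1)] 
          have lv: "local_count (conf w v) i div d + 1 = b"
            using cv blv d blk'[OF x] unfolding nx_def by simp
          \<comment> \<open>This is where leaks are excluded. If the arrival of \<open>nx\<close>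
            does not end the phase, then the counter is below the threshold even with its bit
            included, so at the present time the slack exceeds 1 and covers the lowered
            threshold.\<close>
          have "phase (conf w (Suc v)) = ?f"
          proof (rule ccontr)
            assume "phase (conf w (Suc v)) \<noteq> ?f"
            hence "leaked t m i b w"
              unfolding leaked_def using v(2,4) rv rSv cv(1) blv d lv by (intro exI[of _ v]) simp
            thus False using nl by simp
          qed
          moreover
          have rS': "rnd (conf w (Suc v)) = rnd (conf w v)" using rv rSv by simp
          have "0 < blen (conf w v)" using blv d by simp
          from in_round_cases[OF rS' this]
          have "(conf w (Suc v) = recv w (act w v) (conf w v) \<and>
             real (bit_count (recv w (act w v) (conf w v))) < that w m ?f) \<or>
             conf w (Suc v) = next_phase w (recv w (act w v) (conf w v))"
            by cases (use rv v(4) in simp_all)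
          ultimately have lst: "conf w (Suc v) = recv w (act w v) (conf w v)"
             "real (bit_count (recv w (act w v) (conf w v))) < that w m ?f"
            using v(4) by auto
          have "hit w m d i nx" using blk'[OF x] blk[of nx x] x thr n1 by (simp add: hit_def nx_def)
          hence "sent w (act w v) (conf w v) = 1" using cv blv d rv by (simp add: sent_def)
          moreover have "bit_count ?r \<le> bit_count (conf w v)"
            using in_round_mono(4)[of "Suc u" v w] v rv rm' ne0 by simp
          ultimately have "real (bit_count ?r) + 1 < that w m ?f" using lst by simp
          moreover have "bit_count ?r' \<le> bit_count ?r + of_bool (p = ?f)"
            using bits fx by (auto simp: of_bool_def split: if_splits)
          from of_nat_mono[OF this, where ?'a = real]
          have "real (bit_count ?r') \<le> real (bit_count ?r) + of_bool (p = ?f)"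
            by (simp only: of_nat_add of_nat_of_bool)
          ultimately show ?thesis using that' fx ne0 by auto
        next
          case fy
          obtain v where v: "u < v" "v < t" "cross w m i ny v" "phase (conf w v) = ?f"
            using future[of ny] fy n1 unfolding p_def by blast
          have rv: "rnd (conf w v) = m" using v(3) by (simp add: cross_def)
          have ne0: "conf w (Suc u) = ?r" "real (bit_count ?r) < that w m ?f"
            using no_end[OF v(1,2) rv v(4)] by auto
          have "bit_count ?r' + of_bool (a = ?f) = bit_count ?r"
            using bits fy by (auto simp: of_bool_def)
          from arg_cong[OF this, of real]
          have "real (bit_count ?r') + of_bool (a = ?f) = real (bit_count ?r)"
            by (simp only: of_nat_add of_nat_of_bool)
          thus ?thesis using that' fy ne0 by auto
        qed
        show ?thesis
        proof (cases "real (bit_count ?r) < that w m ?f")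
          case True
          have c: "conf w (Suc u) = ?r" "conf w' (Suc u) = ?r'"
            using True test bl bd' d ne ne' rm v by (auto simp: conf_Suc step_eq check_phase_eq acts)
          have "vis (conf w (Suc u)) = vis (conf w' (Suc u))"
            using c v lcb' rm by (simp add: vis_eq_iff)
          thus ?thesis using c bits cin hst acts rm unfolding R_def
            by (simp add: hist_Suc vis_eq_iff)
        next
          case False
          hence all: "a = ?f \<longrightarrow> nx \<le> ?lc" "p = ?f \<longrightarrow> ny \<le> ?lc" using test by auto
          have "?f < hz"
          proof (rule ccontr)
            assume "\<not> ?f < hz"
            hence "conf w (Suc u) = restart k ?r"
              using False bl ne rm by (simp add: conf_Suc step_eq check_phase_eq)
            thus False using rm rm' by simp
          qed
          hence c: "conf w (Suc u) = next_phase w ?r" "conf w' (Suc u) = next_phase w' ?r'"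
            using False test bl bd' d ne ne' rm v by (auto simp: conf_Suc step_eq check_phase_eq acts)
          have bits': "bit_count ?r' + of_bool (a = ?f) = bit_count ?r + of_bool (p = ?f)"
            using bits all by (auto simp: of_bool_def)
          have cin': "((counter_in ?s')(?f := bit_count ?r')) q + of_bool (a = q) =
              ((counter_in ?s)(?f := bit_count ?r)) q + of_bool (p = q)" if "q \<in> {1..?f}" for q
            using cin[of q] bits' that by (cases "q = ?f") auto
          have "bm_prefix hz (\<lambda>l q. snd (snd w') (m, l, q)) ((counter_in ?s')(?f := bit_count ?r')) ?f =
             bm_prefix hz (\<lambda>l q. snd (snd w) (m, l, q)) ((counter_in ?s)(?f := bit_count ?r)) ?f"
            by (rule bm_prefix_shift[OF cin' lw'])
          hence vS: "vis (conf w (Suc u)) = vis (conf w' (Suc u))"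
            using c v lcb' rm bd bd' by (simp add: vis_eq_iff)
          \<comment> \<open>Items that have already arrived belong to phases up to
            \<open>?f\<close>. Hence neither correction term is active in the new phase, where both
            counters start at 0.\<close>
          have past: "cross_phase t m i n w \<noteq> ?f + 1" if "n \<le> ?lc" "1 \<le> n" for n
          proof -
            have "n \<le> local_count (conf w (Suc u)) i" using that by (simp add: lcS)
            from cross_exists[OF that(2) this] obtain v where v: "v < Suc u" "cross w m i n v"
              using rm' by auto
            have "phase (conf w v) \<le> ?f" using v rm by (intro in_round_mono(1)) (auto simp: cross_def)
            moreover have "cross_phase t m i n w = phase (conf w v)"
              using v u_t that by (intro cross_phase_eq) auto
            ultimately show ?thesis by simp
          qed
          have "\<not> (nx \<le> ?lc \<and> a = ?f + 1)" "\<not> (ny \<le> ?lc \<and> p = ?f + 1)"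
            using past n1 by (auto simp: a_def p_def)
          hence "bit_count (conf w' (Suc u)) +
                of_bool (nx \<le> local_count (conf w (Suc u)) i \<and> a = phase (conf w (Suc u))) =
              bit_count (conf w (Suc u)) +
                of_bool (ny \<le> local_count (conf w (Suc u)) i \<and> p = phase (conf w (Suc u)))"
            unfolding lcS c next_phase_simps recv_simps by (simp only: of_bool_eq simp_thms)
          moreover have "counter_in (conf w' (Suc u)) q + of_bool (a = q) =
              counter_in (conf w (Suc u)) q + of_bool (p = q)" if "q \<in> {1..<phase (conf w (Suc u))}" for q
            using cin'[of q] that unfolding c next_phase_simps recv_simps v by simp
          moreover have "answer (conf w (Suc u)) = answer (conf w' (Suc u))"
            using vS by (simp only: vis_eq_iff)
          hence "hist w (Suc u) = hist w' (Suc u)" by (simp only: hist_Suc hst acts)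
          ultimately show ?thesis
            unfolding R_def using vS rm' by blast
        qed
      qed
    qed
  qed
  thus ?thesis by (simp add: same_view_def R_def)
qed

end

subsection \<open>Measurability of a run\<close>

abbreviation thr_measure :: "(nat \<times> nat \<times> nat \<times> nat \<Rightarrow> nat) measure" where
  "thr_measure \<equiv> PiM UNIV (\<lambda>(m, i, j, d). measure_pmf (pmf_of_set {1..d}))"

lemma tape_measure_eq: "tape_measure k C = thr_measure \<Otimes>\<^sub>M
    (PiM UNIV (\<lambda>_. laplace (4 / priv k C)) \<Otimes>\<^sub>M
     PiM UNIV (\<lambda>_. laplace (real (bm_levels (horizon k)) / (priv k C / 4))))"
proof -
  have "(\<lambda>(m::nat, j::nat). laplace b) = (\<lambda>_. laplace b)"
    "(\<lambda>(m::nat, l::nat, q::nat). laplace b) = (\<lambda>_. laplace b)" for b by auto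
  thus ?thesis unfolding tape_measure_def by simp
qed

lemma tape_measurable:
  assumes f: "f \<in> M \<rightarrow>\<^sub>M tape_measure k C"
  shows "(\<lambda>x. fst (f x) c) \<in> M \<rightarrow>\<^sub>M count_space UNIV"
    "(\<lambda>x. fst (snd (f x)) q) \<in> borel_measurable M"
    "(\<lambda>x. snd (snd (f x)) r) \<in> borel_measurable M"
proof -
  note f' = f[unfolded tape_measure_eq]
  note f1 = measurable_compose[OF f' measurable_fst] and f2 = measurable_compose[OF f' measurable_snd]
  note f3 = measurable_compose[OF f2 measurable_fst] and f4 = measurable_compose[OF f2 measurable_snd]
  obtain m i j d where c: "c = (m, i, j, d)" by (cases c) auto
  have "(\<lambda>x. fst (f x) c) \<in> M \<rightarrow>\<^sub>M measure_pmf (pmf_of_set {1..d})"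
    using measurable_compose[OF f1 measurable_component_singleton[OF UNIV_I, of c]] by (simp add: c)
  thus "(\<lambda>x. fst (f x) c) \<in> M \<rightarrow>\<^sub>M count_space UNIV"
    by (simp only: measurable_cong_sets[OF refl sets_measure_pmf_count_space])
  show "(\<lambda>x. fst (snd (f x)) q) \<in> borel_measurable M"
    using measurable_compose[OF f3 measurable_component_singleton[OF UNIV_I, of q]]
    by (simp only: measurable_cong_sets[OF refl sets_laplace])
  show "(\<lambda>x. snd (snd (f x)) r) \<in> borel_measurable M"
    using measurable_compose[OF f4 measurable_component_singleton[OF UNIV_I, of r]]
    by (simp only: measurable_cong_sets[OF refl sets_laplace])
qed

text \<open>Takes the place of a sigma algebra on configurations: measurability field by field, and
  pointwise for the fields that are functions.\<close>

definition meas_conf :: "'a measure \<Rightarrow> ('a \<Rightarrow> conf) \<Rightarrow> bool" where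
  "meas_conf M s \<longleftrightarrow> (\<lambda>x. rnd (s x)) \<in> M \<rightarrow>\<^sub>M count_space UNIV \<and>
    (\<lambda>x. start_count (s x)) \<in> M \<rightarrow>\<^sub>M count_space UNIV \<and>
    (\<forall>i. (\<lambda>x. local_count (s x) i) \<in> M \<rightarrow>\<^sub>M count_space UNIV) \<and>
    (\<lambda>x. phase (s x)) \<in> M \<rightarrow>\<^sub>M count_space UNIV \<and>
    (\<lambda>x. bit_count (s x)) \<in> M \<rightarrow>\<^sub>M count_space UNIV \<and>
    (\<forall>i. (\<lambda>x. counter_in (s x) i) \<in> M \<rightarrow>\<^sub>M count_space UNIV) \<and>
    (\<lambda>x. answer (s x)) \<in> borel_measurable M \<and>
    (\<lambda>x. words (s x)) \<in> M \<rightarrow>\<^sub>M count_space UNIV"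

lemma meas_confD [measurable_dest]:
  assumes "meas_conf M s"
  shows "(\<lambda>x. rnd (s x)) \<in> M \<rightarrow>\<^sub>M count_space UNIV"
    "(\<lambda>x. start_count (s x)) \<in> M \<rightarrow>\<^sub>M count_space UNIV"
    "\<And>i. (\<lambda>x. local_count (s x) i) \<in> M \<rightarrow>\<^sub>M count_space UNIV"
    "(\<lambda>x. phase (s x)) \<in> M \<rightarrow>\<^sub>M count_space UNIV"
    "(\<lambda>x. bit_count (s x)) \<in> M \<rightarrow>\<^sub>M count_space UNIV"
    "\<And>i. (\<lambda>x. counter_in (s x) i) \<in> M \<rightarrow>\<^sub>M count_space UNIV"
    "(\<lambda>x. answer (s x)) \<in> borel_measurable M"
    "(\<lambda>x. words (s x)) \<in> M \<rightarrow>\<^sub>M count_space UNIV"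
  using assms by (auto simp: meas_conf_def)

lemma measurable_nat_fun:
  fixes g :: "nat \<Rightarrow> nat"
  assumes "f \<in> M \<rightarrow>\<^sub>M count_space UNIV" shows "(\<lambda>x. g (f x)) \<in> M \<rightarrow>\<^sub>M count_space UNIV"
  using measurable_compose[OF assms, of g "count_space UNIV"] by simp

lemma measurable_If_arg:
  assumes "Measurable.pred M P" "(\<lambda>x. g (s x)) \<in> M \<rightarrow>\<^sub>M N" "(\<lambda>x. g (s' x)) \<in> M \<rightarrow>\<^sub>M N"
  shows "(\<lambda>x. g (if P x then s x else s' x)) \<in> M \<rightarrow>\<^sub>M N"
proof -
  have "(\<lambda>x. if P x then g (s x) else g (s' x)) \<in> M \<rightarrow>\<^sub>M N"
    using assms by measurable
  moreover have "(\<lambda>x. g (if P x then s x else s' x)) = (\<lambda>x. if P x then g (s x) else g (s' x))"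
    by auto
  ultimately show ?thesis by simp
qed

lemma meas_conf_If:
  assumes "Measurable.pred M P" "meas_conf M s" "meas_conf M s'"
  shows "meas_conf M (\<lambda>x. if P x then s x else s' x)"
proof -
  note * = measurable_If_arg[OF assms(1)]
  note s = meas_confD[OF assms(2)] and s' = meas_confD[OF assms(3)]
  show ?thesis
    unfolding meas_conf_def
    using *[where g = rnd, OF s(1) s'(1)] *[where g = start_count, OF s(2) s'(2)]
      *[where g = "\<lambda>s. local_count s _", OF s(3) s'(3)] *[where g = phase, OF s(4) s'(4)]
      *[where g = bit_count, OF s(5) s'(5)] *[where g = "\<lambda>s. counter_in s _", OF s(6) s'(6)]
      *[where g = answer, OF s(7) s'(7)] *[where g = words, OF s(8) s'(8)]
    by (intro conjI allI)
qed

context tracking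
begin

context
  fixes M :: "'x measure" and f :: "'x \<Rightarrow> tape"
  assumes f: "f \<in> M \<rightarrow>\<^sub>M tape_measure k C"
begin

declare tape_measurable[OF f, measurable]

lemma meas_blen:
  assumes "meas_conf M s" shows "(\<lambda>x. blen (s x)) \<in> M \<rightarrow>\<^sub>M count_space UNIV"
  unfolding blen_def by (rule measurable_nat_fun) (rule meas_confD[OF assms])

lemma meas_total:
  assumes "meas_conf M s" shows "(\<lambda>x. total k (s x)) \<in> M \<rightarrow>\<^sub>M count_space UNIV"
  unfolding total_def using meas_confD[OF assms] by measurable

lemma meas_restart:
  assumes "meas_conf M s" shows "meas_conf M (\<lambda>x. restart k (s x))"
proof -
  note [measurable] = meas_confD[OF assms] meas_total[OF assms]
  show ?thesis unfolding meas_conf_def restart_simps by (intro conjI allI) measurable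
qed

lemma meas_forward:
  assumes "meas_conf M s" shows "meas_conf M (\<lambda>x. forward k \<alpha> C (s x))"
proof -
  note [measurable] = meas_confD[OF assms]
  have [measurable]: "(\<lambda>x. block_len k \<alpha> C (start_count (s x) + 1)) \<in> M \<rightarrow>\<^sub>M count_space UNIV"
    by (rule measurable_nat_fun[where g = "\<lambda>n. block_len k \<alpha> C (n + 1)"]) measurable
  show ?thesis unfolding meas_conf_def forward_simps by (intro conjI allI) measurable
qed

text \<open>The round and the phase that select the noise are themselves random, so the entry that
  is read is split according to their countably many values.\<close>

lemma meas_that:
  assumes [measurable]: "m \<in> M \<rightarrow>\<^sub>M count_space UNIV" "j \<in> M \<rightarrow>\<^sub>M count_space UNIV"
  shows "(\<lambda>x. that (f x) (m x) (j x)) \<in> borel_measurable M"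
proof -
  have "(\<lambda>x. that (f x) m' (j x)) \<in> borel_measurable M" for m'
    by (rule measurable_compose_countable[where g = j]) (unfold that_def, measurable)
  thus ?thesis
    by (rule measurable_compose_countable[where g = m and f = "\<lambda>m' x. that (f x) m' (j x)"]) measurable
qed

lemma meas_next_phase:
  assumes "meas_conf M s" shows "meas_conf M (\<lambda>x. next_phase (f x) (s x))"
proof -
  note [measurable] = meas_confD[OF assms] meas_blen[OF assms]
  let ?x = "\<lambda>x. (counter_in (s x))(phase (s x) := bit_count (s x))"
  have [measurable]: "(\<lambda>x. ?x x i) \<in> M \<rightarrow>\<^sub>M count_space UNIV" for i
    unfolding fun_upd_apply by measurable
  have "(\<lambda>x. bm_prefix hz (\<lambda>l q. snd (snd (f x)) (m, l, q)) (?x x) j) \<in> borel_measurable M" for m j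
    unfolding bm_prefix_def by measurable
  hence "(\<lambda>x. bm_prefix hz (\<lambda>l q. snd (snd (f x)) (m, l, q)) (?x x) (phase (s x))) \<in> borel_measurable M" for m
    by (rule measurable_compose_countable[where g = "\<lambda>x. phase (s x)"]) measurable
  hence [measurable]: "(\<lambda>x. bm_prefix hz (\<lambda>l q. snd (snd (f x)) (rnd (s x), l, q)) (?x x) (phase (s x)))
      \<in> borel_measurable M"
    by (rule measurable_compose_countable[where g = "\<lambda>x. rnd (s x)"
          and f = "\<lambda>m x. bm_prefix hz (\<lambda>l q. snd (snd (f x)) (m, l, q)) (?x x) (phase (s x))"]) measurable
  show ?thesis unfolding meas_conf_def next_phase_simps by (intro conjI allI) measurable
qed

context
  fixes a :: "'x \<Rightarrow> nat option"
  assumes a[measurable]: "a \<in> M \<rightarrow>\<^sub>M count_space UNIV"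
begin

lemma meas_bump:
  assumes "meas_conf M s" shows "meas_conf M (\<lambda>x. bump (a x) (s x))"
proof -
  note [measurable] = meas_confD[OF assms]
  show ?thesis unfolding meas_conf_def bump_simps by (intro conjI allI) measurable
qed

lemma meas_sent:
  assumes "meas_conf M s" shows "(\<lambda>x. sent (f x) (a x) (s x)) \<in> M \<rightarrow>\<^sub>M count_space UNIV"
proof -
  note [measurable] = meas_confD[OF assms] meas_blen[OF assms]
  \<comment> \<open>Quantifying over the values of all indices replaces the random position on the
    tape by countably many fixed ones.\<close>
  have "sent (f x) (a x) (s x) = (if \<exists>i m d n. a x = Some i \<and> rnd (s x) = m \<and> blen (s x) = d \<and>
      local_count (s x) i = n \<and> n mod d + 1 = fst (f x) (m, i, n div d + 1, d) then 1 else 0)" for x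
    by (auto simp: sent_def hit_def split: option.splits)
  moreover have "(\<lambda>x. if \<exists>i m d n. a x = Some i \<and> rnd (s x) = m \<and> blen (s x) = d \<and>
      local_count (s x) i = n \<and> n mod d + 1 = fst (f x) (m, i, n div d + 1, d) then 1 else 0 :: nat)
      \<in> M \<rightarrow>\<^sub>M count_space UNIV"
    by measurable
  ultimately show ?thesis by simp
qed

lemma meas_recv:
  assumes "meas_conf M s" shows "meas_conf M (\<lambda>x. recv (f x) (a x) (s x))"
proof -
  note [measurable] = meas_confD[OF assms] meas_confD[OF meas_bump[OF assms]] meas_sent[OF assms]
  show ?thesis unfolding meas_conf_def recv_simps by (intro conjI allI) measurable
qed

lemma meas_step:
  assumes s: "meas_conf M s" shows "meas_conf M (\<lambda>x. step k \<alpha> C (f x) (a x) (s x))"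
proof -
  note [measurable] = meas_confD[OF s] meas_blen[OF s]
  have 1: "step k \<alpha> C (f x) (a x) (s x) = (if blen (s x) = 0 then if a x = None then s x else forward k \<alpha> C (s x)
    else if \<exists>i. a x = Some i \<and> nb < local_count (s x) i div blen (s x) + 1
      then restart k ((bump (a x) (s x))\<lparr>words := words (s x) + 1\<rparr>)
    else if real (bit_count (recv (f x) (a x) (s x))) < that (f x) (rnd (s x)) (phase (s x))
      then recv (f x) (a x) (s x)
    else if phase (s x) < hz then next_phase (f x) (recv (f x) (a x) (s x))
    else restart k (recv (f x) (a x) (s x)))" for x
    by (auto simp: step_eq check_phase_eq ends_def split: option.splits)
  have w: "meas_conf M (\<lambda>x. (bump (a x) (s x))\<lparr>words := words (s x) + 1\<rparr>)"
  proof -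
    note [measurable] = meas_confD[OF meas_bump[OF s]]
    show ?thesis unfolding meas_conf_def by simp
  qed
  note [measurable] = meas_confD[OF meas_recv[OF s]] meas_that[where m = "\<lambda>x. rnd (s x)" and j = "\<lambda>x. phase (s x)"]
  show ?thesis
    unfolding 1
    by (intro meas_conf_If meas_restart meas_forward meas_next_phase meas_recv s w) measurable
qed

end

text \<open>The coins enter through an arbitrary measurable \<open>g\<close>, so this covers fixed
  coins as well as the product space on which the final probability is taken.\<close>

lemma meas_run:
  assumes g[measurable]: "g \<in> M \<rightarrow>\<^sub>M S" and adv: "\<And>t. adv t \<in> S \<Otimes>\<^sub>M history_space t \<rightarrow>\<^sub>M count_space UNIV"
  shows "meas_conf M (\<lambda>x. fst (run k \<alpha> C adv (g x) (f x) t))"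
    "(\<lambda>x. snd (run k \<alpha> C adv (g x) (f x) t)) \<in> M \<rightarrow>\<^sub>M history_space t"
    "(\<lambda>x. adv t (g x, snd (run k \<alpha> C adv (g x) (f x) t))) \<in> M \<rightarrow>\<^sub>M count_space UNIV"
proof -
  have act: "(\<lambda>x. adv t (g x, snd (run k \<alpha> C adv (g x) (f x) t))) \<in> M \<rightarrow>\<^sub>M count_space UNIV"
    if [measurable]: "(\<lambda>x. snd (run k \<alpha> C adv (g x) (f x) t)) \<in> M \<rightarrow>\<^sub>M history_space t" for t
    by (rule measurable_compose[OF _ adv]) measurable
  have "meas_conf M (\<lambda>x. fst (run k \<alpha> C adv (g x) (f x) t)) \<and>
    (\<lambda>x. snd (run k \<alpha> C adv (g x) (f x) t)) \<in> M \<rightarrow>\<^sub>M history_space t"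
  proof (induction t)
    case 0
    show ?case by (simp add: meas_conf_def history_space_def space_PiM)
  next
    case (Suc t)
    note act' = act[OF conjunct2[OF Suc]]
    have st: "meas_conf M (\<lambda>x. step k \<alpha> C (f x) (adv t (g x, snd (run k \<alpha> C adv (g x) (f x) t)))
        (fst (run k \<alpha> C adv (g x) (f x) t)))"
      by (rule meas_step[OF act' conjunct1[OF Suc]])
    have eq: "run k \<alpha> C adv (g x) (f x) (Suc t) =
      (let a = adv t (g x, snd (run k \<alpha> C adv (g x) (f x) t));
           s = step k \<alpha> C (f x) a (fst (run k \<alpha> C adv (g x) (f x) t))
       in (s, (snd (run k \<alpha> C adv (g x) (f x) t))(t := (a, answer s))))" for x
      by (simp add: split_beta Let_def)
    have ins: "{..<Suc t} = {..<t} \<union> {t}" by auto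
    have "(\<lambda>x. (snd (run k \<alpha> C adv (g x) (f x) t))(t := (adv t (g x, snd (run k \<alpha> C adv (g x) (f x) t)),
        answer (step k \<alpha> C (f x) (adv t (g x, snd (run k \<alpha> C adv (g x) (f x) t)))
        (fst (run k \<alpha> C adv (g x) (f x) t)))))) \<in> M \<rightarrow>\<^sub>M history_space (Suc t)"
      unfolding history_space_def
      by (rule measurable_fun_upd[OF ins])
         (use Suc act' meas_confD(7)[OF st] in \<open>auto simp: history_space_def\<close>)
    thus ?case using st unfolding eq Let_def fst_conv snd_conv by blast
  qed
  thus "meas_conf M (\<lambda>x. fst (run k \<alpha> C adv (g x) (f x) t))"
    and h: "(\<lambda>x. snd (run k \<alpha> C adv (g x) (f x) t)) \<in> M \<rightarrow>\<^sub>M history_space t" by auto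
  from act[OF h] show "(\<lambda>x. adv t (g x, snd (run k \<alpha> C adv (g x) (f x) t))) \<in> M \<rightarrow>\<^sub>M count_space UNIV" .
qed

end

end

subsection \<open>Resampling a threshold and shifting the noise\<close>

lemma prob_space_thr_measure: "prob_space thr_measure"
  by (rule prob_space_PiM) (auto simp: prob_space_measure_pmf split: prod.splits)

text \<open>On each level a positive index lies in exactly one interval and 0 in none, which bounds
  the number of noise entries that \<open>bin_shift\<close> touches.\<close>

lemma dyadic_iff: "a \<in> dyadic l q \<longleftrightarrow> 1 \<le> a \<and> q = (a - 1) div 2 ^ l"
proof
  assume "a \<in> dyadic l q"
  hence "q * 2 ^ l < a" "a \<le> q * 2 ^ l + 2 ^ l" by (auto simp: dyadic_def)
  hence "1 \<le> a" "2 ^ l * q \<le> a - 1" "a - 1 < 2 ^ l * Suc q" by (auto simp: mult.commute)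
  thus "1 \<le> a \<and> q = (a - 1) div 2 ^ l" using div_nat_eqI[of "2 ^ l" q "a - 1"] by simp
next
  assume a: "1 \<le> a \<and> q = (a - 1) div 2 ^ l"
  have "q * 2 ^ l \<le> a - 1" using a by simp
  moreover have "a - 1 < (q + 1) * 2 ^ l"
    using a by (metis Suc_eq_plus1 dividend_less_div_times mult.commute mult_Suc_right add.commute
      zero_less_numeral zero_less_power)
  ultimately show "a \<in> dyadic l q" using a unfolding dyadic_def greaterThanAtMost_iff by linarith
qed

lemma priv_pos: "1 \<le> k \<Longrightarrow> 0 < C \<Longrightarrow> 0 < priv k C"
  by (simp add: priv_def)

lemma bm_levels_pos: "1 \<le> bm_levels h"
  by (simp add: bm_levels_def)

locale tracking_meas = tracking +
  fixes S :: "real measure"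
  assumes adv_meas: "\<And>t. adv t \<in> S \<Otimes>\<^sub>M history_space t \<rightarrow>\<^sub>M count_space UNIV"
    and z_space: "z \<in> space S"
begin

abbreviation "TM \<equiv> tape_measure k C"
abbreviation "eps \<equiv> priv k C"
abbreviation "lap1 \<equiv> (PiM UNIV (\<lambda>_. laplace (4 / eps)) :: (nat \<times> nat \<Rightarrow> real) measure)"
abbreviation "lap2 \<equiv> (PiM UNIV (\<lambda>_. laplace (real (bm_levels hz) / (eps / 4))) :: (nat \<times> nat \<times> nat \<Rightarrow> real) measure)"

lemma eps_pos: "0 < eps"
  using k_pos C_ge1 by (intro priv_pos) auto

lemma scales_pos: "0 < 4 / eps" "0 < real (bm_levels hz) / (eps / 4)"
  using eps_pos bm_levels_pos[of hz] by auto

lemma prob_lap: "prob_space lap1" "prob_space lap2"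
  by (rule prob_space_PiM, rule prob_space_laplace, rule scales_pos)+

lemma prob_space_lap: "prob_space (lap1 \<Otimes>\<^sub>M lap2)"
  by (intro prob_space_pair prob_lap)

lemma prob_space_TM: "prob_space TM"
  unfolding tape_measure_eq by (intro prob_space_pair prob_space_thr_measure prob_space_lap)

lemma meas_conf_conf: "meas_conf TM (\<lambda>w. conf w t)"
  and hist_meas: "(\<lambda>w. hist w t) \<in> TM \<rightarrow>\<^sub>M history_space t"
  and act_meas: "(\<lambda>w. act w t) \<in> TM \<rightarrow>\<^sub>M count_space UNIV"
proof -
  have id: "(\<lambda>w. w) \<in> TM \<rightarrow>\<^sub>M TM" by simp
  have g: "(\<lambda>w. z) \<in> TM \<rightarrow>\<^sub>M S" using z_space by simp
  show "meas_conf TM (\<lambda>w. conf w t)" "(\<lambda>w. hist w t) \<in> TM \<rightarrow>\<^sub>M history_space t"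
    "(\<lambda>w. act w t) \<in> TM \<rightarrow>\<^sub>M count_space UNIV"
    unfolding conf_def run_conf_def hist_def act_def by (rule meas_run[OF id g adv_meas])+
qed

declare meas_confD[OF meas_conf_conf, measurable] act_meas[measurable]
declare meas_blen[OF measurable_ident_sets[OF refl] meas_conf_conf, measurable]
  meas_total[OF measurable_ident_sets[OF refl] meas_conf_conf, measurable]
  tape_measurable[OF measurable_ident_sets[OF refl], measurable]

lemma set_thr_measurable [measurable]: "set_thr c x \<in> TM \<rightarrow>\<^sub>M TM"
proof -
  have sp: "x \<in> space (case c of (m, i, j, d) \<Rightarrow> measure_pmf (pmf_of_set {1..d}))"
    by (auto split: prod.splits)
  have "(\<lambda>w. (fst w)(c := x)) \<in> TM \<rightarrow>\<^sub>M thr_measure"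
    unfolding tape_measure_eq
    by (rule measurable_fun_upd[where J = UNIV, OF _ measurable_fst]) (use sp in auto)
  moreover have "snd \<in> TM \<rightarrow>\<^sub>M lap1 \<Otimes>\<^sub>M lap2"
    unfolding tape_measure_eq by (rule measurable_snd)
  ultimately have "(\<lambda>w. ((fst w)(c := x), snd w)) \<in> TM \<rightarrow>\<^sub>M TM"
    unfolding tape_measure_eq by (rule measurable_Pair)
  thus ?thesis by (simp add: set_thr_def[abs_def])
qed

text \<open>Turns an integral into the average of \<open>d\<close> integrals that differ only in one
  threshold; these are what the coupling compares.\<close>

lemma resample_thr:
  assumes g: "g \<in> borel_measurable TM" and d: "1 \<le> d"
  shows "(\<integral>\<^sup>+w. g w \<partial>TM) = (\<Sum>x\<in>{1..d}. \<integral>\<^sup>+w. g (set_thr (m, i, b, d) x w) \<partial>TM) / ennreal (real d)"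
proof -
  let ?c = "(m, i, b, d)"
  interpret A: prob_space thr_measure by (rule prob_space_thr_measure)
  interpret B: prob_space "lap1 \<Otimes>\<^sub>M lap2" by (rule prob_space_lap)
  interpret pair_sigma_finite thr_measure "lap1 \<Otimes>\<^sub>M lap2" ..
  have g'[measurable]: "g \<in> borel_measurable (thr_measure \<Otimes>\<^sub>M (lap1 \<Otimes>\<^sub>M lap2))"
    using g unfolding tape_measure_eq .
  have gx: "(\<lambda>w. g (set_thr ?c x w)) \<in> borel_measurable (thr_measure \<Otimes>\<^sub>M (lap1 \<Otimes>\<^sub>M lap2))" for x
    using measurable_compose[OF set_thr_measurable g] unfolding tape_measure_eq .
  have pr: "prob_space (case c of (m, i, j, d) \<Rightarrow> measure_pmf (pmf_of_set {1..d}))"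
    for c :: "nat \<times> nat \<times> nat \<times> nat" by (auto simp: prob_space_measure_pmf split: prod.splits)
  have "(\<integral>\<^sup>+w. g w \<partial>TM) = (\<integral>\<^sup>+v. (\<integral>\<^sup>+a. g (a, v) \<partial>thr_measure) \<partial>(lap1 \<Otimes>\<^sub>M lap2))"
    unfolding tape_measure_eq by (rule nn_integral_snd[symmetric]) (rule g')
  also have "\<dots> = (\<integral>\<^sup>+v. (\<integral>\<^sup>+a. (\<Sum>x\<in>{1..d}. g (set_thr ?c x (a, v))) / ennreal (real d) \<partial>thr_measure) \<partial>(lap1 \<Otimes>\<^sub>M lap2))"
  proof (rule nn_integral_cong)
    fix v assume v: "v \<in> space (lap1 \<Otimes>\<^sub>M lap2)"
    have "(\<lambda>a. g (a, v)) \<in> borel_measurable thr_measure" using v by measurable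
    from nn_integral_PiM_resample[OF pr this, of ?c]
    have "(\<integral>\<^sup>+a. g (a, v) \<partial>thr_measure) =
       (\<integral>\<^sup>+a. (\<integral>\<^sup>+x. g (a(?c := x), v) \<partial>measure_pmf (pmf_of_set {1..d})) \<partial>thr_measure)"
      unfolding prod.case .
    also have "\<dots> = (\<integral>\<^sup>+a. (\<Sum>x\<in>{1..d}. g (set_thr ?c x (a, v))) / ennreal (real d) \<partial>thr_measure)"
      using d by (intro nn_integral_cong, subst nn_integral_pmf_of_set)
        (auto simp: set_thr_def ennreal_of_nat_eq_real_of_nat)
    finally show "(\<integral>\<^sup>+a. g (a, v) \<partial>thr_measure) = \<dots>" .
  qed
  also have "\<dots> = (\<integral>\<^sup>+w. (\<Sum>x\<in>{1..d}. g (set_thr ?c x w)) / ennreal (real d) \<partial>TM)"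
    unfolding tape_measure_eq
  proof (rule nn_integral_snd)
    show "(\<lambda>w. (\<Sum>x\<in>{1..d}. g (set_thr ?c x w)) / ennreal (real d)) \<in>
        borel_measurable (thr_measure \<Otimes>\<^sub>M (lap1 \<Otimes>\<^sub>M lap2))"
      using gx by measurable
  qed
  also have "\<dots> = (\<Sum>x\<in>{1..d}. \<integral>\<^sup>+w. g (set_thr ?c x w) \<partial>TM) / ennreal (real d)"
    using gx unfolding tape_measure_eq by (subst nn_integral_divide) (auto simp: nn_integral_sum)
  finally show ?thesis .
qed

text \<open>At most two thresholds move, each by at most 1, at scale \<open>4 / eps\<close>. On
  every level at most two intervals move, each by at most 1, at scale
  \<open>real (bm_levels hz) / (eps / 4)\<close>. Each group costs a factor
  \<open>exp (eps / 2)\<close>.\<close>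

lemma shift_noise:
  assumes g: "g \<in> borel_measurable TM"
  shows "(\<integral>\<^sup>+w. g (noise_shift m a p w) \<partial>TM) \<le> ennreal (exp eps) * (\<integral>\<^sup>+w. g w \<partial>TM)"
proof -
  interpret A: prob_space thr_measure by (rule prob_space_thr_measure)
  interpret L1: prob_space lap1 by (rule prob_lap)
  interpret L2: prob_space lap2 by (rule prob_lap)
  interpret B: prob_space "lap1 \<Otimes>\<^sub>M lap2" by (rule prob_space_lap)
  let ?L = "bm_levels hz"
  have g'[measurable]: "g \<in> borel_measurable (thr_measure \<Otimes>\<^sub>M (lap1 \<Otimes>\<^sub>M lap2))"
    using g unfolding tape_measure_eq .
  have m1: "(\<lambda>x q. x q + thr_shift m a p q) \<in> lap1 \<rightarrow>\<^sub>M lap1"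
    by (rule measurable_PiM_single') (auto simp: space_PiM)
  have m2: "(\<lambda>y q. y q + bin_shift hz m a p q) \<in> lap2 \<rightarrow>\<^sub>M lap2"
    by (rule measurable_PiM_single') (auto simp: space_PiM)
  note [measurable] = m1 m2
  have gs: "(\<lambda>w. g (noise_shift m a p w)) \<in> borel_measurable (thr_measure \<Otimes>\<^sub>M (lap1 \<Otimes>\<^sub>M lap2))"
    unfolding noise_shift_def by measurable
  have c1: "(\<Sum>q\<in>{(m, a), (m, p)}. \<bar>thr_shift m a p q\<bar>) / (4 / eps) \<le> eps / 2"
  proof -
    have "(\<Sum>q\<in>{(m, a), (m, p)}. \<bar>thr_shift m a p q\<bar>) \<le> (\<Sum>q\<in>{(m, a), (m, p)}. 1)"
      by (intro sum_mono) (auto simp: thr_shift_def)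
    also have "\<dots> \<le> 2" by (simp add: card_insert_if)
    finally show ?thesis using eps_pos by (simp add: divide_simps)
  qed
  define J where "J = (\<lambda>l. (m, l, (a - 1) div 2 ^ l)) ` {..<?L} \<union> (\<lambda>l. (m, l, (p - 1) div 2 ^ l)) ` {..<?L}"
  have J: "finite J" "\<And>q. q \<notin> J \<Longrightarrow> bin_shift hz m a p q = 0"
    by (auto simp: J_def bin_shift_def dyadic_iff)
  have c2: "(\<Sum>q\<in>J. \<bar>bin_shift hz m a p q\<bar>) / (real ?L / (eps / 4)) \<le> eps / 2"
  proof -
    have le: "(\<Sum>q\<in>J. \<bar>bin_shift hz m a p q\<bar>) \<le> (\<Sum>q\<in>J. 1)"
      by (intro sum_mono) (auto simp: bin_shift_def)
    have "card J \<le> card ((\<lambda>l. (m, l, (a - 1) div 2 ^ l)) ` {..<?L}) + card ((\<lambda>l. (m, l, (p - 1) div 2 ^ l)) ` {..<?L})"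
      unfolding J_def by (rule card_Un_le)
    also have "\<dots> \<le> ?L + ?L"
      by (intro add_mono) (use card_image_le[of "{..<?L}"] in fastforce)+
    finally have "card J \<le> ?L + ?L" .
    hence "(\<Sum>q\<in>J. (1::real)) \<le> 2 * real ?L" by simp
    hence "(\<Sum>q\<in>J. \<bar>bin_shift hz m a p q\<bar>) \<le> 2 * real ?L" using le by linarith
    thus ?thesis using eps_pos bm_levels_pos[of hz] by (simp add: divide_simps)
  qed
  have "(\<integral>\<^sup>+w. g (noise_shift m a p w) \<partial>TM) =
     (\<integral>\<^sup>+h. (\<integral>\<^sup>+v. g (noise_shift m a p (h, v)) \<partial>(lap1 \<Otimes>\<^sub>M lap2)) \<partial>thr_measure)"
    unfolding tape_measure_eq by (rule B.nn_integral_fst[symmetric]) (rule gs)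
  also have "\<dots> \<le> (\<integral>\<^sup>+h. ennreal (exp eps) * (\<integral>\<^sup>+v. g (h, v) \<partial>(lap1 \<Otimes>\<^sub>M lap2)) \<partial>thr_measure)"
  proof (intro nn_integral_mono)
    fix h assume h: "h \<in> space thr_measure"
    have gh[measurable]: "(\<lambda>v. g (h, v)) \<in> borel_measurable (lap1 \<Otimes>\<^sub>M lap2)" using h by measurable
    have gsh: "(\<lambda>v. g (noise_shift m a p (h, v))) \<in> borel_measurable (lap1 \<Otimes>\<^sub>M lap2)"
      by (rule measurable_compose[OF _ gs]) (use h in measurable)
    have "(\<integral>\<^sup>+v. g (noise_shift m a p (h, v)) \<partial>(lap1 \<Otimes>\<^sub>M lap2)) =
      (\<integral>\<^sup>+x. (\<integral>\<^sup>+y. g (noise_shift m a p (h, (x, y))) \<partial>lap2) \<partial>lap1)"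
      by (rule L2.nn_integral_fst[symmetric]) (rule gsh)
    also have "\<dots> = (\<integral>\<^sup>+x. (\<integral>\<^sup>+y. g (h, (\<lambda>q. x q + thr_shift m a p q), (\<lambda>q. y q + bin_shift hz m a p q)) \<partial>lap2) \<partial>lap1)"
      by (simp add: noise_shift_def)
    also have "\<dots> \<le> (\<integral>\<^sup>+x. ennreal (exp (eps / 2)) * (\<integral>\<^sup>+y. g (h, (\<lambda>q. x q + thr_shift m a p q), y) \<partial>lap2) \<partial>lap1)"
    proof (intro nn_integral_mono)
      fix x assume "x \<in> space lap1"
      hence x': "(\<lambda>q. x q + thr_shift m a p q) \<in> space lap1" by (simp add: space_PiM)
      have "(\<lambda>y. g (h, (\<lambda>q. x q + thr_shift m a p q), y)) \<in> borel_measurable lap2"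
        by (rule measurable_compose[OF _ gh]) (use x' in measurable)
      from nn_integral_PiM_laplace_shift[OF scales_pos(2) J this]
      have "(\<integral>\<^sup>+y. g (h, (\<lambda>q. x q + thr_shift m a p q), (\<lambda>q. y q + bin_shift hz m a p q)) \<partial>lap2) \<le>
        ennreal (exp ((\<Sum>q\<in>J. \<bar>bin_shift hz m a p q\<bar>) / (real ?L / (eps / 4)))) *
          (\<integral>\<^sup>+y. g (h, (\<lambda>q. x q + thr_shift m a p q), y) \<partial>lap2)" .
      also have "\<dots> \<le> ennreal (exp (eps / 2)) * (\<integral>\<^sup>+y. g (h, (\<lambda>q. x q + thr_shift m a p q), y) \<partial>lap2)"
        by (intro mult_right_mono ennreal_leI) (use c2 in auto)
      finally show "(\<integral>\<^sup>+y. g (h, (\<lambda>q. x q + thr_shift m a p q), (\<lambda>q. y q + bin_shift hz m a p q)) \<partial>lap2) \<le> \<dots>" .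
    qed
    also have "\<dots> = ennreal (exp (eps / 2)) * (\<integral>\<^sup>+x. (\<integral>\<^sup>+y. g (h, (\<lambda>q. x q + thr_shift m a p q), y) \<partial>lap2) \<partial>lap1)"
      by (rule nn_integral_cmult) measurable
    also have "(\<integral>\<^sup>+x. (\<integral>\<^sup>+y. g (h, (\<lambda>q. x q + thr_shift m a p q), y) \<partial>lap2) \<partial>lap1) \<le>
      ennreal (exp (eps / 2)) * (\<integral>\<^sup>+x. (\<integral>\<^sup>+y. g (h, x, y) \<partial>lap2) \<partial>lap1)"
    proof -
      have "(\<lambda>x. \<integral>\<^sup>+y. g (h, x, y) \<partial>lap2) \<in> borel_measurable lap1" by measurable
      from nn_integral_PiM_laplace_shift[OF scales_pos(1) _ _ this, of "{(m, a), (m, p)}" "thr_shift m a p"]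
      have "(\<integral>\<^sup>+x. (\<integral>\<^sup>+y. g (h, (\<lambda>q. x q + thr_shift m a p q), y) \<partial>lap2) \<partial>lap1) \<le>
        ennreal (exp ((\<Sum>q\<in>{(m, a), (m, p)}. \<bar>thr_shift m a p q\<bar>) / (4 / eps))) *
        (\<integral>\<^sup>+x. (\<integral>\<^sup>+y. g (h, x, y) \<partial>lap2) \<partial>lap1)"
        by (auto simp: thr_shift_def)
      also have "\<dots> \<le> ennreal (exp (eps / 2)) * (\<integral>\<^sup>+x. (\<integral>\<^sup>+y. g (h, x, y) \<partial>lap2) \<partial>lap1)"
        by (intro mult_right_mono ennreal_leI) (use c1 in auto)
      finally show ?thesis .
    qed
    also have "(\<integral>\<^sup>+x. (\<integral>\<^sup>+y. g (h, x, y) \<partial>lap2) \<partial>lap1) = (\<integral>\<^sup>+v. g (h, v) \<partial>(lap1 \<Otimes>\<^sub>M lap2))"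
      by (rule L2.nn_integral_fst) (rule gh)
    finally have "(\<integral>\<^sup>+v. g (noise_shift m a p (h, v)) \<partial>(lap1 \<Otimes>\<^sub>M lap2)) \<le>
       ennreal (exp (eps / 2)) * (ennreal (exp (eps / 2)) * (\<integral>\<^sup>+v. g (h, v) \<partial>(lap1 \<Otimes>\<^sub>M lap2)))"
      by (simp add: mult_left_mono)
    also have "\<dots> = ennreal (exp eps) * (\<integral>\<^sup>+v. g (h, v) \<partial>(lap1 \<Otimes>\<^sub>M lap2))"
      by (simp add: mult.assoc[symmetric] ennreal_mult'[symmetric] exp_add[symmetric])
    finally show "(\<integral>\<^sup>+v. g (noise_shift m a p (h, v)) \<partial>(lap1 \<Otimes>\<^sub>M lap2)) \<le> \<dots>" .
  qed
  also have "\<dots> = ennreal (exp eps) * (\<integral>\<^sup>+h. (\<integral>\<^sup>+v. g (h, v) \<partial>(lap1 \<Otimes>\<^sub>M lap2)) \<partial>thr_measure)"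
    by (rule nn_integral_cmult) measurable
  also have "(\<integral>\<^sup>+h. (\<integral>\<^sup>+v. g (h, v) \<partial>(lap1 \<Otimes>\<^sub>M lap2)) \<partial>thr_measure) = (\<integral>\<^sup>+w. g w \<partial>TM)"
    unfolding tape_measure_eq by (rule B.nn_integral_fst) (rule g')
  finally show ?thesis .
qed

end

subsection \<open>Posterior concentration of the thresholds\<close>

text \<open>Hoeffding's lemma for a Bernoulli variable. A negative \<open>lam\<close> is reduced to
  a positive one by exchanging success and failure.\<close>

lemma bernoulli_mgf_le:
  fixes a lam :: real
  assumes "0 \<le> a" "a \<le> 1"
  shows "1 + a * (exp lam - 1) \<le> exp (lam * a + lam\<^sup>2 / 8)"
proof -
  have pos: "1 + a * (exp \<mu> - 1) \<le> exp (\<mu> * a + \<mu>\<^sup>2 / 8)" if "0 \<le> a" "0 \<le> \<mu>" for a \<mu> :: real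
  proof -
    have "0 < 1 + a * (exp \<mu> - 1)" using that by (intro add_pos_nonneg mult_nonneg_nonneg) auto
    hence "1 + a * (exp \<mu> - 1) = exp (ln (1 + a * (exp \<mu> - 1)))" by simp
    also have "\<dots> \<le> exp (\<mu> * a + \<mu>\<^sup>2 / 8)"
      using Hoeffdings_lemma_aux[OF that(2,1)] by (subst exp_le_cancel_iff) linarith
    finally show ?thesis .
  qed
  show ?thesis
  proof (cases "0 \<le> lam")
    case False
    have "1 + a * (exp lam - 1) = exp lam * (1 + (1 - a) * (exp (- lam) - 1))"
      by (simp add: algebra_simps exp_minus)
    also have "\<dots> \<le> exp lam * exp (- lam * (1 - a) + (- lam)\<^sup>2 / 8)"
      by (intro mult_left_mono pos) (use assms False in auto)
    also have "\<dots> = exp (lam * a + lam\<^sup>2 / 8)"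
      by (simp add: exp_add[symmetric] algebra_simps)
    finally show ?thesis .
  qed (use pos assms in auto)
qed

text \<open>Here \<open>a\<close> and \<open>b\<close> are unnormalized weights of success and
  failure and \<open>p\<close> is the nominal success probability. Odds that are off by a factor of
  at most \<open>e\<close> move the probability by at most \<open>(e - 1) * (p * (1 - p))\<close>,
  hence by \<open>(e - 1) / 4\<close>. The amount \<open>kap\<close> pays for this bias and for
  Hoeffding's variance term.\<close>

lemma biased_mgf_le:
  fixes a b p e lam kap :: real
  assumes ab: "0 \<le> a" "0 \<le> b" "0 \<le> p" "p \<le> 1" "1 \<le> e"
    and le: "a * (1 - p) \<le> e * (b * p)" "b * p \<le> e * (a * (1 - p))"
    and kap: "\<bar>lam\<bar> * (e - 1) / 4 + lam\<^sup>2 / 8 \<le> kap"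
  shows "a * exp (lam * (1 - p) - kap) + b * exp (lam * (0 - p) - kap) \<le> a + b"
proof (cases "a + b = 0")
  case True
  hence "a = 0" "b = 0" using ab by linarith+
  thus ?thesis by simp
next
  case False
  define s where "s = a + b"
  have s: "0 < s" using False ab by (simp add: s_def)
  define x where "x = a / s"
  have x: "0 \<le> x" "x \<le> 1" "a = s * x" "b = s * (1 - x)"
    using ab s by (auto simp: x_def s_def field_simps)
  have "s * (x * (1 - p)) \<le> s * (e * ((1 - x) * p))" "s * ((1 - x) * p) \<le> s * (e * (x * (1 - p)))"
    using le unfolding x(3,4) by (simp_all add: mult_ac)
  hence le': "x * (1 - p) \<le> e * ((1 - x) * p)" "(1 - x) * p \<le> e * (x * (1 - p))"
    using s by auto
  have q: "p * (1 - p) \<le> 1 / 4"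
    using mult_const_minus_self_real_le[of p 1] by simp
  have bias: "\<bar>x - p\<bar> \<le> (e - 1) / 4"
  proof (cases "p \<le> x")
    case True
    have "(1 - x) * p \<le> (1 - p) * p" using True ab by (intro mult_right_mono) auto
    hence "(1 - x) * p \<le> 1 / 4" using q by (simp add: mult.commute)
    hence "(e - 1) * ((1 - x) * p) \<le> (e - 1) * (1 / 4)" using ab by (intro mult_left_mono) auto
    moreover have "x - p = x * (1 - p) - (1 - x) * p" by (simp add: algebra_simps)
    ultimately show ?thesis using le'(1) True by (simp add: algebra_simps)
  next
    case False
    have "x * (1 - p) \<le> p * (1 - p)" using False ab by (intro mult_right_mono) auto
    hence "x * (1 - p) \<le> 1 / 4" using q by linarith
    hence "(e - 1) * (x * (1 - p)) \<le> (e - 1) * (1 / 4)" using ab by (intro mult_left_mono) auto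
    moreover have "x - p = x * (1 - p) - (1 - x) * p" by (simp add: algebra_simps)
    ultimately show ?thesis using le'(2) False by (simp add: algebra_simps)
  qed
  have "lam * (x - p) \<le> \<bar>lam\<bar> * \<bar>x - p\<bar>" by (metis abs_ge_self abs_mult)
  also have "\<dots> \<le> \<bar>lam\<bar> * ((e - 1) / 4)" by (intro mult_left_mono bias) auto
  finally have "lam * (x - p) \<le> \<bar>lam\<bar> * (e - 1) / 4" by simp
  moreover have "lam * (x - p) = lam * x - lam * p" by (simp add: algebra_simps)
  ultimately have *: "lam * x + lam\<^sup>2 / 8 - lam * p \<le> kap" using kap by linarith
  have "a * exp (lam * (1 - p) - kap) + b * exp (lam * (0 - p) - kap) =
     s * ((1 + x * (exp lam - 1)) * exp (- lam * p - kap))"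
    unfolding x(3,4) by (simp add: algebra_simps exp_diff exp_add exp_minus divide_simps)
  also have "\<dots> \<le> s * (exp (lam * x + lam\<^sup>2 / 8) * exp (- lam * p - kap))"
    using s by (intro mult_left_mono mult_right_mono bernoulli_mgf_le x) auto
  also have "\<dots> = s * exp (lam * x + lam\<^sup>2 / 8 - lam * p - kap)"
    by (simp add: exp_add[symmetric] algebra_simps)
  also have "\<dots> \<le> s * 1" using s * by (intro mult_left_mono) auto
  finally show ?thesis by (simp add: s_def)
qed

lemma sum_mult_comparable:
  fixes P :: "nat \<Rightarrow> real"
  assumes "\<And>x y. x \<in> A \<Longrightarrow> y \<in> B \<Longrightarrow> P x \<le> e * P y" "finite A" "finite B"
  shows "sum P A * real (card B) \<le> e * (sum P B * real (card A))"
proof -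
  have "sum P A * real (card B) = (\<Sum>x\<in>A. \<Sum>y\<in>B. P x)"
    by (simp add: sum_distrib_right mult.commute)
  also have "\<dots> \<le> (\<Sum>x\<in>A. \<Sum>y\<in>B. e * P y)" by (intro sum_mono assms)
  also have "\<dots> = e * (sum P B * real (card A))" by (simp add: sum_distrib_left sum_distrib_right mult_ac)
  finally show ?thesis .
qed

text \<open>If the weights of any two threshold values differ by a factor of at most
  \<open>e\<close>, then the event \<open>x \<le> v\<close> has odds within a factor
  \<open>e\<close> of \<open>v\<close> to \<open>d - v\<close>, as \<open>biased_mgf_le\<close>
  requires. If some weight is infinite, so is the right-hand side.\<close>

lemma tilted_average_le:
  fixes P :: "nat \<Rightarrow> ennreal"
  assumes P: "\<And>x y. x \<in> {1..d} \<Longrightarrow> y \<in> {1..d} \<Longrightarrow> P x \<le> ennreal e * P y"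
    and v: "0 < v" "v < d" and e: "1 \<le> e" and kap: "\<bar>lam\<bar> * (e - 1) / 4 + lam\<^sup>2 / 8 \<le> kap"
  shows "(\<Sum>x\<in>{1..d}. P x * ennreal (exp (lam * (of_bool (x \<le> v) - real v / real d) - kap))) \<le>
     (\<Sum>x\<in>{1..d}. P x)"
proof (cases "\<exists>x\<in>{1..d}. P x = \<infinity>")
  case True
  hence top: "(\<Sum>x\<in>{1..d}. P x) = top" by (auto simp: infinity_ennreal_def)
  show ?thesis unfolding top by (rule top_greatest)
next
  case False
  define R where "R x = enn2real (P x)" for x
  have R: "P x = ennreal (R x)" if "x \<in> {1..d}" for x
    using False that by (auto simp: R_def less_top)
  have R0: "0 \<le> R x" for x by (simp add: R_def)
  have RR: "R x \<le> e * R y" if "x \<in> {1..d}" "y \<in> {1..d}" for x y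
    using P[OF that] e R0 unfolding R[OF that(1)] R[OF that(2)]
    by (subst (asm) ennreal_mult[symmetric]) (auto simp: ennreal_le_iff)
  define a where "a = (\<Sum>x\<in>{1..v}. R x)"
  define b where "b = (\<Sum>x\<in>{v<..d}. R x)"
  define p where "p = real v / real d"
  have p: "0 \<le> p" "p \<le> 1" "1 - p = real (d - v) / real d"
    using v by (auto simp: p_def field_simps of_nat_diff)
  have split: "(\<Sum>x\<in>{1..d}. f x) = (\<Sum>x\<in>{1..v}. f x) + (\<Sum>x\<in>{v<..d}. f x)" for f :: "nat \<Rightarrow> real"
  proof -
    have "{1..d} = {1..v} \<union> {v<..d}" using v by auto
    thus ?thesis by (simp only:) (rule sum.union_disjoint, auto)
  qed
  have A: "a * real (d - v) \<le> e * (b * real v)" "b * real v \<le> e * (a * real (d - v))"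
    using sum_mult_comparable[of "{1..v}" "{v<..d}" R e] sum_mult_comparable[of "{v<..d}" "{1..v}" R e]
      RR v by (auto simp: a_def b_def)
  have d0: "0 < real d" using v by simp
  have le: "a * (1 - p) \<le> e * (b * p)" "b * p \<le> e * (a * (1 - p))"
    using divide_right_mono[OF A(1), of "real d"] divide_right_mono[OF A(2), of "real d"] d0
    unfolding p(3) by (simp_all add: p_def)
  have "(\<Sum>x\<in>{1..d}. P x * ennreal (exp (lam * (of_bool (x \<le> v) - p) - kap))) =
     ennreal (\<Sum>x\<in>{1..d}. R x * exp (lam * (of_bool (x \<le> v) - p) - kap))"
    by (subst sum_ennreal[symmetric]) (auto simp: R R0 ennreal_mult' intro!: sum.cong)
  also have "(\<Sum>x\<in>{1..d}. R x * exp (lam * (of_bool (x \<le> v) - p) - kap)) =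
      a * exp (lam * (1 - p) - kap) + b * exp (lam * (0 - p) - kap)"
    unfolding split a_def b_def sum_distrib_right by (intro arg_cong2[where f = "(+)"] sum.cong) auto
  also have "\<dots> \<le> a + b"
    by (rule biased_mgf_le[OF _ _ p(1,2) e le kap]) (auto simp: a_def b_def R0 intro: sum_nonneg)
  also have "a + b = (\<Sum>x\<in>{1..d}. R x)" by (simp only: split a_def b_def)
  also have "ennreal \<dots> = (\<Sum>x\<in>{1..d}. P x)"
    by (subst sum_ennreal[symmetric]) (auto simp: R R0)
  finally show ?thesis by (simp add: p_def ennreal_leI)
qed

context tracking_meas
begin

text \<open>\<open>F\<close> is a function of the view up to time \<open>t\<close> and of the
  thresholds in \<open>Cs\<close> only. With \<open>Cs = {}\<close> it is a function of the view
  alone.\<close>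

definition view_inv :: "nat \<Rightarrow> (nat \<times> nat \<times> nat \<times> nat) set \<Rightarrow> (tape \<Rightarrow> 'b) \<Rightarrow> bool" where
  "view_inv t Cs F \<longleftrightarrow> (\<forall>w w'. same_view t w w' \<longrightarrow> (\<forall>c\<in>Cs. fst w c = fst w' c) \<longrightarrow> F w = F w')"

lemma same_viewD:
  assumes "same_view t w w'" "u \<le> t"
  shows "rnd (conf w u) = rnd (conf w' u)" "start_count (conf w u) = start_count (conf w' u)"
    "local_count (conf w u) = local_count (conf w' u)" "phase (conf w u) = phase (conf w' u)"
    "answer (conf w u) = answer (conf w' u)" "blen (conf w u) = blen (conf w' u)"
    "act w u = act w' u"
proof -
  have "vis (conf w u) = vis (conf w' u)" "hist w u = hist w' u"
    using assms unfolding same_view_def by blast+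
  thus "rnd (conf w u) = rnd (conf w' u)" "start_count (conf w u) = start_count (conf w' u)"
    "local_count (conf w u) = local_count (conf w' u)" "phase (conf w u) = phase (conf w' u)"
    "answer (conf w u) = answer (conf w' u)" "blen (conf w u) = blen (conf w' u)"
    "act w u = act w' u"
    by (simp_all add: vis_eq_iff blen_def act_def)
qed

lemma cross_phase_view:
  assumes "same_view t w w'" "1 \<le> n"
  shows "cross_phase t m i n w = cross_phase t m i n w'"
proof -
  have *: "cross w m i n u \<longleftrightarrow> cross w' m i n u" if "u < t" for u
    using same_viewD[OF assms(1), of u] same_viewD[OF assms(1), of "Suc u"] that by (simp add: cross_def)
  show ?thesis
  proof (cases "\<exists>u<t. cross w m i n u")
    case True
    then obtain u where u: "u < t" "cross w m i n u" by blast
    have "cross_phase t m i n w = phase (conf w u)" "cross_phase t m i n w' = phase (conf w' u)"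
      using cross_phase_eq u * assms(2) by auto
    thus ?thesis using same_viewD(4)[OF assms(1), of u] u by simp
  next
    case False
    thus ?thesis using * unfolding cross_phase_def by auto
  qed
qed

lemma leaked_view:
  assumes "same_view t w w'"
  shows "leaked t m i b w = leaked t m i b w'"
proof -
  have "rnd (conf w u) = rnd (conf w' u) \<and> rnd (conf w (Suc u)) = rnd (conf w' (Suc u)) \<and>
     phase (conf w u) = phase (conf w' u) \<and> phase (conf w (Suc u)) = phase (conf w' (Suc u)) \<and>
     act w u = act w' u \<and> local_count (conf w u) = local_count (conf w' u) \<and>
     blen (conf w u) = blen (conf w' u)" if "u < t" for u
    using same_viewD[OF assms, of u] same_viewD[OF assms, of "Suc u"] that by simp
  thus ?thesis unfolding leaked_def by (intro ex_cong1 conj_cong refl) simp_all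
qed

text \<open>Eliminates \<open>LEAST\<close>, so that measurability follows from countable
  quantifiers.\<close>

lemma cross_phase_iff:
  assumes "1 \<le> n"
  shows "cross_phase t m i n w = a \<longleftrightarrow> (\<exists>u<t. cross w m i n u \<and> phase (conf w u) = a) \<or>
    (a = 0 \<and> \<not> (\<exists>u<t. cross w m i n u))"
proof (cases "\<exists>u<t. cross w m i n u")
  case True
  then obtain u where u: "u < t" "cross w m i n u" by blast
  have ph: "cross_phase t m i n w = phase (conf w u)" by (rule cross_phase_eq[OF u(2,1) assms])
  have un: "v = u" if "cross w m i n v" for v by (rule cross_unique[OF that u(2) assms])
  show ?thesis
  proof
    assume "cross_phase t m i n w = a"
    thus "(\<exists>u<t. cross w m i n u \<and> phase (conf w u) = a) \<or> (a = 0 \<and> \<not> (\<exists>u<t. cross w m i n u))"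
      using u ph by (intro disjI1 exI[of _ u]) simp
  next
    assume "(\<exists>u<t. cross w m i n u \<and> phase (conf w u) = a) \<or> (a = 0 \<and> \<not> (\<exists>u<t. cross w m i n u))"
    then obtain v where "cross w m i n v" "phase (conf w v) = a" using True by (elim disjE exE conjE) (blast+)
    thus "cross_phase t m i n w = a" using un[of v] ph by simp
  qed
next
  case False
  hence "cross_phase t m i n w = 0" unfolding cross_phase_def by (rule if_not_P)
  thus ?thesis using False by (simp only:) blast
qed

lemma cross_meas [measurable]: "Measurable.pred TM (\<lambda>w. cross w m i n u)"
  unfolding cross_def by measurable

lemma cross_phase_meas:
  assumes "1 \<le> n"
  shows "Measurable.pred TM (\<lambda>w. cross_phase t m i n w = a)"
  unfolding cross_phase_iff[OF assms] by measurable

lemma leaked_meas [measurable]: "Measurable.pred TM (\<lambda>w. leaked t m i b w)"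
proof -
  have 1: "Measurable.pred TM (\<lambda>w. rnd (conf w u) = m)" for u by measurable
  have 2: "Measurable.pred TM (\<lambda>w. phase (conf w (Suc u)) \<noteq> phase (conf w u))" for u
  proof -
    have "phase (conf w (Suc u)) \<noteq> phase (conf w u) \<longleftrightarrow>
      (\<exists>c. phase (conf w u) = c \<and> phase (conf w (Suc u)) \<noteq> c)" for w by blast
    moreover have "Measurable.pred TM (\<lambda>w. \<exists>c. phase (conf w u) = c \<and> phase (conf w (Suc u)) \<noteq> c)"
      by measurable
    ultimately show ?thesis by simp
  qed
  have 3: "Measurable.pred TM (\<lambda>w. act w u = Some i)" for u
    by (rule measurable_compose[OF act_meas[of u]]) simp
  have 4: "Measurable.pred TM (\<lambda>w. local_count (conf w u) i div blen (conf w u) + 1 = b)" for u by measurable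
  show ?thesis
    unfolding leaked_def
    by (intro pred_intros_countable_bounded pred_intros_logic pred_intros_countable 1 2 3 4) simp_all
qed

text \<open>Differential privacy of a single threshold. The shift provided by
  \<open>coupling\<close> depends on the run through the two phases, so \<open>G\<close> is cut into
  the pieces \<open>K a p\<close>, on each of which the shift is a constant translation of the
  noise.\<close>

lemma dp_threshold:
  assumes G[measurable]: "G \<in> borel_measurable TM" and inv: "view_inv t (- {(m, i, b, d)}) G"
    and supp: "\<And>w. G w \<noteq> 0 \<Longrightarrow> rnd (conf w t) = m \<and> blen (conf w t) = d \<and> \<not> leaked t m i b w"
    and x: "x \<in> {1..d}" and y: "y \<in> {1..d}" and b: "1 \<le> b"
  shows "(\<integral>\<^sup>+w. G (set_thr (m, i, b, d) x w) \<partial>TM) \<le>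
    ennreal (exp eps) * (\<integral>\<^sup>+w. G (set_thr (m, i, b, d) y w) \<partial>TM)"
proof -
  let ?c = "(m, i, b, d)"
  define nx where "nx = (b - 1) * d + x"
  define ny where "ny = (b - 1) * d + y"
  have n1: "1 \<le> nx" "1 \<le> ny" using x y by (auto simp: nx_def ny_def)
  define K where "K a p w =
     (if cross_phase t m i nx w = a \<and> cross_phase t m i ny w = p then G w else 0)" for a p w
  note [measurable] = cross_phase_meas[OF n1(1)] cross_phase_meas[OF n1(2)]
  have Km: "(\<lambda>w. K a p w) \<in> borel_measurable TM" for a p
    unfolding K_def by measurable
  have Kx[measurable]: "(\<lambda>w. K a p (set_thr ?c x w)) \<in> borel_measurable TM" for a p x
    by (rule measurable_compose[OF set_thr_measurable Km])
  have sumK: "G w = (\<Sum>a\<le>hz. \<Sum>p\<le>hz. K a p w)" for w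
  proof -
    have "(\<Sum>a\<le>hz. \<Sum>p\<le>hz. K a p w) = (\<Sum>a\<le>hz. \<Sum>p\<le>hz.
        if p = cross_phase t m i ny w then if a = cross_phase t m i nx w then G w else 0 else 0)"
      by (intro sum.cong) (auto simp: K_def)
    also have "\<dots> = (\<Sum>a\<le>hz. if a = cross_phase t m i nx w then G w else 0)"
      using cross_phase_le by (intro sum.cong) auto
    also have "\<dots> = G w" using cross_phase_le by simp
    finally show ?thesis by simp
  qed
  \<comment> \<open>The tape with value \<open>x\<close> is matched with the shifted tape with value
    \<open>y\<close>. Both have the same view, which determines the crossing phases, so the matched
    tape lies in the same piece; only the density factor of the shift is lost.\<close>
  have KK: "K a p (set_thr ?c x w) \<le> K a p (set_thr ?c y (noise_shift m a p w))" for a p w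
  proof (cases "K a p (set_thr ?c x w) = 0")
    case False
    let ?w = "set_thr ?c x w"
    have ap: "a = cross_phase t m i nx ?w" "p = cross_phase t m i ny ?w" and G0: "G ?w \<noteq> 0"
      using False by (auto simp: K_def split: if_splits)
    have "same_view t ?w (noise_shift m a p (set_thr ?c y ?w))"
      unfolding ap nx_def ny_def
      by (rule coupling) (use supp[OF G0] x y b in \<open>auto simp: set_thr_def\<close>)
    also have "noise_shift m a p (set_thr ?c y ?w) = set_thr ?c y (noise_shift m a p w)"
      by (simp add: noise_shift_def set_thr_def)
    finally have sv: "same_view t ?w (set_thr ?c y (noise_shift m a p w))" .
    moreover have "\<forall>c\<in>- {?c}. fst ?w c = fst (set_thr ?c y (noise_shift m a p w)) c"
      by (simp add: noise_shift_def set_thr_def)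
    ultimately have "G ?w = G (set_thr ?c y (noise_shift m a p w))"
      using inv unfolding view_inv_def by blast
    thus ?thesis
      using cross_phase_view[OF sv n1(1), of m i] cross_phase_view[OF sv n1(2), of m i]
      by (simp add: K_def)
  qed simp
  have "(\<integral>\<^sup>+w. G (set_thr ?c x w) \<partial>TM) = (\<Sum>a\<le>hz. \<Sum>p\<le>hz. \<integral>\<^sup>+w. K a p (set_thr ?c x w) \<partial>TM)"
    by (subst sumK) (simp add: nn_integral_sum)
  also have "\<dots> \<le> (\<Sum>a\<le>hz. \<Sum>p\<le>hz. ennreal (exp eps) * (\<integral>\<^sup>+w. K a p (set_thr ?c y w) \<partial>TM))"
  proof (intro sum_mono)
    fix a p
    have "(\<integral>\<^sup>+w. K a p (set_thr ?c x w) \<partial>TM) \<le> (\<integral>\<^sup>+w. K a p (set_thr ?c y (noise_shift m a p w)) \<partial>TM)"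
      by (intro nn_integral_mono KK)
    also have "\<dots> \<le> ennreal (exp eps) * (\<integral>\<^sup>+w. K a p (set_thr ?c y w) \<partial>TM)"
      by (rule shift_noise) measurable
    finally show "(\<integral>\<^sup>+w. K a p (set_thr ?c x w) \<partial>TM) \<le> \<dots>" .
  qed
  also have "\<dots> = ennreal (exp eps) * (\<integral>\<^sup>+w. G (set_thr ?c y w) \<partial>TM)"
    by (subst sumK) (simp add: nn_integral_sum sum_distrib_left)
  finally show ?thesis .
qed

text \<open>Truncated subtraction yields 0 for blocks that have not begun, and the minimum yields
  \<open>d\<close> for complete ones.\<close>

definition offset :: "nat \<Rightarrow> nat \<Rightarrow> nat \<times> nat \<Rightarrow> tape \<Rightarrow> nat" where
  "offset t d ib w = min d (local_count (conf w t) (fst ib) - (snd ib - 1) * d)"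

text \<open>The blocks whose bit is still uncertain and which \<open>coupling\<close> can
  handle.\<close>

definition hot :: "nat \<Rightarrow> nat \<Rightarrow> nat \<Rightarrow> nat \<times> nat \<Rightarrow> tape \<Rightarrow> bool" where
  "hot t m d ib w \<longleftrightarrow> 0 < offset t d ib w \<and> offset t d ib w < d \<and> \<not> leaked t m (fst ib) (snd ib) w"

text \<open>The bit of the block minus the probability it would have if the threshold were still
  uniform given the offset.\<close>

definition dev :: "nat \<Rightarrow> nat \<Rightarrow> nat \<Rightarrow> nat \<times> nat \<Rightarrow> tape \<Rightarrow> real" where
  "dev t m d ib w = of_bool (fst w (m, fst ib, snd ib, d) \<le> offset t d ib w) - real (offset t d ib w) / real d"

definition fac :: "real \<Rightarrow> real \<Rightarrow> nat \<Rightarrow> nat \<Rightarrow> nat \<Rightarrow> nat \<times> nat \<Rightarrow> tape \<Rightarrow> ennreal" where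
  "fac lam kap t m d ib w = (if hot t m d ib w then ennreal (exp (lam * dev t m d ib w - kap)) else 1)"

lemma offset_meas [measurable]: "(\<lambda>w. offset t d ib w) \<in> TM \<rightarrow>\<^sub>M count_space UNIV"
  unfolding offset_def by measurable

lemma hot_meas [measurable]: "Measurable.pred TM (\<lambda>w. hot t m d ib w)"
  unfolding hot_def by measurable

lemma dev_meas [measurable]: "(\<lambda>w. dev t m d ib w) \<in> borel_measurable TM"
proof -
  have o[measurable]: "(\<lambda>w. real (offset t d ib w)) \<in> borel_measurable TM"
    by (rule measurable_compose[OF offset_meas]) simp
  have f[measurable]: "(\<lambda>w. real (fst w (m, fst ib, snd ib, d))) \<in> borel_measurable TM"
    by (rule measurable_compose[OF tape_measurable(1)[OF measurable_ident_sets[OF refl]]]) simp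
  have "dev t m d ib = (\<lambda>w. (if real (fst w (m, fst ib, snd ib, d)) \<le> real (offset t d ib w) then 1 else 0) -
      real (offset t d ib w) / real d)"
    by (simp add: dev_def fun_eq_iff)
  moreover have "\<dots> \<in> borel_measurable TM" by measurable
  ultimately show ?thesis by simp
qed

lemma fac_meas [measurable]: "(\<lambda>w. fac lam kap t m d ib w) \<in> borel_measurable TM"
  unfolding fac_def by measurable

lemma offset_view: "same_view t w w' \<Longrightarrow> offset t d ib w = offset t d ib w'"
  using same_viewD(3)[of t w w' t] by (simp add: offset_def)

lemma hot_view: "same_view t w w' \<Longrightarrow> hot t m d ib w = hot t m d ib w'"
  using offset_view[of t w w' d ib] leaked_view[of t w w' m "fst ib" "snd ib"] by (simp add: hot_def)

lemma fac_view:
  assumes "same_view t w w'" "fst w (m, fst ib, snd ib, d) = fst w' (m, fst ib, snd ib, d)"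
  shows "fac lam kap t m d ib w = fac lam kap t m d ib w'"
  using hot_view[OF assms(1), of m d ib] offset_view[OF assms(1), of d ib] assms(2)
  by (simp add: fac_def dev_def)

text \<open>The offset belongs to the view. Once its value \<open>v\<close> is fixed, the factor is
  an explicit function of the resampled threshold alone, and the weights of the threshold values are
  comparable by \<open>dp_threshold\<close>. The part \<open>H\<close>, on which the factor is 1, is
  left alone.\<close>

lemma fac_integral_le:
  assumes F[measurable]: "F \<in> borel_measurable TM" and inv: "view_inv t (- {(m, i, b, d)}) F"
    and supp: "\<And>w. F w \<noteq> 0 \<Longrightarrow> rnd (conf w t) = m \<and> blen (conf w t) = d"
    and b: "1 \<le> b" and d: "1 \<le> d" and kap: "\<bar>lam\<bar> * (exp eps - 1) / 4 + lam\<^sup>2 / 8 \<le> kap"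
  shows "(\<integral>\<^sup>+w. F w * fac lam kap t m d (i, b) w \<partial>TM) \<le> (\<integral>\<^sup>+w. F w \<partial>TM)"
proof -
  let ?c = "(m, i, b, d)" and ?ib = "(i, b)"
  define G where "G v w = (if hot t m d ?ib w \<and> offset t d ?ib w = v then F w else 0)" for v w
  define H where "H w = (if hot t m d ?ib w then 0 else F w)" for w
  have Gm[measurable]: "(\<lambda>w. G v w) \<in> borel_measurable TM" for v
    unfolding G_def by measurable
  have Hm[measurable]: "(\<lambda>w. H w) \<in> borel_measurable TM"
    unfolding H_def by measurable
  define g where "g v w = ennreal (exp (lam * (of_bool (fst w ?c \<le> v) - real v / real d) - kap))" for v and w :: tape
  have gm[measurable]: "(\<lambda>w. g v w) \<in> borel_measurable TM" for v
    unfolding g_def of_bool_def by measurable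
  have hot_less: "offset t d ?ib w < d" if "hot t m d ?ib w" for w
    using that by (simp add: hot_def)
  have decomp: "F w = H w + (\<Sum>v<d. G v w)" for w
  proof (cases "hot t m d ?ib w")
    case True
    have "(\<Sum>v<d. G v w) = (\<Sum>v<d. if v = offset t d ?ib w then F w else 0)"
      using True by (intro sum.cong) (auto simp: G_def)
    thus ?thesis using hot_less[OF True] True by (simp add: H_def)
  next
    case False
    thus ?thesis by (simp add: G_def H_def)
  qed
  have ptw: "F w * fac lam kap t m d ?ib w = H w + (\<Sum>v<d. G v w * g v w)" for w
  proof (cases "hot t m d ?ib w")
    case True
    have "(\<Sum>v<d. G v w * g v w) = (\<Sum>v<d. if v = offset t d ?ib w then F w * g v w else 0)"
      using True by (intro sum.cong) (auto simp: G_def)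
    thus ?thesis using hot_less[OF True] True by (simp add: H_def fac_def dev_def g_def)
  next
    case False
    thus ?thesis by (simp add: G_def H_def fac_def)
  qed
  have Gg: "(\<integral>\<^sup>+w. G v w * g v w \<partial>TM) \<le> (\<integral>\<^sup>+w. G v w \<partial>TM)" if v: "v < d" for v
  proof (cases "v = 0")
    case True
    have "G v w = 0" for w using True by (auto simp: G_def hot_def)
    thus ?thesis by simp
  next
    case False
    have Ginv: "view_inv t (- {?c}) (G v)"
    proof (unfold view_inv_def, intro allI impI)
      fix w w' assume sv: "same_view t w w'" and c: "\<forall>c\<in>- {?c}. fst w c = fst w' c"
      have "F w = F w'" using inv sv c unfolding view_inv_def by blast
      thus "G v w = G v w'"
        using hot_view[OF sv, of m d ?ib] offset_view[OF sv, of d ?ib] by (simp add: G_def)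
    qed
    have Gsupp: "rnd (conf w t) = m \<and> blen (conf w t) = d \<and> \<not> leaked t m i b w" if "G v w \<noteq> 0" for w
      using that supp[of w] by (auto simp: G_def hot_def split: if_splits)
    let ?P = "\<lambda>x. \<integral>\<^sup>+w. G v (set_thr ?c x w) \<partial>TM"
    have P: "?P x \<le> ennreal (exp eps) * ?P y" if "x \<in> {1..d}" "y \<in> {1..d}" for x y
      by (rule dp_threshold[OF Gm Ginv Gsupp that b])
    have "(\<integral>\<^sup>+w. G v w * g v w \<partial>TM) =
       (\<Sum>x\<in>{1..d}. \<integral>\<^sup>+w. G v (set_thr ?c x w) * g v (set_thr ?c x w) \<partial>TM) / ennreal (real d)"
      by (rule resample_thr) (use d in measurable)
    also have "(\<Sum>x\<in>{1..d}. \<integral>\<^sup>+w. G v (set_thr ?c x w) * g v (set_thr ?c x w) \<partial>TM) =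
       (\<Sum>x\<in>{1..d}. ?P x * ennreal (exp (lam * (of_bool (x \<le> v) - real v / real d) - kap)))"
    proof (rule sum.cong[OF refl])
      fix x
      have "g v (set_thr ?c x w) = ennreal (exp (lam * (of_bool (x \<le> v) - real v / real d) - kap))" for w
        by (simp add: g_def set_thr_def)
      thus "(\<integral>\<^sup>+w. G v (set_thr ?c x w) * g v (set_thr ?c x w) \<partial>TM) =
         ?P x * ennreal (exp (lam * (of_bool (x \<le> v) - real v / real d) - kap))"
        by (simp add: nn_integral_multc)
    qed
    also have "\<dots> \<le> (\<Sum>x\<in>{1..d}. ?P x)"
      by (rule tilted_average_le[OF P _ v _ kap]) (use False eps_pos in auto)
    also have "(\<Sum>x\<in>{1..d}. ?P x) / ennreal (real d) = (\<integral>\<^sup>+w. G v w \<partial>TM)"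
      by (rule resample_thr[symmetric]) (use d in measurable)
    finally show ?thesis by (simp add: divide_right_mono_ennreal)
  qed
  have "(\<integral>\<^sup>+w. F w * fac lam kap t m d ?ib w \<partial>TM) = (\<integral>\<^sup>+w. H w \<partial>TM) + (\<Sum>v<d. \<integral>\<^sup>+w. G v w * g v w \<partial>TM)"
    unfolding ptw by (subst nn_integral_add) (auto simp: nn_integral_sum)
  also have "\<dots> \<le> (\<integral>\<^sup>+w. H w \<partial>TM) + (\<Sum>v<d. \<integral>\<^sup>+w. G v w \<partial>TM)"
    by (intro add_left_mono sum_mono Gg) auto
  also have "\<dots> = (\<integral>\<^sup>+w. H w + (\<Sum>v<d. G v w) \<partial>TM)"
    by (subst nn_integral_add) (auto simp: nn_integral_sum)
  also have "\<dots> = (\<integral>\<^sup>+w. F w \<partial>TM)"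
    by (simp only: decomp)
  finally show ?thesis .
qed

text \<open>The factors are removed one by one. Those that remain read other thresholds and the
  view, so together with \<open>Z\<close> they form an admissible \<open>F\<close> for
  \<open>fac_integral_le\<close>.\<close>

lemma prod_fac_integral_le:
  assumes Z[measurable]: "Z \<in> borel_measurable TM" and inv: "view_inv t {} Z"
    and supp: "\<And>w. Z w \<noteq> 0 \<Longrightarrow> rnd (conf w t) = m \<and> blen (conf w t) = d"
    and d: "1 \<le> d" and kap: "\<bar>lam\<bar> * (exp eps - 1) / 4 + lam\<^sup>2 / 8 \<le> kap"
    and "finite B" "\<And>ib. ib \<in> B \<Longrightarrow> 1 \<le> snd ib"
  shows "(\<integral>\<^sup>+w. Z w * (\<Prod>ib\<in>B. fac lam kap t m d ib w) \<partial>TM) \<le> (\<integral>\<^sup>+w. Z w \<partial>TM)"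
  using assms(6,7)
proof (induction B)
  case empty
  show ?case by simp
next
  case (insert ib B)
  obtain i b where ib: "ib = (i, b)" by (cases ib) auto
  let ?F = "\<lambda>w. Z w * (\<Prod>ib\<in>B. fac lam kap t m d ib w)"
  have "view_inv t (- {(m, i, b, d)}) ?F"
  proof (unfold view_inv_def, intro allI impI)
    fix w w' assume sv: "same_view t w w'" and c: "\<forall>c\<in>- {(m, i, b, d)}. fst w c = fst w' c"
    have "fac lam kap t m d jb w = fac lam kap t m d jb w'" if "jb \<in> B" for jb
    proof (rule fac_view[OF sv])
      have "jb \<noteq> (i, b)" using that insert.hyps ib by auto
      hence "(m, fst jb, snd jb, d) \<noteq> (m, i, b, d)" by (cases jb) auto
      thus "fst w (m, fst jb, snd jb, d) = fst w' (m, fst jb, snd jb, d)" using c by auto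
    qed
    moreover have "Z w = Z w'" using inv sv unfolding view_inv_def by blast
    ultimately show "?F w = ?F w'" by simp
  qed
  note fi = fac_integral_le[OF _ this _ _ d kap]
  have "(\<integral>\<^sup>+w. Z w * (\<Prod>ib\<in>insert ib B. fac lam kap t m d ib w) \<partial>TM) =
     (\<integral>\<^sup>+w. ?F w * fac lam kap t m d (i, b) w \<partial>TM)"
    using insert.hyps by (intro nn_integral_cong) (simp add: ib mult_ac)
  also have "\<dots> \<le> (\<integral>\<^sup>+w. ?F w \<partial>TM)"
  proof (rule fi)
    show "?F \<in> borel_measurable TM" by measurable
    show "rnd (conf w t) = m \<and> blen (conf w t) = d" if "?F w \<noteq> 0" for w
      using that by (intro supp) auto
    show "1 \<le> b" using insert.prems[of ib] ib by simp
  qed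
  also have "\<dots> \<le> (\<integral>\<^sup>+w. Z w \<partial>TM)" using insert by simp
  finally show ?case .
qed

end

lemma space_PiM_laplace [simp]: "space (PiM UNIV (\<lambda>_. laplace b)) = UNIV"
  by (simp add: space_PiM PiE_UNIV_domain)

lemma space_thr_measure: "space thr_measure = UNIV"
proof -
  have "space (case c of (m, i, j, d) \<Rightarrow> measure_pmf (pmf_of_set {1..d})) = UNIV"
    for c :: "nat \<times> nat \<times> nat \<times> nat" by (cases c) simp
  thus ?thesis unfolding space_PiM by (simp add: PiE_UNIV_domain)
qed

subsection \<open>Bits versus items\<close>

text \<open>Block \<open>b\<close> sends its bit at item number \<open>(b - 1) * d + r b\<close>,
  and this item is among the first \<open>n\<close> exactly when the threshold does not exceed the
  offset.\<close>

lemma card_hits: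
  fixes r :: "nat \<Rightarrow> nat"
  assumes d: "1 \<le> d" and r: "\<And>b. b \<in> {1..nb} \<Longrightarrow> r b \<in> {1..d}" and n: "n \<le> nb * d"
  shows "card {v \<in> {1..n}. (v - 1) mod d + 1 = r ((v - 1) div d + 1)} =
    card {b \<in> {1..nb}. r b \<le> min d (n - (b - 1) * d)}"
proof -
  let ?A = "{b \<in> {1..nb}. r b \<le> min d (n - (b - 1) * d)}"
  let ?B = "{v \<in> {1..n}. (v - 1) mod d + 1 = r ((v - 1) div d + 1)}"
  let ?f = "\<lambda>b. (b - 1) * d + r b"
  have fd: "(?f b - 1) div d + 1 = b \<and> (?f b - 1) mod d = r b - 1" if "b \<in> {1..nb}" for b
  proof -
    have eq: "?f b - 1 = (r b - 1) + (b - 1) * d" and lt: "r b - 1 < d" using r[OF that] by auto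
    have "(?f b - 1) div d = b - 1" unfolding eq using lt by simp
    moreover have "(?f b - 1) mod d = r b - 1" unfolding eq using lt by simp
    ultimately show ?thesis using that by simp
  qed
  have "bij_betw ?f ?A ?B"
  proof (rule bij_betwI[where g = "\<lambda>v. (v - 1) div d + 1"])
    show "?f \<in> ?A \<rightarrow> ?B"
    proof
      fix b assume b: "b \<in> ?A"
      hence b': "b \<in> {1..nb}" by simp
      have "1 \<le> r b" "r b \<le> n - (b - 1) * d" using r[OF b'] b by auto
      hence "?f b \<in> {1..n}" by auto
      thus "?f b \<in> ?B" using fd[OF b'] \<open>1 \<le> r b\<close> by auto
    qed
    show "(\<lambda>v. (v - 1) div d + 1) \<in> ?B \<rightarrow> ?A"
    proof
      fix v assume v: "v \<in> ?B"
      let ?b = "(v - 1) div d + 1"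
      have "v - 1 < nb * d" using v n by auto
      hence "(v - 1) div d < nb" using d by (simp add: div_less_iff_less_mult)
      hence b: "?b \<in> {1..nb}" by auto
      have rv: "r ?b = (v - 1) mod d + 1" and v1: "1 \<le> v" using v by auto
      moreover have "v - 1 = (v - 1) div d * d + (v - 1) mod d" by simp
      hence "v = (v - 1) div d * d + ((v - 1) mod d + 1)" using v1 by linarith
      hence "v = (?b - 1) * d + r ?b" unfolding rv by simp
      hence "r ?b \<le> n - (?b - 1) * d" using v by auto
      ultimately show "?b \<in> ?A" using b r[OF b] by auto
    qed
    show "(?f b - 1) div d + 1 = b" if "b \<in> ?A" for b using fd that by simp
    show "?f ((v - 1) div d + 1) = v" if "v \<in> ?B" for v
    proof -
      have rv: "r ((v - 1) div d + 1) = (v - 1) mod d + 1" and v1: "1 \<le> v" using that by auto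
      have "v - 1 = (v - 1) div d * d + (v - 1) mod d" by simp
      hence "v = (v - 1) div d * d + ((v - 1) mod d + 1)" using v1 by linarith
      thus ?thesis unfolding rv by simp
    qed
  qed
  from bij_betw_same_card[OF this] show ?thesis by simp
qed

lemma real_card_filter:
  "finite A \<Longrightarrow> real (card {b \<in> A. P b}) = (\<Sum>b\<in>A. of_bool (P b))"
  by (simp add: of_bool_def sum.If_cases Int_def)

lemma sum_offsets: "(\<Sum>b\<in>{1..nb}. min d (n - (b - 1) * d)) = min n (nb * d)" for n d nb :: nat
proof (induction nb)
  case (Suc nb)
  have "(\<Sum>b\<in>{1..Suc nb}. min d (n - (b - 1) * d)) = min n (nb * d) + min d (n - nb * d)"
    using Suc by simp
  also have "\<dots> = min n (Suc nb * d)"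
    by (cases "n \<le> nb * d") (auto simp: min_def)
  finally show ?case .
qed simp

context tracking_meas
begin

definition good_thr :: "tape \<Rightarrow> bool" where
  "good_thr w \<longleftrightarrow> (\<forall>m i b d. 1 \<le> d \<longrightarrow> fst w (m, i, b, d) \<in> {1..d})"

text \<open>Thresholds live on the space of all natural numbers, so their range is an almost sure
  statement. Resampling the entry shows that the exceptional set is null.\<close>

lemma AE_good_thr: "AE w in TM. good_thr w"
proof -
  have "AE w in TM. 1 \<le> d \<longrightarrow> fst w (m, i, b, d) \<in> {1..d}" for m i b d
  proof (cases "1 \<le> d")
    case True
    let ?N = "{w \<in> space TM. \<not> fst w (m, i, b, d) \<in> {1..d}}"
    have [measurable]: "Measurable.pred TM (\<lambda>w. fst w (m, i, b, d) \<in> {1..d})"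
      by (rule measurable_compose[OF tape_measurable(1)[OF measurable_ident_sets[OF refl]]]) simp
    have N: "?N \<in> sets TM" by measurable
    have "emeasure TM ?N = (\<integral>\<^sup>+w. indicator ?N w \<partial>TM)" using N by simp
    also have "\<dots> = (\<Sum>x\<in>{1..d}. \<integral>\<^sup>+w. indicator ?N (set_thr (m, i, b, d) x w) \<partial>TM) / ennreal (real d)"
      by (rule resample_thr) (use True N in auto)
    also have "(\<Sum>x\<in>{1..d}. \<integral>\<^sup>+w. indicator ?N (set_thr (m, i, b, d) x w) \<partial>TM) = (\<Sum>x\<in>{1..d}. 0)"
      by (intro sum.cong refl) (auto simp: set_thr_def indicator_def)
    finally have "emeasure TM ?N = 0" by simp
    thus ?thesis using N by (intro AE_I[of _ _ ?N]) auto
  qed simp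
  thus ?thesis unfolding good_thr_def by (intro AE_all_countable[THEN iffD2] allI)
qed

lemma space_TM [simp]: "space TM = UNIV"
  unfolding tape_measure_eq space_pair_measure space_thr_measure by simp

abbreviation (input) coords :: "(nat \<times> nat) set" where "coords \<equiv> {..<k} \<times> {1..nb}"

text \<open>Bits and items are both summed block by block. The bound \<open>nb * d\<close> on local
  counts guarantees that the blocks cover all items.\<close>

lemma received_dev:
  assumes g: "good_thr w" and m: "rnd (conf w t) = m" and d: "blen (conf w t) = d" "1 \<le> d"
  shows "real (received w (conf w t)) - real (\<Sum>i<k. local_count (conf w t) i) / real d =
    (\<Sum>ib\<in>coords. dev t m d ib w)"
proof -
  have lc: "local_count (conf w t) i \<le> nb * d" for i
    using inv_conf[of w t] d by (simp add: inv_def)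
  have site: "real (card {n \<in> {1..local_count (conf w t) i}. hit w m d i n}) - real (local_count (conf w t) i) / real d =
     (\<Sum>b\<in>{1..nb}. dev t m d (i, b) w)" for i
  proof -
    let ?n = "local_count (conf w t) i" and ?r = "\<lambda>b. fst w (m, i, b, d)"
    have r: "?r b \<in> {1..d}" for b using g d(2) unfolding good_thr_def by blast
    have c0: "card {n \<in> {1..?n}. hit w m d i n} = card {b \<in> {1..nb}. ?r b \<le> min d (?n - (b - 1) * d)}"
      unfolding hit_def by (rule card_hits[where r = ?r, OF d(2) r lc[of i]])
    have "real (card {b \<in> {1..nb}. ?r b \<le> min d (?n - (b - 1) * d)}) =
        (\<Sum>b\<in>{1..nb}. of_bool (?r b \<le> min d (?n - (b - 1) * d)))"
      by (rule real_card_filter) simp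
    hence c: "real (card {n \<in> {1..?n}. hit w m d i n}) = (\<Sum>b\<in>{1..nb}. of_bool (?r b \<le> offset t d (i, b) w))"
      unfolding c0 offset_def fst_conv snd_conv .
    have "real ?n = real (\<Sum>b\<in>{1..nb}. min d (?n - (b - 1) * d))"
      using lc[of i] sum_offsets[where n = ?n and d = d and nb = nb] by (simp only: min_absorb1)
    also have "\<dots> = (\<Sum>b\<in>{1..nb}. real (offset t d (i, b) w))"
      by (simp only: offset_def fst_conv snd_conv of_nat_sum)
    finally show ?thesis
      unfolding c by (simp only: dev_def sum_subtractf sum_divide_distrib fst_conv snd_conv)
  qed
  have "real (received w (conf w t)) - real (\<Sum>i<k. local_count (conf w t) i) / real d =
     (\<Sum>i<k. real (card {n \<in> {1..local_count (conf w t) i}. hit w m d i n}) - real (local_count (conf w t) i) / real d)"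
    unfolding received_def m d(1) by (simp only: sum_subtractf sum_divide_distrib of_nat_sum)
  also have "\<dots> = (\<Sum>i<k. \<Sum>b\<in>{1..nb}. dev t m d (i, b) w)" by (simp only: site)
  also have "\<dots> = (\<Sum>ib\<in>coords. dev t m d ib w)"
    by (subst sum.cartesian_product) (rule sum.cong, auto)
  finally show ?thesis .
qed

definition active :: "nat \<Rightarrow> nat \<Rightarrow> tape \<Rightarrow> (nat \<times> nat) set" where
  "active t d w = {ib \<in> coords. 0 < offset t d ib w \<and> offset t d ib w < d}"

lemma finite_active [simp]: "finite (active t d w)"
  unfolding active_def by (rule finite_subset[of _ coords]) auto

text \<open>A site has at most one block that is begun but not complete, the one with index
  \<open>local_count (conf w t) i div d + 1\<close>.\<close>

lemma card_active: "card (active t d w) \<le> k"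
proof -
  have "b = local_count (conf w t) i div d + 1" if "(i, b) \<in> active t d w" for i b
  proof -
    have b: "1 \<le> b" "0 < local_count (conf w t) i - (b - 1) * d" "local_count (conf w t) i - (b - 1) * d < d"
      using that by (auto simp: active_def offset_def)
    hence "local_count (conf w t) i div d = b - 1"
      by (intro div_nat_eqI) (auto simp: mult.commute algebra_simps)
    thus ?thesis using b by simp
  qed
  hence "active t d w \<subseteq> (\<lambda>i. (i, local_count (conf w t) i div d + 1)) ` {..<k}"
    by (auto simp: active_def)
  hence "card (active t d w) \<le> card ((\<lambda>i. (i, local_count (conf w t) i div d + 1)) ` {..<k})"
    by (intro card_mono) auto
  also have "\<dots> \<le> k" using card_image_le[of "{..<k}"] by fastforce
  finally show ?thesis .
qed

lemma dev_le_1: "1 \<le> d \<Longrightarrow> \<bar>dev t m d ib w\<bar> \<le> 1"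
proof -
  assume "1 \<le> d"
  moreover have "offset t d ib w \<le> d" by (simp add: offset_def)
  ultimately have "0 \<le> real (offset t d ib w) / real d" "real (offset t d ib w) / real d \<le> 1"
    by (auto simp: divide_simps)
  thus ?thesis by (auto simp: dev_def of_bool_def)
qed

lemma dev_inactive:
  assumes "good_thr w" "1 \<le> d" "ib \<in> coords" "ib \<notin> active t d w"
  shows "dev t m d ib w = 0"
proof -
  have r: "fst w (m, fst ib, snd ib, d) \<in> {1..d}" using assms by (auto simp: good_thr_def)
  have "offset t d ib w \<le> d" by (simp add: offset_def)
  hence "offset t d ib w = 0 \<or> offset t d ib w = d"
    using assms by (auto simp: active_def)
  thus ?thesis using r assms(2) by (auto simp: dev_def)
qed

lemma sum_dev_active:
  assumes "good_thr w" "1 \<le> d"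
  shows "(\<Sum>ib\<in>coords. dev t m d ib w) = (\<Sum>ib\<in>active t d w. dev t m d ib w)"
  by (rule sum.mono_neutral_right) (use dev_inactive[OF assms] in \<open>auto simp: active_def\<close>)

lemma abs_sum_dev_le:
  assumes "1 \<le> d" "finite A" shows "\<bar>\<Sum>ib\<in>A. dev t m d ib w\<bar> \<le> real (card A)"
proof -
  have "\<bar>\<Sum>ib\<in>A. dev t m d ib w\<bar> \<le> (\<Sum>ib\<in>A. \<bar>dev t m d ib w\<bar>)" by (rule sum_abs)
  also have "\<dots> \<le> (\<Sum>ib\<in>A. 1)" by (intro sum_mono dev_le_1 assms)
  finally show ?thesis by simp
qed

text \<open>Every leak is charged to the time of a phase change, and phases strictly increase along
  these times.\<close>

lemma card_leaked:
  assumes "rnd (conf w t) = m"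
  shows "card {ib \<in> coords. leaked t m (fst ib) (snd ib) w} \<le> hz"
proof -
  define U where "U = {u. u < t \<and> rnd (conf w u) = m \<and> rnd (conf w (Suc u)) = m \<and>
     phase (conf w (Suc u)) \<noteq> phase (conf w u)}"
  have fin: "finite U" unfolding U_def by (rule finite_subset[of _ "{..<t}"]) auto
  have inj: "inj_on (\<lambda>u. phase (conf w u)) U"
  proof (rule linorder_inj_onI')
    fix u v assume uv: "u \<in> U" "v \<in> U" "u < v"
    have "phase (conf w u) < phase (conf w (Suc u))"
      using in_round_Suc(1)[of w u] uv by (auto simp: U_def)
    also have "\<dots> \<le> phase (conf w v)"
      by (rule in_round_mono(1)) (use uv in \<open>auto simp: U_def\<close>)
    finally show "phase (conf w u) \<noteq> phase (conf w v)" by simp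
  qed
  have "card U = card ((\<lambda>u. phase (conf w u)) ` U)" by (rule card_image[OF inj, symmetric])
  also have "\<dots> \<le> card {1..hz}"
    using inv_conf[of w] by (intro card_mono) (auto simp: inv_def)
  finally have cU: "card U \<le> hz" by simp
  have "{ib \<in> coords. leaked t m (fst ib) (snd ib) w} \<subseteq>
     (\<lambda>u. (the (act w u), local_count (conf w u) (the (act w u)) div blen (conf w u) + 1)) ` U"
    by (force simp: leaked_def U_def image_iff)
  hence "card {ib \<in> coords. leaked t m (fst ib) (snd ib) w} \<le>
     card ((\<lambda>u. (the (act w u), local_count (conf w u) (the (act w u)) div blen (conf w u) + 1)) ` U)"
    using fin by (intro card_mono) auto
  also have "\<dots> \<le> card U" by (rule card_image_le[OF fin])
  finally show ?thesis using cU by simp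
qed

subsection \<open>Deviation at a time determined by the view\<close>

text \<open>Markov's inequality for the product of factors. At most \<open>k\<close> blocks are hot,
  which costs \<open>kap * real k\<close>; leaked blocks contribute at most 1 each, which lowers
  \<open>x\<close> by \<open>hz\<close>; the factor 2 accounts for both signs. The bound is relative
  to the probability of \<open>Z\<close>, which makes it summable over disjoint events.\<close>

lemma deviation_tail:
  assumes Z[measurable]: "Measurable.pred TM Z" and inv: "view_inv t {} Z"
    and supp: "\<And>w. Z w \<Longrightarrow> rnd (conf w t) = m \<and> blen (conf w t) = d" and d: "1 \<le> d"
    and l: "0 < l" and kap: "l * (exp eps - 1) / 4 + l\<^sup>2 / 8 \<le> kap"
  shows "emeasure TM {w. Z w \<and> \<bar>\<Sum>ib\<in>coords. dev t m d ib w\<bar> > x} \<le>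
    ennreal (2 * exp (kap * real k - l * (x - real hz))) * emeasure TM {w. Z w}"
proof -
  let ?Z = "\<lambda>w. if Z w then 1 else 0 :: ennreal"
  let ?E = "{w. Z w \<and> \<bar>\<Sum>ib\<in>coords. dev t m d ib w\<bar> > x}"
  let ?c = "exp (kap * real k - l * (x - real hz))"
  have Zm: "?Z \<in> borel_measurable TM" by measurable
  have Zi: "view_inv t {} ?Z" using inv unfolding view_inv_def by metis
  have kap0: "0 \<le> kap"
  proof -
    have "0 \<le> l * (exp eps - 1) / 4 + l\<^sup>2 / 8" using l eps_pos by simp
    thus ?thesis using kap by linarith
  qed
  have mg: "(\<integral>\<^sup>+w. ?Z w * (\<Prod>ib\<in>coords. fac s kap t m d ib w) \<partial>TM) \<le> emeasure TM {w. Z w}"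
    if "s = l \<or> s = - l" for s
  proof -
    have "(\<integral>\<^sup>+w. ?Z w * (\<Prod>ib\<in>coords. fac s kap t m d ib w) \<partial>TM) \<le> (\<integral>\<^sup>+w. ?Z w \<partial>TM)"
      by (rule prod_fac_integral_le[OF Zm Zi _ d])
         (use that supp kap l in \<open>auto split: if_splits\<close>)
    also have "(\<integral>\<^sup>+w. ?Z w \<partial>TM) = (\<integral>\<^sup>+w. indicator {w. Z w} w \<partial>TM)"
      by (intro nn_integral_cong) (auto simp: indicator_def)
    also have "\<dots> = emeasure TM {w. Z w}"
      using Z by (intro nn_integral_indicator) (simp add: pred_def)
    finally show ?thesis .
  qed
  \<comment> \<open>The quotient \<open>s / l\<close> is the sign of the deviation.\<close>
  have large: "1 \<le> ennreal ?c * (\<Prod>ib\<in>coords. fac s kap t m d ib w)"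
    if g: "good_thr w" and Zw: "Z w" and s: "x < (s / l) * (\<Sum>ib\<in>coords. dev t m d ib w)" "s = l \<or> s = - l" for s w
  proof -
    let ?H = "{ib \<in> coords. hot t m d ib w}"
    let ?L = "{ib \<in> coords. leaked t m (fst ib) (snd ib) w}"
    let ?A = "active t d w"
    have HA: "?H = ?A - ?L" by (auto simp: hot_def active_def)
    have "(\<Sum>ib\<in>coords. dev t m d ib w) = (\<Sum>ib\<in>?A. dev t m d ib w)" by (rule sum_dev_active[OF g d])
    also have "\<dots> = (\<Sum>ib\<in>?H. dev t m d ib w) + (\<Sum>ib\<in>?A \<inter> ?L. dev t m d ib w)"
      unfolding HA by (subst sum.Int_Diff[of ?A _ ?L]) auto
    finally have eq: "(\<Sum>ib\<in>coords. dev t m d ib w) = \<dots>" .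
    have "\<bar>\<Sum>ib\<in>?A \<inter> ?L. dev t m d ib w\<bar> \<le> real (card (?A \<inter> ?L))"
      by (rule abs_sum_dev_le[OF d]) simp
    also have "\<dots> \<le> real (card ?L)" by (simp add: card_mono)
    also have "\<dots> \<le> real hz" by (rule of_nat_mono[OF card_leaked]) (use supp[OF Zw] in simp)
    finally have "x - real hz < (s / l) * (\<Sum>ib\<in>?H. dev t m d ib w)"
      using s l unfolding eq by (auto simp: algebra_simps)
    hence "l * (x - real hz) < l * ((s / l) * (\<Sum>ib\<in>?H. dev t m d ib w))"
      using l by (intro mult_strict_left_mono)
    hence lt: "l * (x - real hz) < s * (\<Sum>ib\<in>?H. dev t m d ib w)" using l by simp
    have "card ?H \<le> card ?A" unfolding HA by (intro card_mono) auto
    hence "real (card ?H) \<le> real k" using card_active[of t d w] by linarith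
    hence ck: "kap * real (card ?H) \<le> kap * real k" using kap0 by (intro mult_left_mono) auto
    have "(\<Prod>ib\<in>coords. fac s kap t m d ib w) = (\<Prod>ib\<in>?H. ennreal (exp (s * dev t m d ib w - kap)))"
      unfolding fac_def by (rule prod.inter_filter[symmetric]) simp
    also have "\<dots> = ennreal (exp (s * (\<Sum>ib\<in>?H. dev t m d ib w) - kap * real (card ?H)))"
      by (subst prod_ennreal) (auto simp: exp_sum[symmetric] sum_subtractf sum_distrib_left mult.commute)
    finally have "ennreal ?c * (\<Prod>ib\<in>coords. fac s kap t m d ib w) =
       ennreal (exp (kap * real k - l * (x - real hz) + (s * (\<Sum>ib\<in>?H. dev t m d ib w) - kap * real (card ?H))))"
      by (simp add: ennreal_mult'[symmetric] exp_add[symmetric])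
    also have "\<dots> \<ge> ennreal 1" using lt ck by (intro ennreal_leI) auto
    finally show ?thesis by simp
  qed
  have "{w \<in> space TM. Z w \<and> \<bar>\<Sum>ib\<in>coords. dev t m d ib w\<bar> > x} \<in> sets TM" by measurable
  hence E: "?E \<in> sets TM" by simp
  have "emeasure TM ?E = (\<integral>\<^sup>+w. indicator ?E w \<partial>TM)"
    by (rule nn_integral_indicator[OF E, symmetric])
  also have "\<dots> \<le> (\<integral>\<^sup>+w. ennreal ?c * (?Z w * (\<Prod>ib\<in>coords. fac l kap t m d ib w)) +
      ennreal ?c * (?Z w * (\<Prod>ib\<in>coords. fac (- l) kap t m d ib w)) \<partial>TM)"
  proof (rule nn_integral_mono_AE)
    show "AE w in TM. indicator ?E w \<le> ennreal ?c * (?Z w * (\<Prod>ib\<in>coords. fac l kap t m d ib w)) +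
      ennreal ?c * (?Z w * (\<Prod>ib\<in>coords. fac (- l) kap t m d ib w))"
      using AE_good_thr
    proof eventually_elim
      case (elim w)
      show ?case
      proof (cases "w \<in> ?E")
        case True
        hence Zw: "Z w" by simp
        have ll: "l / l = 1" "- l / l = - 1" using l by auto
        have "x < (\<Sum>ib\<in>coords. dev t m d ib w) \<or> x < - (\<Sum>ib\<in>coords. dev t m d ib w)"
          using True by auto
        thus ?thesis
        proof
          assume "x < (\<Sum>ib\<in>coords. dev t m d ib w)"
          hence "1 \<le> ennreal ?c * (\<Prod>ib\<in>coords. fac l kap t m d ib w)"
            using large[OF elim Zw, of l] ll by auto
          thus ?thesis using True Zw by (auto intro: add_increasing2)
        next
          assume "x < - (\<Sum>ib\<in>coords. dev t m d ib w)"
          hence "1 \<le> ennreal ?c * (\<Prod>ib\<in>coords. fac (- l) kap t m d ib w)"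
            using large[OF elim Zw, of "- l"] ll by auto
          thus ?thesis using True Zw by (auto intro: add_increasing)
        qed
      qed simp
    qed
  qed
  also have "\<dots> = ennreal ?c * (\<integral>\<^sup>+w. ?Z w * (\<Prod>ib\<in>coords. fac l kap t m d ib w) \<partial>TM) +
      ennreal ?c * (\<integral>\<^sup>+w. ?Z w * (\<Prod>ib\<in>coords. fac (- l) kap t m d ib w) \<partial>TM)"
    by (subst nn_integral_add, measurable) (simp add: nn_integral_cmult)
  also have "\<dots> \<le> ennreal ?c * emeasure TM {w. Z w} + ennreal ?c * emeasure TM {w. Z w}"
    by (intro add_mono mult_left_mono mg) auto
  also have "\<dots> = ennreal (2 * ?c) * emeasure TM {w. Z w}"
    by (simp add: distrib_right[symmetric] ennreal_plus[symmetric] del: ennreal_plus)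
  finally show ?thesis .
qed

subsection \<open>The first inaccurate answer of a phase\<close>

definition bad :: "nat \<Rightarrow> nat \<Rightarrow> tape \<Rightarrow> nat \<Rightarrow> bool" where
  "bad m j w t \<longleftrightarrow> rnd (conf w t) = m \<and> phase (conf w t) = j \<and> 1 \<le> blen (conf w t) \<and>
     \<bar>answer (conf w t) - real (total k (conf w t))\<bar> > \<alpha> * real (total k (conf w t))"

definition first_bad :: "nat \<Rightarrow> nat \<Rightarrow> nat \<Rightarrow> nat \<Rightarrow> tape \<Rightarrow> bool" where
  "first_bad m j t d w \<longleftrightarrow> bad m j w t \<and> blen (conf w t) = d \<and> (\<forall>u<t. \<not> bad m j w u)"

lemma bad_meas [measurable]: "Measurable.pred TM (\<lambda>w. bad m j w t)"
proof -
  have [measurable]: "(\<lambda>w. real (total k (conf w t))) \<in> borel_measurable TM"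
    by (rule measurable_compose[OF meas_total[OF measurable_ident_sets[OF refl] meas_conf_conf]]) simp
  show ?thesis unfolding bad_def by measurable
qed

lemma first_bad_meas [measurable]: "Measurable.pred TM (\<lambda>w. first_bad m j t d w)"
  unfolding first_bad_def by measurable

lemma bad_view:
  assumes "same_view t w w'" "u \<le> t" shows "bad m j w u = bad m j w' u"
  using same_viewD[OF assms] by (simp add: bad_def total_def)

text \<open>Answers, phases and counts are visible, so whether \<open>t\<close> is the first
  inaccurate time is decided by the view. This admits the event as \<open>Z\<close> in
  \<open>deviation_tail\<close>.\<close>

lemma first_bad_view: "view_inv t {} (first_bad m j t d)"
  unfolding view_inv_def first_bad_def
proof (intro allI impI)
  fix w w' assume sv: "same_view t w w'"
  have "(\<forall>u<t. \<not> bad m j w u) = (\<forall>u<t. \<not> bad m j w' u)"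
    using bad_view[OF sv] by simp
  thus "(bad m j w t \<and> blen (conf w t) = d \<and> (\<forall>u<t. \<not> bad m j w u)) =
      (bad m j w' t \<and> blen (conf w' t) = d \<and> (\<forall>u<t. \<not> bad m j w' u))"
    using bad_view[OF sv order_refl] same_viewD(6)[OF sv order_refl] by simp
qed

lemma first_bad_unique:
  assumes "first_bad m j t d w" "first_bad m j t' d' w" shows "t = t' \<and> d = d'"
proof -
  have "t = t'" using assms unfolding first_bad_def by (meson linorder_neqE_nat)
  thus ?thesis using assms by (simp add: first_bad_def)
qed

definition deviates :: "real \<Rightarrow> nat \<Rightarrow> nat \<Rightarrow> tape \<Rightarrow> bool" where
  "deviates x m j w \<longleftrightarrow> (\<exists>t d. 1 \<le> d \<and> first_bad m j t d w \<and> \<bar>\<Sum>ib\<in>coords. dev t m d ib w\<bar> > x)"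

lemma deviates_meas [measurable]: "Measurable.pred TM (deviates x m j)"
proof -
  have "Measurable.pred TM (\<lambda>w. deviates x m j w)" unfolding deviates_def by measurable
  thus ?thesis .
qed

text \<open>The events that the first inaccurate time is \<open>t\<close> with block length
  \<open>d\<close> are disjoint, so their probabilities add up to at most 1. The block length is
  enumerated as well, since it is random but has to be fixed for
  \<open>deviation_tail\<close>.\<close>

lemma emeasure_deviates:
  assumes l: "0 < l" and kap: "l * (exp eps - 1) / 4 + l\<^sup>2 / 8 \<le> kap"
  shows "emeasure TM {w. deviates x m j w} \<le> ennreal (2 * exp (kap * real k - l * (x - real hz)))"
proof -
  let ?c = "ennreal (2 * exp (kap * real k - l * (x - real hz)))"
  let ?Z = "\<lambda>n. {w. case prod_decode n of (t, d) \<Rightarrow> 1 \<le> d \<and> first_bad m j t d w}"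
  let ?E = "\<lambda>n. {w. case prod_decode n of (t, d) \<Rightarrow> (1 \<le> d \<and> first_bad m j t d w) \<and>
      \<bar>\<Sum>ib\<in>coords. dev t m d ib w\<bar> > x}"
  interpret prob_space TM by (rule prob_space_TM)
  have Em: "?E n \<in> sets TM" for n
  proof -
    obtain t d where td: "prod_decode n = (t, d)" by (cases "prod_decode n")
    have "{w \<in> space TM. (1 \<le> d \<and> first_bad m j t d w) \<and> \<bar>\<Sum>ib\<in>coords. dev t m d ib w\<bar> > x} \<in> sets TM"
      by measurable
    thus ?thesis by (simp add: td)
  qed
  have Zm: "?Z n \<in> sets TM" for n
  proof -
    obtain t d where td: "prod_decode n = (t, d)" by (cases "prod_decode n")
    have "{w \<in> space TM. 1 \<le> d \<and> first_bad m j t d w} \<in> sets TM" by measurable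
    thus ?thesis by (simp add: td)
  qed
  have EZ: "emeasure TM (?E n) \<le> ?c * emeasure TM (?Z n)" for n
  proof -
    obtain t d where td: "prod_decode n = (t, d)" by (cases "prod_decode n")
    show ?thesis
    proof (cases "1 \<le> d")
      case True
      have "emeasure TM {w. first_bad m j t d w \<and> \<bar>\<Sum>ib\<in>coords. dev t m d ib w\<bar> > x} \<le>
         ?c * emeasure TM {w. first_bad m j t d w}"
        by (rule deviation_tail[OF first_bad_meas first_bad_view _ True l kap])
           (simp add: first_bad_def bad_def)
      thus ?thesis using True by (simp only: td prod.case simp_thms)
    qed (simp add: td)
  qed
  have dis: "disjoint_family ?Z"
  proof (unfold disjoint_family_on_def, intro ballI impI)
    fix n n' :: nat assume nn: "n \<noteq> n'"
    obtain t d where td: "prod_decode n = (t, d)" by (cases "prod_decode n")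
    obtain t' d' where td': "prod_decode n' = (t', d')" by (cases "prod_decode n'")
    have "(t, d) \<noteq> (t', d')" using nn td td' by (metis prod_decode_inverse)
    moreover have "t = t' \<and> d = d'" if "first_bad m j t d w" "first_bad m j t' d' w" for w
      by (rule first_bad_unique[OF that])
    ultimately show "?Z n \<inter> ?Z n' = {}" unfolding td td' prod.case by blast
  qed
  have "{w. deviates x m j w} \<subseteq> (\<Union>n. ?E n)"
  proof
    fix w assume "w \<in> {w. deviates x m j w}"
    then obtain t d where "1 \<le> d" "first_bad m j t d w" "\<bar>\<Sum>ib\<in>coords. dev t m d ib w\<bar> > x"
      by (auto simp: deviates_def)
    hence "w \<in> ?E (prod_encode (t, d))" by (simp only: prod_encode_inverse prod.case mem_Collect_eq simp_thms)
    thus "w \<in> (\<Union>n. ?E n)" by (rule UN_I[OF UNIV_I])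
  qed
  hence "emeasure TM {w. deviates x m j w} \<le> emeasure TM (\<Union>n. ?E n)"
    by (rule emeasure_mono, intro sets.countable_UN image_subsetI Em)
  also have "\<dots> \<le> (\<Sum>n. emeasure TM (?E n))"
    by (rule emeasure_subadditive_countably, intro image_subsetI Em)
  also have "\<dots> \<le> (\<Sum>n. ?c * emeasure TM (?Z n))"
    by (intro suminf_le EZ) auto
  also have "\<dots> = ?c * emeasure TM (\<Union>n. ?Z n)"
    unfolding ennreal_suminf_cmult
    by (subst suminf_emeasure[OF _ dis]) (intro image_subsetI Zm refl)+
  also have "\<dots> \<le> ?c * 1" by (intro mult_left_mono emeasure_le_1) auto
  finally show ?thesis by simp
qed

end

subsection \<open>Accuracy, number of rounds and communication on a good tape\<close>

locale tracking_full = tracking_meas +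
  fixes N :: nat
  assumes adv_stop: "\<And>t h. N \<le> item_count h t \<Longrightarrow> adv t (z, h) = None"
    and k_le: "real k \<le> 1 / \<alpha>\<^sup>2"
begin

abbreviation "sk \<equiv> sqrt (real k)"
abbreviation "lapT w m j \<equiv> fst (snd w) (m, j :: nat) :: real"

lemma sk_ge1: "1 \<le> sk"
  using k_pos by simp

lemma sk_sq: "sk * sk = real k"
  by simp

lemma \<alpha>_sk: "\<alpha> * sk \<le> 1"
proof -
  have "(\<alpha> * sk)\<^sup>2 \<le> 1"
    using k_le \<alpha>_pos by (simp add: power_mult_distrib field_simps)
  thus ?thesis using \<alpha>_pos by (simp add: power_le_one_iff abs_square_le_1)
qed

lemma Csk_ge1: "1 \<le> C * sk"
  using mult_mono[OF C_ge1 sk_ge1] C_ge1 by simp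

lemma hz_le_sk: "real hz \<le> sk"
  by (simp add: horizon_def)

text \<open>Rounding down loses at most a factor 2 once the result is at least 1; hence 8 in one
  bound and 16 in the other.\<close>

lemma block_len_bounds:
  assumes "1 \<le> blen s"
  shows "real (blen s) * (8 * C * sk) \<le> \<alpha> * real (start_count s)"
    "\<alpha> * real (start_count s) \<le> real (blen s) * (16 * C * sk)" "1 \<le> start_count s"
proof -
  let ?D = "\<alpha> * real (start_count s) / (8 * C * sk)"
  have p: "0 < 8 * C * sk" using Csk_ge1 by linarith
  have D0: "0 \<le> ?D" using \<alpha>_pos p by (intro divide_nonneg_pos mult_nonneg_nonneg) auto
  have b: "real (blen s) = real_of_int \<lfloor>?D\<rfloor>"
    using D0 by (simp add: blen_def block_len_def)
  hence le: "real (blen s) \<le> ?D" and lt: "?D < real (blen s) + 1" by linarith+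
  show "real (blen s) * (8 * C * sk) \<le> \<alpha> * real (start_count s)"
    using le p by (simp only: pos_le_divide_eq)
  have "?D \<le> real (blen s) * 2" using lt assms by linarith
  hence "\<alpha> * real (start_count s) \<le> (real (blen s) * 2) * (8 * C * sk)"
    using p by (simp only: pos_divide_le_eq)
  thus "\<alpha> * real (start_count s) \<le> real (blen s) * (16 * C * sk)" by (simp only: mult_ac)
  show "1 \<le> start_count s"
  proof (rule ccontr)
    assume "\<not> 1 \<le> start_count s"
    hence "start_count s = 0" by simp
    thus False using assms by (simp add: blen_def block_len_def)
  qed
qed

lemma blen_zero_start:
  assumes "blen s = 0" shows "\<alpha> * real (start_count s) < 8 * C * sk"
proof -
  let ?D = "\<alpha> * real (start_count s) / (8 * C * sk)"
  have p: "0 < 8 * C * sk" using Csk_ge1 by linarith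
  have "\<lfloor>?D\<rfloor> \<le> 0" using assms by (simp add: blen_def block_len_def)
  hence "?D < 1" by linarith
  thus ?thesis using p by (simp only: pos_divide_less_eq)
qed

text \<open>The error is \<open>d * (x + v - b)\<close> with the prefix noise \<open>x\<close>, the
  deviation \<open>v\<close> and the pending bits \<open>b\<close>. Since \<open>b\<close> is below
  threshold plus noise, an underestimate involves the two noises only through their difference,
  which is why the difference is bounded as such.\<close>

lemma accurate:
  assumes d: "1 \<le> blen (conf w t)" and m: "rnd (conf w t) = m" and j: "phase (conf w t) = j"
    and dev: "\<bar>real (received w (conf w t)) - real (\<Sum>i<k. local_count (conf w t) i) / real (blen (conf w t))\<bar> \<le> C * sk"
    and noise: "lapT w m j - xi hz w m (j - 1) \<le> 5 * (C * sk)" "\<bar>xi hz w m (j - 1)\<bar> \<le> 7 * (C * sk)"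
  shows "\<not> bad m j w t"
proof -
  let ?s = "conf w t"
  define n where "n = real (\<Sum>i<k. local_count ?s i)"
  define d where "d = real (blen ?s)"
  define x where "x = xi hz w m (j - 1)"
  define Sm where "Sm = real (\<Sum>q\<in>{1..<j}. counter_in ?s q)"
  define b where "b = real (bit_count ?s)"
  have d1: "1 \<le> d" using assms(1) by (simp add: d_def)
  have I: "inv w ?s" by (rule inv_conf)
  have ans: "answer ?s = real (start_count ?s) + d * (Sm + x)"
    using I m j by (simp add: inv_def d_def Sm_def x_def)
  have "bit_count ?s + (\<Sum>q\<in>{1..<j}. counter_in ?s q) = received w ?s"
    using I j by (simp add: inv_def)
  hence B: "real (received w ?s) = b + Sm" unfolding b_def Sm_def by (metis of_nat_add)
  have tot: "real (total k ?s) = real (start_count ?s) + n" by (simp add: total_def n_def)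
  have bb: "b = 0 \<or> b < 2 * (C * sk) + lapT w m j"
    using I m j by (auto simp: inv_def b_def that_def mult.assoc)
  have b0: "0 \<le> b" by (simp add: b_def)
  define v where "v = b + Sm - n / d"
  have v: "\<bar>v\<bar> \<le> C * sk" using dev unfolding B n_def[symmetric] d_def[symmetric] v_def .
  have nd: "n = d * (b + Sm - v)" using d1 by (simp add: v_def)
  have diff: "answer ?s - real (total k ?s) = d * (x + v - b)"
    unfolding ans tot nd by (simp add: algebra_simps)
  have Q: "0 \<le> C * sk" using Csk_ge1 by linarith
  \<comment> \<open>From above 7 + 1, from below 1 + 2 + 5, in units of
    \<open>C * sk\<close>.\<close>
  have "\<bar>x + v - b\<bar> \<le> 8 * (C * sk)"
    using v noise bb b0 Q unfolding x_def[symmetric] by linarith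
  hence "d * \<bar>x + v - b\<bar> \<le> d * (8 * (C * sk))" using d1 by (intro mult_left_mono) auto
  also have "\<dots> \<le> \<alpha> * real (start_count ?s)"
    using block_len_bounds(1)[OF assms(1)] by (simp add: d_def mult_ac)
  also have "\<dots> \<le> \<alpha> * real (total k ?s)"
    using \<alpha>_pos by (intro mult_left_mono) (simp_all add: start_le_total)
  finally have "\<bar>answer ?s - real (total k ?s)\<bar> \<le> \<alpha> * real (total k ?s)"
    unfolding diff abs_mult using d1 by simp
  thus ?thesis by (simp add: bad_def)
qed

text \<open>No probability is involved: a complete block has sent exactly one bit, and every site
  has at most one block whose bit is open.\<close>

lemma received_bounds:
  assumes g: "good_thr w" and d: "1 \<le> blen s" and lc: "\<And>i. local_count s i \<le> nb * blen s"
  shows "real (received w s) \<le> real (\<Sum>i<k. local_count s i) / real (blen s) + real k"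
    "real (\<Sum>i<k. local_count s i) / real (blen s) \<le> real (received w s) + real k"
proof -
  let ?d = "blen s" and ?c = "\<lambda>i. card {n \<in> {1..local_count s i}. hit w (rnd s) (blen s) i n}"
  have site: "real (?c i) \<le> real (local_count s i) / real ?d + 1 \<and> real (local_count s i) / real ?d \<le> real (?c i) + 1" for i
  proof -
    let ?n = "local_count s i" and ?r = "\<lambda>b. fst w (rnd s, i, b, ?d)"
    have r: "?r b \<in> {1..?d}" for b using g d unfolding good_thr_def by blast
    have c0: "?c i = card {b \<in> {1..nb}. ?r b \<le> min ?d (?n - (b - 1) * ?d)}"
      unfolding hit_def by (rule card_hits[where r = ?r, OF d r lc])
    have up: "?c i \<le> ?n div ?d + 1"
    proof -
      have "b \<le> ?n div ?d + 1" if "?r b \<le> min ?d (?n - (b - 1) * ?d)" for b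
      proof -
        have "1 \<le> ?n - (b - 1) * ?d" using that r[of b] by auto
        hence "(b - 1) * ?d \<le> ?n" by simp
        hence "b - 1 \<le> ?n div ?d" using d by (simp add: less_eq_div_iff_mult_less_eq)
        thus ?thesis by simp
      qed
      hence "{b \<in> {1..nb}. ?r b \<le> min ?d (?n - (b - 1) * ?d)} \<subseteq> {1..?n div ?d + 1}" by auto
      from card_mono[OF _ this] show ?thesis unfolding c0 by simp
    qed
    have low: "?n div ?d \<le> ?c i"
    proof -
      have "{1..?n div ?d} \<subseteq> {b \<in> {1..nb}. ?r b \<le> min ?d (?n - (b - 1) * ?d)}"
      proof
        fix b assume b: "b \<in> {1..?n div ?d}"
        have "?n div ?d \<le> nb" using div_le_mono[OF lc[of i], of ?d] d by simp
        moreover have "b * ?d \<le> ?n" using b d by (simp add: less_eq_div_iff_mult_less_eq)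
        moreover have "b * ?d = (b - 1) * ?d + ?d" using b by (cases b) auto
        moreover have "?r b \<le> ?d" using r[of b] by simp
        ultimately show "b \<in> {b \<in> {1..nb}. ?r b \<le> min ?d (?n - (b - 1) * ?d)}"
          using b by auto
      qed
      from card_mono[OF _ this] show ?thesis unfolding c0 by simp
    qed
    have q: "real (?n div ?d) \<le> real ?n / real ?d" by (rule of_nat_div_le_of_nat)
    have "?n < ?d + ?n div ?d * ?d" using d by (intro dividend_less_div_times) simp
    hence "real ?n \<le> real (?d + ?n div ?d * ?d)" by (simp only: of_nat_le_iff)
    hence "real ?n \<le> (real (?n div ?d) + 1) * real ?d" by (simp add: algebra_simps)
    hence "real ?n / real ?d \<le> real (?n div ?d) + 1" using d by (simp add: pos_divide_le_eq)
    thus ?thesis using up low q by linarith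
  qed
  have "real (received w s) = (\<Sum>i<k. real (?c i))" by (simp only: received_def of_nat_sum)
  also have "\<dots> \<le> (\<Sum>i<k. real (local_count s i) / real ?d + 1)" by (intro sum_mono) (use site in blast)
  also have "\<dots> = real (\<Sum>i<k. local_count s i) / real ?d + real k"
    by (simp add: sum.distrib sum_divide_distrib)
  finally show "real (received w s) \<le> real (\<Sum>i<k. local_count s i) / real ?d + real k" .
  have "real (\<Sum>i<k. local_count s i) / real ?d = (\<Sum>i<k. real (local_count s i) / real ?d)"
    by (simp add: sum_divide_distrib)
  also have "\<dots> \<le> (\<Sum>i<k. real (?c i) + 1)" by (intro sum_mono) (use site in blast)
  also have "\<dots> = real (received w s) + real k" by (simp add: sum.distrib received_def)
  finally show "real (\<Sum>i<k. local_count s i) / real ?d \<le> real (received w s) + real k" .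
qed

text \<open>The deviation is controlled only at the first inaccurate time of the phase, so the
  contradiction is derived there. If \<open>k\<close> is at most \<open>C * sk\<close>,
  \<open>received_bounds\<close> replaces the probabilistic bound.\<close>

lemma never_bad:
  assumes g: "good_thr w" and dv: "\<not> deviates (C * sk) m j w \<or> real k \<le> C * sk"
    and noise: "lapT w m j - xi hz w m (j - 1) \<le> 5 * (C * sk)" "\<bar>xi hz w m (j - 1)\<bar> \<le> 7 * (C * sk)"
  shows "\<not> bad m j w t"
proof
  assume "bad m j w t"
  define t0 where "t0 = (LEAST t. bad m j w t)"
  have b0: "bad m j w t0" unfolding t0_def using \<open>bad m j w t\<close> by (rule LeastI)
  have "\<not> bad m j w u" if "u < t0" for u using not_less_Least[of u "bad m j w"] that by (simp add: t0_def)
  let ?s = "conf w t0"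
  have fb: "first_bad m j t0 (blen ?s) w" using b0 \<open>\<And>u. u < t0 \<Longrightarrow> \<not> bad m j w u\<close> by (simp add: first_bad_def)
  have r: "rnd ?s = m" "phase ?s = j" "1 \<le> blen ?s" using b0 by (auto simp: bad_def)
  have "\<bar>real (received w ?s) - real (\<Sum>i<k. local_count ?s i) / real (blen ?s)\<bar> \<le> C * sk"
  proof (cases "real k \<le> C * sk")
    case True
    have "local_count ?s i \<le> nb * blen ?s" for i using inv_conf[of w t0] by (simp add: inv_def)
    from received_bounds[OF g r(3) this] True show ?thesis by linarith
  next
    case False
    hence "\<bar>\<Sum>ib\<in>coords. dev t0 m (blen ?s) ib w\<bar> \<le> C * sk"
      using dv fb r(3) unfolding deviates_def by (meson not_less)
    thus ?thesis using received_dev[OF g r(1) refl r(3)] by simp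
  qed
  from accurate[OF r(3,1,2) this noise] b0 show False by simp
qed

section \<open>Growth of the count and number of rounds\<close>

lemma total_Suc:
  "total k (conf w (Suc t)) = total k (conf w t) + (if act w t = None then 0 else 1)"
  unfolding conf_Suc by (rule total_step) (rule act_less)

lemma total_le_N: "total k (conf w t) \<le> N"
proof (induction t)
  case 0
  show ?case by (simp add: conf_0 total_def)
next
  case (Suc t)
  show ?case
  proof (cases "N \<le> total k (conf w t)")
    case True
    hence "act w t = None" unfolding act_def by (intro adv_stop) (simp add: card_items)
    thus ?thesis using Suc by (simp add: total_Suc)
  next
    case False
    thus ?thesis by (simp add: total_Suc)
  qed
qed

text \<open>Bits run ahead of items by at most \<open>k\<close> blocks, so a round in which
  \<open>2 * k\<close> bits were sent has received at least \<open>k\<close> blocks of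
  items.\<close>

definition long_round :: "tape \<Rightarrow> nat \<Rightarrow> bool" where
  "long_round w m \<longleftrightarrow> 2 * real k \<le> (\<Sum>q\<in>{1..hz}. that w m q)"

abbreviation "growth \<equiv> \<alpha> * sk / (16 * C)"

lemma nb_ge: "C * real k \<le> real nb"
  unfolding num_blocks_def by linarith

lemma lc_le_recv:
  assumes "inv w s" "1 \<le> blen s" "\<not> ends a s"
  shows "local_count (recv w a s) i \<le> nb * blen (recv w a s)"
proof (cases "a = Some i")
  case True
  hence "local_count s i div blen s < nb" using assms by (auto simp: ends_def)
  hence "local_count s i < nb * blen s" using assms by (simp add: div_less_iff_less_mult)
  thus ?thesis using True by simp
qed (use assms in \<open>simp add: inv_def\<close>)

text \<open>If a site ends the round, it alone has filled \<open>nb\<close> blocks, which is at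
  least \<open>k\<close>. Otherwise all thresholds were met, and the round being long leaves at
  least \<open>k\<close> blocks of items after subtracting the \<open>k\<close> possibly premature
  bits.\<close>

lemma restart_growth:
  assumes g: "good_thr w" and r: "rnd (conf w (Suc t)) \<noteq> rnd (conf w t)" and l: "long_round w (rnd (conf w t))"
  shows "real (start_count (conf w t)) * (1 + growth) \<le> real (start_count (conf w (Suc t)))"
proof -
  let ?s = "conf w t" and ?a = "act w t"
  have I: "inv w ?s" by (rule inv_conf)
  have d: "1 \<le> blen ?s"
    using r idle_or_in_round(1,4)[of w t] by (cases "blen ?s = 0") auto
  have dk: "real (blen ?s) * real k \<ge> real (start_count ?s) * growth"
  proof -
    have "real (start_count ?s) * growth = \<alpha> * real (start_count ?s) * sk / (16 * C)" by simp
    also have "\<dots> \<le> real (blen ?s) * (16 * C * sk) * sk / (16 * C)"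
      using block_len_bounds(2)[OF d] C_ge1 sk_ge1 by (intro divide_right_mono mult_right_mono) auto
    also have "\<dots> = real (blen ?s) * (sk * sk)" using C_ge1 by simp
    finally show ?thesis by simp
  qed
  have "real (start_count ?s) + real (blen ?s) * real k \<le> real (start_count (conf w (Suc t)))"
  proof (cases "ends ?a ?s")
    case True
    then obtain i where i: "?a = Some i" "nb < local_count ?s i div blen ?s + 1" by (auto simp: ends_def)
    have ik: "i < k" by (rule act_less[OF i(1)])
    have "nb * blen ?s \<le> local_count ?s i"
      using i(2) d by (simp add: less_Suc_eq_le less_eq_div_iff_mult_less_eq)
    also have "\<dots> \<le> local_count (bump ?a ?s) i" by simp
    also have "\<dots> \<le> (\<Sum>i<k. local_count (bump ?a ?s) i)"
      using ik by (intro member_le_sum) auto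
    finally have le: "nb * blen ?s \<le> (\<Sum>i<k. local_count (bump ?a ?s) i)" .
    have "k \<le> nb" using nb_ge C_ge1 mult_right_mono[OF C_ge1, of "real k"] by linarith
    hence "k * blen ?s \<le> nb * blen ?s" by (rule mult_le_mono1)
    hence "start_count ?s + k * blen ?s \<le> start_count ?s + (\<Sum>i<k. local_count (bump ?a ?s) i)"
      using le by linarith
    hence "start_count ?s + blen ?s * k \<le> total k (bump ?a ?s)"
      unfolding total_def bump_simps(2) by (simp only: mult.commute)
    moreover have "start_count (conf w (Suc t)) = total k (bump ?a ?s)"
      using d True by (simp add: conf_Suc step_eq)
    ultimately show ?thesis by (metis of_nat_add of_nat_le_iff of_nat_mult)
  next
    case False
    let ?r = "recv w ?a ?s"
    have c: "real (bit_count ?r) \<ge> that w (rnd ?s) (phase ?s)" "\<not> phase ?s < hz"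
      "conf w (Suc t) = restart k ?r"
      using r d False by (auto simp: conf_Suc step_eq check_phase_eq split: if_splits)
    have ph: "phase ?s = hz" using c(2) I by (simp add: inv_def)
    have "(\<Sum>q\<in>{1..hz}. that w (rnd ?s) q) = that w (rnd ?s) hz + (\<Sum>q\<in>{1..<hz}. that w (rnd ?s) q)"
    proof -
      have "{1..hz} = insert hz {1..<hz}" using hz_pos by auto
      thus ?thesis by simp
    qed
    also have "\<dots> \<le> real (bit_count ?r) + (\<Sum>q\<in>{1..<hz}. real (counter_in ?s q))"
      using c(1) I ph by (intro add_mono sum_mono) (auto simp: inv_def)
    also have "\<dots> = real (received w ?r)"
    proof -
      have "bit_count ?s + (\<Sum>q\<in>{1..<hz}. counter_in ?s q) = received w ?s"
        using I ph by (simp add: inv_def)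
      hence "bit_count ?r + (\<Sum>q\<in>{1..<hz}. counter_in ?s q) = received w ?r"
        using received_recv[OF act_less[of w t], where w = w and s = ?s] by simp
      from arg_cong[OF this, of real] show ?thesis by (simp only: of_nat_add of_nat_sum)
    qed
    also have "\<dots> \<le> real (\<Sum>i<k. local_count ?r i) / real (blen ?s) + real k"
      using received_bounds(1)[OF g, of ?r] lc_le_recv[OF I d False] d by simp
    finally have "2 * real k \<le> real (\<Sum>i<k. local_count ?r i) / real (blen ?s) + real k"
      using l by (simp add: long_round_def)
    hence "real k \<le> real (\<Sum>i<k. local_count ?r i) / real (blen ?s)" by linarith
    hence "real (blen ?s) * real k \<le> real (\<Sum>i<k. local_count ?r i)"
      using d by (simp add: pos_le_divide_eq mult.commute)
    thus ?thesis using c(3) by (simp add: total_def)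
  qed
  thus ?thesis using dk by (simp add: algebra_simps)
qed

lemma start_mono_Suc: "start_count (conf w t) \<le> start_count (conf w (Suc t))"
  unfolding conf_Suc
  by (rule step_cases[where s = "conf w t" and a = "act w t" and w = w])
     (auto simp: total_def)

lemma start_growth:
  assumes g: "good_thr w" and "1 \<le> blen (conf w t)"
  shows "(1 + growth) ^ card {m. m < rnd (conf w t) \<and> long_round w m} \<le> real (start_count (conf w t))"
  using assms(2)
proof (induction t)
  case 0
  thus ?case by (simp add: conf_0 blen_def block_len_def)
next
  case (Suc t)
  have gr: "0 \<le> growth" using \<alpha>_pos sk_ge1 C_ge1 by (intro divide_nonneg_pos mult_nonneg_nonneg) auto
  show ?case
  proof (cases "blen (conf w t) = 0")
    case True
    thus ?thesis using idle_or_in_round(4)[OF True] block_len_bounds(3)[OF Suc.prems] by simp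
  next
    case False
    hence IH: "(1 + growth) ^ card {m. m < rnd (conf w t) \<and> long_round w m} \<le> real (start_count (conf w t))"
      using Suc.IH by simp
    show ?thesis
    proof (cases "rnd (conf w (Suc t)) = rnd (conf w t)")
      case True
      thus ?thesis using IH of_nat_mono[OF start_mono_Suc[of w t], where ?'a = real]
        by (simp only:; linarith)
    next
      case ne: False
      have Sr: "rnd (conf w (Suc t)) = Suc (rnd (conf w t))"
        using ne unfolding conf_Suc step_eq check_phase_eq by (auto split: option.splits if_splits)
      show ?thesis
      proof (cases "long_round w (rnd (conf w t))")
        case True
        have "{m. m < rnd (conf w (Suc t)) \<and> long_round w m} =
           insert (rnd (conf w t)) {m. m < rnd (conf w t) \<and> long_round w m}"
          using True by (auto simp: Sr less_Suc_eq)
        hence "(1 + growth) ^ card {m. m < rnd (conf w (Suc t)) \<and> long_round w m} =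
            (1 + growth) ^ card {m. m < rnd (conf w t) \<and> long_round w m} * (1 + growth)"
          by (simp add: mult.commute)
        also have "\<dots> \<le> real (start_count (conf w t)) * (1 + growth)"
          using IH gr by (intro mult_right_mono) auto
        also have "\<dots> \<le> real (start_count (conf w (Suc t)))" by (rule restart_growth[OF g ne True])
        finally show ?thesis .
      next
        case nl: False
        have "{m. m < rnd (conf w (Suc t)) \<and> long_round w m} = {m. m < rnd (conf w t) \<and> long_round w m}"
          using nl by (auto simp: Sr less_Suc_eq)
        thus ?thesis using IH of_nat_mono[OF start_mono_Suc[of w t], where ?'a = real]
          by (simp only:; linarith)
      qed
    qed
  qed
qed

text \<open>Otherwise the long rounds among the first \<open>R\<close> would have pushed the count
  beyond \<open>N\<close>.\<close>

lemma rnd_less: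
  assumes g: "good_thr w" and R: "1 \<le> R" and many: "real N < (1 + growth) ^ card {m. m < R \<and> long_round w m}"
  shows "rnd (conf w t) < R"
proof (rule ccontr)
  assume "\<not> rnd (conf w t) < R"
  hence Rt: "R \<le> rnd (conf w t)" by simp
  have d: "1 \<le> blen (conf w t)"
    using idle_or_in_round(1)[of w t] Rt R by (cases "blen (conf w t) = 0") auto
  have gr: "0 \<le> growth" using \<alpha>_pos sk_ge1 C_ge1 by (intro divide_nonneg_pos mult_nonneg_nonneg) auto
  have "real N < (1 + growth) ^ card {m. m < R \<and> long_round w m}" by (rule many)
  also have "\<dots> \<le> (1 + growth) ^ card {m. m < rnd (conf w t) \<and> long_round w m}"
    using gr Rt by (intro power_increasing card_mono) auto
  also have "\<dots> \<le> real (start_count (conf w t))" by (rule start_growth[OF g d])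
  also have "\<dots> \<le> real N"
    using start_le_total[of "conf w t"] total_le_N[of w t] by simp
  finally show False by simp
qed

section \<open>Number of words\<close>

lemma received_le:
  assumes "\<And>m q. m < R \<Longrightarrow> q \<in> {1..hz} \<Longrightarrow> lapT w m q \<le> 5 * (C * sk)" and "rnd (conf w t) < R"
  shows "real (received w (conf w t)) \<le> 8 * C * real k"
proof -
  let ?s = "conf w t"
  have I: "inv w ?s" by (rule inv_conf)
  have th: "that w (rnd ?s) q \<le> 7 * (C * sk)" if "q \<in> {1..hz}" for q
    using assms(1)[OF assms(2) that] by (simp add: that_def mult.assoc)
  have Q: "1 \<le> C * sk" by (rule Csk_ge1)
  have b: "real (bit_count ?s) \<le> 8 * (C * sk)"
  proof (cases "bit_count ?s = 0")
    case False
    hence "real (bit_count ?s) < that w (rnd ?s) (phase ?s)" using I by (simp add: inv_def)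
    also have "\<dots> \<le> 7 * (C * sk)" using I by (intro th) (simp add: inv_def)
    finally show ?thesis using Q by linarith
  qed (use Q in simp)
  \<comment> \<open>Threshold 2, noise 5, and the bit that overshoots, which is at most 1, all in
    units of \<open>C * sk\<close>.\<close>
  have c: "real (counter_in ?s q) \<le> 8 * (C * sk)" if q: "q \<in> {1..<phase ?s}" for q
  proof -
    have "q \<in> {1..hz}" using q I by (simp add: inv_def)
    moreover have "real (counter_in ?s q) \<le> max 0 (that w (rnd ?s) q) + 1" using I q by (simp add: inv_def)
    ultimately show ?thesis using th[of q] Q by linarith
  qed
  have "bit_count ?s + (\<Sum>q\<in>{1..<phase ?s}. counter_in ?s q) = received w ?s"
    using I by (simp add: inv_def)
  from arg_cong[OF this, of real]
  have "real (received w ?s) = real (bit_count ?s) + (\<Sum>q\<in>{1..<phase ?s}. real (counter_in ?s q))"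
    by (simp only: of_nat_add of_nat_sum)
  also have "\<dots> \<le> 8 * (C * sk) + (\<Sum>q\<in>{1..<phase ?s}. 8 * (C * sk))"
    by (intro add_mono b sum_mono c)
  also have "\<dots> = real (phase ?s) * (8 * (C * sk))"
    using I by (simp add: inv_def of_nat_diff algebra_simps)
  also have "\<dots> \<le> sk * (8 * (C * sk))"
    using I hz_le_sk Q by (intro mult_right_mono) (auto simp: inv_def)
  also have "\<dots> = 8 * C * (sk * sk)" by (simp only: mult_ac)
  finally show ?thesis by simp
qed

abbreviation "pot \<equiv> 34 * (C * sk) / \<alpha>"

text \<open>If the count grows by the factor \<open>1 + y\<close> in a round, then the items fill at
  most \<open>16 * (C * sk) / \<alpha> * y\<close> blocks, and for bounded \<open>y\<close> this is
  paid by the growth of the logarithm of the starting count. The other costs of a round, namely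
  \<open>3 * k\<close> for the restart, \<open>k\<close> for bits of incomplete blocks and 1 for the
  last message, fit into \<open>5 * k\<close>. The first bracket pays for the items forwarded before
  the first round and for the broadcast that opens it.\<close>

lemma words_bound:
  assumes g: "good_thr w" and noise: "\<And>m q. m < R \<Longrightarrow> q \<in> {1..hz} \<Longrightarrow> lapT w m q \<le> 5 * (C * sk)"
    and R: "\<And>t. rnd (conf w t) < R" and d: "1 \<le> blen (conf w t)"
  shows "real (words (conf w t)) \<le> (8 * (C * sk) / \<alpha> + 1 + real k) + 5 * real k * real (rnd (conf w t)) +
    pot * ln (real (start_count (conf w t))) + real (received w (conf w t))"
  using d
proof (induction t)
  case 0
  thus ?case by (simp add: conf_0 blen_def block_len_def)
next
  case (Suc t)
  let ?s = "conf w t" and ?s' = "conf w (Suc t)" and ?a = "act w t"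
  have I: "inv w ?s" by (rule inv_conf)
  have pot0: "0 \<le> pot" using Csk_ge1 \<alpha>_pos by (intro divide_nonneg_pos) auto
  show ?case
  proof (cases "blen ?s = 0")
    case True
    have w: "words ?s = start_count ?s" using I True by (simp add: inv_def)
    have "?a \<noteq> None"
    proof
      assume "?a = None"
      thus False using True Suc.prems by (simp add: conf_Suc step_eq)
    qed
    then obtain i where "?a = Some i" by auto
    hence "?s' = forward k \<alpha> C ?s" using True by (simp add: conf_Suc step_eq)
    hence "words ?s' \<le> start_count ?s + 1 + k" using w by simp
    moreover have "real (start_count ?s) \<le> 8 * (C * sk) / \<alpha>"
      using blen_zero_start[OF True] \<alpha>_pos by (simp add: pos_le_divide_eq mult_ac)
    moreover have "0 \<le> ln (real (start_count ?s'))" using block_len_bounds(3)[OF Suc.prems] by simp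
    hence "0 \<le> pot * ln (real (start_count ?s'))" using pot0 by (intro mult_nonneg_nonneg)
    moreover have "0 \<le> 5 * real k * real (rnd ?s')" by simp
    ultimately show ?thesis by linarith
  next
    case False
    hence d: "1 \<le> blen ?s" by simp
    note IH = Suc.IH[OF d]
    show ?thesis
    proof (cases "rnd ?s' = rnd ?s")
      case True
      have d0: "0 < blen ?s" using d by simp
      from in_round_cases[OF True d0]
      have "words ?s' = words ?s + sent w ?a ?s \<and> start_count ?s' = start_count ?s \<and>
         received w ?s' = received w (recv w ?a ?s)"
        by cases (auto intro!: received_cong)
      thus ?thesis
        using IH True received_recv[OF act_less[of w t], where w = w and s = ?s] by simp
    next
      case ne: False
      have Sr: "rnd ?s' = Suc (rnd ?s)"
        using ne unfolding conf_Suc step_eq check_phase_eq by (auto split: option.splits if_splits)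
      have tot: "words ?s' \<le> words ?s + 1 + 3 * k \<and> total k ?s \<le> start_count ?s' \<and> received w ?s' = 0"
      proof (cases "ends ?a ?s")
        case True
        hence "?s' = restart k ((bump ?a ?s)\<lparr>words := words ?s + 1\<rparr>)"
          using d by (simp add: conf_Suc step_eq)
        thus ?thesis using total_bump[OF act_less[of w t], where s = ?s] by (simp add: received_def)
      next
        case False
        have "?s' = restart k (recv w ?a ?s)"
          using ne d False by (auto simp: conf_Suc step_eq check_phase_eq split: if_splits)
        moreover have "sent w ?a ?s \<le> 1" by (simp add: sent_def split: option.splits)
        ultimately show ?thesis
          using total_bump[OF act_less[of w t], where s = ?s] by (simp add: received_def)
      qed
      define n where "n = real (\<Sum>i<k. local_count ?s i)"
      define s0 where "s0 = real (start_count ?s)"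
      define b where "b = real (blen ?s)"
      have s0: "1 \<le> s0" using block_len_bounds(3)[OF d] by (simp add: s0_def)
      have b1: "1 \<le> b" using d by (simp add: b_def)
      have n0: "0 \<le> n" unfolding n_def by (rule of_nat_0_le_iff)
      have lc: "local_count ?s i \<le> nb * blen ?s" for i using I by (simp add: inv_def)
      have rb: "real (received w ?s) \<le> n / b + real k" "n / b \<le> real (received w ?s) + real k"
        using received_bounds[OF g d lc] by (simp_all add: n_def b_def)
      have "n / b \<le> 8 * C * real k + real k"
        using rb(2) received_le[OF noise R, of t] by linarith
      also have "\<dots> \<le> 9 * (C * real k)" using mult_right_mono[OF C_ge1, of "real k"] by simp
      \<comment> \<open>The length of a block is at most \<alpha> times the starting count over
        \<open>8 * C * sk\<close>, and \<open>\<alpha>_sk\<close> removes the remaining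
        \<open>sk\<close>; so a round at most adds 9/8 of the count.\<close>
      finally have "n \<le> 9 * (C * real k) * b" using b1 by (simp add: pos_divide_le_eq)
      also have "\<dots> = (b * (8 * C * sk)) * (9 / 8 * sk)"
        using sk_sq by (simp add: mult_ac)
      also have "\<dots> \<le> (\<alpha> * s0) * (9 / 8 * sk)"
        using block_len_bounds(1)[OF d] sk_ge1 unfolding b_def s0_def by (intro mult_right_mono) auto
      also have "\<dots> = (\<alpha> * sk) * (9 / 8 * s0)" by simp
      also have "\<dots> \<le> 1 * (9 / 8 * s0)" using \<alpha>_sk s0 by (intro mult_right_mono) auto
      finally have n9: "n \<le> 9 / 8 * s0" by simp
      define y where "y = n / s0"
      have y: "0 \<le> y" "y \<le> 9 / 8" using n0 n9 s0 by (simp_all add: y_def pos_divide_le_eq)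
      \<comment> \<open>Because \<open>1 + y\<close> is at most 17/8. This gives the constant of
        \<open>pot\<close>, 34 = 16 * 17/8.\<close>
      have "y \<le> 17 / 8 * (y / (1 + y))"
      proof -
        have "y * (1 + y) \<le> 17 / 8 * y" using mult_left_mono[of "1 + y" "17 / 8" y] y by simp
        hence "y \<le> (17 / 8 * y) / (1 + y)" using y by (subst pos_le_divide_eq) auto
        thus ?thesis by simp
      qed
      also have "y / (1 + y) \<le> ln (1 + y)"
      proof -
        have "ln (1 / (1 + y)) \<le> 1 / (1 + y) - 1" using y by (intro ln_le_minus_one) auto
        moreover have "ln (1 / (1 + y)) = - ln (1 + y)" using y by (simp add: ln_div)
        moreover have "1 - 1 / (1 + y) = y / (1 + y)" using y by (simp add: field_simps)
        ultimately show ?thesis by linarith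
      qed
      finally have yl: "y \<le> 17 / 8 * ln (1 + y)" by simp
      have "n / b \<le> 16 * (C * sk) / \<alpha> * y"
      proof -
        have "n * (\<alpha> * s0) \<le> n * (b * (16 * C * sk))"
          using block_len_bounds(2)[OF d] n0 unfolding b_def s0_def by (intro mult_left_mono)
        thus ?thesis using b1 s0 \<alpha>_pos by (simp add: y_def divide_simps mult_ac)
      qed
      also have "\<dots> \<le> 16 * (C * sk) / \<alpha> * (17 / 8 * ln (1 + y))"
        using Csk_ge1 \<alpha>_pos by (intro mult_left_mono yl divide_nonneg_pos) auto
      also have "\<dots> = pot * ln (1 + y)" by simp
      finally have nb: "n / b \<le> pot * ln (1 + y)" .
      have "s0 * (1 + y) = s0 + n" using s0 by (simp add: y_def field_simps)
      also have "\<dots> = real (total k ?s)" by (simp add: total_def s0_def n_def)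
      also have "\<dots> \<le> real (start_count ?s')" using tot by simp
      finally have le: "s0 * (1 + y) \<le> real (start_count ?s')" .
      have "ln s0 + ln (1 + y) = ln (s0 * (1 + y))" using s0 y by (simp add: ln_mult)
      also have "\<dots> \<le> ln (real (start_count ?s'))"
      proof -
        have "0 < s0 * (1 + y)" using s0 y by (intro mult_pos_pos) auto
        thus ?thesis using le by (intro ln_mono) auto
      qed
      finally have "pot * (ln s0 + ln (1 + y)) \<le> pot * ln (real (start_count ?s'))"
        using pot0 by (intro mult_left_mono)
      hence "pot * ln s0 + n / b \<le> pot * ln (real (start_count ?s'))"
        using nb by (simp only: distrib_left; linarith)
      moreover have "real (words ?s') \<le> real (words ?s) + 1 + 3 * real k" using tot by linarith
      moreover have "5 * real k * real (rnd ?s') = 5 * real k * real (rnd ?s) + 5 * real k"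
        by (simp add: Sr algebra_simps)
      moreover have "1 \<le> real k" using k_pos by simp
      ultimately show ?thesis using IH rb(1) tot unfolding s0_def[symmetric] by linarith
    qed
  qed
qed

end

subsection \<open>Tails of the noise\<close>

text \<open>All \<open>L\<close> digits are 1 only for \<open>2 ^ L - 1\<close>, which the
  hypothesis excludes. Summing the constant 1 in \<open>dyadic_sum\<close> evaluates the number with
  all digits 1.\<close>

lemma card_odd_digits:
  fixes j L :: nat
  assumes "j + 1 < 2 ^ L" shows "card {l. l < L \<and> odd (j div 2 ^ l)} < L"
proof (rule ccontr)
  let ?S = "{l. l < L \<and> odd (j div 2 ^ l)}"
  assume "\<not> card ?S < L"
  hence "card {..<L} \<le> card ?S" by simp
  moreover have "?S \<subseteq> {..<L}" by auto
  ultimately have "?S = {..<L}" by (intro card_seteq) auto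
  hence "(\<Sum>l<L. \<Sum>i\<in>dyadic l (j div 2 ^ l - 1). 1) = (\<Sum>i\<in>{j div 2 ^ L * 2 ^ L<..j}. 1 :: nat)"
    using dyadic_sum[where L = L and j = j and x = "\<lambda>_. 1 :: nat"] by simp
  moreover have "card (dyadic l q) = 2 ^ l" for l q by (simp add: dyadic_def)
  ultimately have "(\<Sum>l<L. 2 ^ l) = j" using assms by simp
  hence "j = 2 ^ L - 1" by (simp add: sum_power2 atLeast0LessThan[symmetric])
  thus False using assms by simp
qed

lemma emeasure_PiM_coordinate:
  assumes M: "\<And>i. prob_space (M i)" and A: "A \<in> sets (M i)"
  shows "emeasure (PiM UNIV M) {w \<in> space (PiM UNIV M). w i \<in> A} = emeasure (M i) A"
proof -
  have "emeasure (PiM UNIV M) {w \<in> space (PiM UNIV M). w i \<in> A} =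
    (\<integral>\<^sup>+w. indicator {w \<in> space (PiM UNIV M). w i \<in> A} w \<partial>PiM UNIV M)"
  proof (rule nn_integral_indicator[symmetric])
    have "(\<lambda>w. w i) -` A \<inter> space (PiM UNIV M) \<in> sets (PiM UNIV M)"
      by (rule measurable_sets[OF measurable_component_singleton[OF UNIV_I, where M = M] A])
    moreover have "(\<lambda>w. w i) -` A \<inter> space (PiM UNIV M) = {w \<in> space (PiM UNIV M). w i \<in> A}" by auto
    ultimately show "{w \<in> space (PiM UNIV M). w i \<in> A} \<in> sets (PiM UNIV M)" by simp
  qed
  also have "\<dots> = (\<integral>\<^sup>+w. (\<Prod>q\<in>{i}. indicator A (w q)) \<partial>PiM UNIV M)"
    by (intro nn_integral_cong) (auto simp: indicator_def)
  also have "\<dots> = (\<Prod>q\<in>{i}. \<integral>\<^sup>+x. indicator A x \<partial>M q)"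
    by (rule nn_integral_PiM_prod[OF M]) (use A in auto)
  finally show ?thesis using A by simp
qed

lemma one_le_prod_ennreal:
  fixes f :: "'a \<Rightarrow> ennreal"
  assumes "\<And>i. i \<in> A \<Longrightarrow> 1 \<le> f i" shows "1 \<le> prod f A"
  using assms
proof (induction A rule: infinite_finite_induct)
  case (insert i A)
  have "1 * 1 \<le> f i * prod f A" using insert by (intro mult_mono) auto
  thus ?case using insert.hyps by simp
qed auto

context tracking_full
begin

abbreviation "Lv \<equiv> bm_levels hz"
abbreviation "b1 \<equiv> 4 / eps"
abbreviation "b2 \<equiv> real Lv / (eps / 4)"
abbreviation "X \<equiv> C * sk"

text \<open>Error distances are multiples of \<open>X\<close> and noise scales are multiples of
  \<open>1 / eps\<close>, so \<open>k\<close> cancels and all tail exponents are multiples of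
  \<open>C\<^sup>2\<close>.\<close>

lemma X_eps: "X * eps = C\<^sup>2"
  using sk_ge1 by (simp add: priv_def power2_eq_square)

lemma X_div_b1: "c * X / b1 = c * C\<^sup>2 / 4"
proof -
  have "c * X / b1 = c * (X * eps) / 4" by simp
  thus ?thesis by (simp only: X_eps)
qed

lemma X_div_b2: "c * X / b2 = c * C\<^sup>2 / (4 * real Lv)"
proof -
  have "c * X / b2 = c * (X * eps) / (4 * real Lv)" by simp
  thus ?thesis by (simp only: X_eps)
qed

lemma emeasure_TM_snd:
  assumes "A \<in> sets (lap1 \<Otimes>\<^sub>M lap2)"
  shows "emeasure TM {w. snd w \<in> A} = emeasure (lap1 \<Otimes>\<^sub>M lap2) A"
proof -
  interpret H: prob_space thr_measure by (rule prob_space_thr_measure)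
  interpret B: prob_space "lap1 \<Otimes>\<^sub>M lap2" by (rule prob_space_lap)
  have "{w. snd w \<in> A} = space thr_measure \<times> A" unfolding space_thr_measure by auto
  moreover have "emeasure TM (space thr_measure \<times> A) = emeasure thr_measure (space thr_measure) * emeasure (lap1 \<Otimes>\<^sub>M lap2) A"
    unfolding tape_measure_eq by (intro B.emeasure_pair_measure_Times assms sets.top)
  ultimately show ?thesis by (simp only: H.emeasure_space_1 mult_1_left)
qed

lemma emeasure_TM_lap1:
  assumes "A \<in> sets lap1"
  shows "emeasure TM {w. fst (snd w) \<in> A} = emeasure lap1 A"
proof -
  interpret L2: prob_space lap2 by (rule prob_lap)
  have "{w :: tape. fst (snd w) \<in> A} = {w. snd w \<in> A \<times> space lap2}" by (auto simp: space_pair_measure)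
  moreover have "A \<times> space lap2 \<in> sets (lap1 \<Otimes>\<^sub>M lap2)" by (rule pair_measureI[OF assms sets.top])
  moreover have "emeasure (lap1 \<Otimes>\<^sub>M lap2) (A \<times> space lap2) = emeasure lap1 A * emeasure lap2 (space lap2)"
    by (intro L2.emeasure_pair_measure_Times assms sets.top)
  ultimately show ?thesis by (simp only: emeasure_TM_snd L2.emeasure_space_1 mult_1_right)
qed

lemma emeasure_TM_lap2:
  assumes "A \<in> sets lap2"
  shows "emeasure TM {w. snd (snd w) \<in> A} = emeasure lap2 A"
proof -
  interpret L1: prob_space lap1 by (rule prob_lap)
  interpret L2: prob_space lap2 by (rule prob_lap)
  have "{w :: tape. snd (snd w) \<in> A} = {w. snd w \<in> space lap1 \<times> A}" by (auto simp: space_pair_measure)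
  moreover have "space lap1 \<times> A \<in> sets (lap1 \<Otimes>\<^sub>M lap2)" by (rule pair_measureI[OF sets.top assms])
  moreover have "emeasure (lap1 \<Otimes>\<^sub>M lap2) (space lap1 \<times> A) = emeasure lap1 (space lap1) * emeasure lap2 A"
    by (intro L2.emeasure_pair_measure_Times assms sets.top)
  ultimately show ?thesis by (simp only: emeasure_TM_snd L1.emeasure_space_1 mult_1_left)
qed

lemma lapT_tail:
  assumes "0 \<le> c"
  shows "emeasure TM {w. c * X < lapT w m q} \<le> ennreal (exp (- c * C\<^sup>2 / 4) / 2)"
proof -
  have X0: "0 \<le> X" using Csk_ge1 by linarith
  have e: "{x \<in> space lap1. x (m, q) \<in> {c * X<..}} = {x. c * X < x (m, q)}"
    by (auto simp: space_PiM)
  have s: "{x \<in> space lap1. x (m, q) \<in> {c * X<..}} \<in> sets lap1" by measurable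
  have "emeasure TM {w. fst (snd w) \<in> {x. c * X < x (m, q)}} = emeasure lap1 {x. c * X < x (m, q)}"
    by (rule emeasure_TM_lap1) (use s e in simp)
  also have "\<dots> = emeasure (laplace b1) {c * X<..}"
    unfolding e[symmetric] by (rule emeasure_PiM_coordinate) (auto intro: prob_space_laplace scales_pos)
  also have "\<dots> \<le> ennreal (exp (- (c * X) / b1) / 2)"
    by (rule laplace_tail[OF scales_pos(1)]) (use assms X0 in simp)
  also have "- (c * X) / b1 = - c * C\<^sup>2 / 4" using X_div_b1[of "- c"] by simp
  finally show ?thesis by simp
qed

definition digits :: "nat \<Rightarrow> nat set" where "digits j = {l. l < Lv \<and> odd (j div 2 ^ l)}"
definition intervals :: "nat \<Rightarrow> nat \<Rightarrow> (nat \<times> nat \<times> nat) set" where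
  "intervals m j = (\<lambda>l. (m, l, j div 2 ^ l - 1)) ` digits j"

lemma finite_intervals [simp]: "finite (intervals m j)"
  by (simp add: intervals_def digits_def)

lemma xi_intervals: "xi hz w m j = (\<Sum>q\<in>intervals m j. snd (snd w) q)"
  unfolding intervals_def xi_def digits_def by (subst sum.reindex) (auto simp: inj_on_def)

text \<open>The prefix noise needed in phase \<open>q\<close> is that of index \<open>q - 1\<close>,
  which is less than the horizon. So not all levels occur, and one factor is saved in
  \<open>infl\<close>.\<close>

lemma card_intervals:
  assumes "j < hz" shows "card (intervals m j) < Lv"
proof -
  have "card (intervals m j) = card (digits j)"
    unfolding intervals_def by (rule card_image) (auto simp: inj_on_def)
  also have "\<dots> < Lv"
    unfolding digits_def using less_two_power_bm_levels[OF hz_pos, of "j + 1"] assms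
    by (intro card_odd_digits) (use less_two_power_bm_levels[OF hz_pos, of hz] in simp)
  finally show ?thesis .
qed

text \<open>The moment generating factors at the rate \<open>u / b2\<close>. At most
  \<open>Lv - 1\<close> intervals occur, and one of them is integrated by its tail.\<close>

definition infl :: "real \<Rightarrow> real" where "infl u = (1 / (1 - u\<^sup>2)) ^ (Lv - 2)"

text \<open>The critical rate \<open>u = 1\<close> is allowed for \<open>Lv \<le> 2\<close>, since
  then the prefix noise is a single variable.\<close>

lemma xi_tail:
  assumes j: "j < hz" and ne: "intervals m j \<noteq> {}" and u: "0 < u" "u \<le> 1" "u = 1 \<Longrightarrow> Lv \<le> 2"
    and \<sigma>: "\<sigma> = 1 \<or> \<sigma> = -1"
  shows "emeasure lap2 {y. s < (\<Sum>q\<in>intervals m j. \<sigma> * y q)} \<le> ennreal (exp (- (u / b2) * s) * infl u)"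
proof -
  obtain q0 where q0: "q0 \<in> intervals m j" using ne by blast
  define J where "J = intervals m j - {q0}"
  have ins: "intervals m j = insert q0 J" and J: "finite J" "q0 \<notin> J" using q0 by (auto simp: J_def)
  have cJ: "card J \<le> Lv - 2" using card_intervals[OF j, of m] J unfolding ins by simp
  have b2: "0 < b2" by (rule scales_pos)
  have "b2 \<noteq> 0" using b2 by linarith
  hence ub: "u / b2 * b2 = u" by (rule iffD1[OF nonzero_eq_divide_eq refl])
  have le: "emeasure lap2 {y. s < (\<Sum>q\<in>intervals m j. \<sigma> * y q)} \<le>
     ennreal (exp (- (u / b2) * s) * (1 / (1 - (u / b2 * b2)\<^sup>2)) ^ card J)"
    unfolding ins
  proof (rule laplace_sum_tail[OF b2 _ _ \<sigma> J])
    show "0 \<le> u / b2" by (intro divide_nonneg_pos b2 less_imp_le u)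
    show "u / b2 \<le> 1 / b2" by (intro divide_right_mono u less_imp_le b2)
    show "u / b2 * b2 < 1" if "J \<noteq> {}"
    proof -
      have "card J \<noteq> 0" using that J by simp
      hence "u \<noteq> 1" using cJ u(3) by auto
      thus ?thesis using u ub by simp
    qed
  qed
  have le2: "(1 / (1 - u\<^sup>2)) ^ card J \<le> infl u"
  proof (cases "u = 1")
    case True
    hence "Lv - 2 = 0" "card J = 0" using u(3) cJ by auto
    thus ?thesis by (simp only: infl_def power_0)
  next
    case False
    hence "u\<^sup>2 < 1" "0 \<le> u\<^sup>2" using u by (auto simp: power_less_one_iff abs_square_less_1)
    hence "1 \<le> 1 / (1 - u\<^sup>2)" by simp
    thus ?thesis unfolding infl_def using cJ by (intro power_increasing)
  qed
  show ?thesis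
    by (rule order_trans[OF le[unfolded ub] ennreal_leI[OF mult_left_mono[OF le2 exp_ge_zero]]])
qed

text \<open>The first condition limits the bits of a phase, the other two are the hypotheses of
  \<open>accurate\<close>.\<close>

definition noise_fail :: "nat \<Rightarrow> nat \<Rightarrow> tape \<Rightarrow> bool" where
  "noise_fail m q w \<longleftrightarrow> 5 * X < lapT w m q \<or> 5 * X < lapT w m q - xi hz w m (q - 1) \<or>
     7 * X < \<bar>xi hz w m (q - 1)\<bar>"

lemma xi_meas [measurable]: "(\<lambda>w. xi hz w m j) \<in> borel_measurable TM"
  unfolding xi_def by measurable

lemma lapT_meas [measurable]: "(\<lambda>w. lapT w m j) \<in> borel_measurable TM"
  by (rule tape_measurable(2)[OF measurable_ident_sets[OF refl]])

lemma noise_fail_meas [measurable]: "Measurable.pred TM (\<lambda>w. noise_fail m q w)"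
  unfolding noise_fail_def by measurable

lemma infl_nonneg: "0 \<le> infl u" if "0 < u" "u \<le> 1"
proof -
  have "u\<^sup>2 \<le> 1" using that by (simp add: power_le_one_iff abs_square_le_1)
  thus ?thesis by (simp add: infl_def)
qed

text \<open>Given the threshold noise, the tail of the prefix noise is bounded by an exponential of
  it, which is then integrated. Relative to the threshold noise, whose scale is smaller by the
  factor \<open>Lv\<close>, the rate is only \<open>u / real Lv\<close>, so this costs a factor
  close to 1.\<close>

lemma emeasure_diff_tail:
  assumes j: "j < hz" and ne: "intervals m j \<noteq> {}" and u: "0 < u" "u \<le> 1" "u = 1 \<Longrightarrow> Lv \<le> 2" and L: "2 \<le> Lv"
  shows "emeasure TM {w. 5 * X < lapT w m q - xi hz w m j} \<le>
    ennreal (exp (- 5 * u * C\<^sup>2 / (4 * real Lv)) * (1 / (1 - (u / real Lv)\<^sup>2)) * infl u)"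
proof -
  interpret L1: prob_space lap1 by (rule prob_lap)
  interpret L2: prob_space lap2 by (rule prob_lap)
  define th where "th = u / b2"
  let ?A = "{v. 5 * X < fst v (m, q) - (\<Sum>r\<in>intervals m j. snd v r)}"
  have "{v \<in> space (lap1 \<Otimes>\<^sub>M lap2). 5 * X < fst v (m, q) - (\<Sum>r\<in>intervals m j. snd v r)} \<in> sets (lap1 \<Otimes>\<^sub>M lap2)"
    by measurable
  hence A: "?A \<in> sets (lap1 \<Otimes>\<^sub>M lap2)" by (simp add: space_pair_measure)
  have b12: "0 < b1" "0 < b2" by (rule scales_pos)+
  have \<theta>: "0 < th" unfolding th_def by (rule divide_pos_pos[OF u(1) b12(2)])
  have \<theta>b: "th * b1 = u / real Lv" unfolding th_def using eps_pos by simp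
  have uL: "u / real Lv < 1" using u L by (simp add: divide_less_eq)
  have "emeasure TM {w. snd w \<in> ?A} = emeasure (lap1 \<Otimes>\<^sub>M lap2) ?A" by (rule emeasure_TM_snd[OF A])
  also have "\<dots> = (\<integral>\<^sup>+x. emeasure lap2 (Pair x -` ?A) \<partial>lap1)" by (rule L2.emeasure_pair_measure_alt[OF A])
  also have "\<dots> \<le> (\<integral>\<^sup>+x. ennreal (exp (- th * (5 * X)) * infl u) * (\<Prod>r\<in>{(m, q)}. ennreal (exp (th * x r))) \<partial>lap1)"
  proof (intro nn_integral_mono)
    fix x
    have "Pair x -` ?A = {y. 5 * X - x (m, q) < (\<Sum>r\<in>intervals m j. - 1 * y r)}"
      by (auto simp: sum_negf)
    hence "emeasure lap2 (Pair x -` ?A) \<le> ennreal (exp (- th * (5 * X - x (m, q))) * infl u)"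
      using xi_tail[OF j ne u, of "- 1" "5 * X - x (m, q)"] unfolding th_def by simp
    also have "exp (- th * (5 * X - x (m, q))) * infl u = (exp (- th * (5 * X)) * infl u) * exp (th * x (m, q))"
      by (simp add: exp_add[symmetric] right_diff_distrib mult_ac)
    also have "ennreal \<dots> = ennreal (exp (- th * (5 * X)) * infl u) * (\<Prod>r\<in>{(m, q)}. ennreal (exp (th * x r)))"
      using infl_nonneg[OF u(1,2)] by (subst ennreal_mult) auto
    finally show "emeasure lap2 (Pair x -` ?A) \<le> \<dots>" .
  qed
  also have "\<dots> = ennreal (exp (- th * (5 * X)) * infl u) * (\<integral>\<^sup>+x. (\<Prod>r\<in>{(m, q)}. ennreal (exp (th * x r))) \<partial>lap1)"
    by (rule nn_integral_cmult) measurable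
  also have "(\<integral>\<^sup>+x. (\<Prod>r\<in>{(m, q)}. ennreal (exp (th * x r))) \<partial>lap1) =
     (\<Prod>r\<in>{(m, q)}. \<integral>\<^sup>+x. ennreal (exp (th * x)) \<partial>laplace b1)"
    by (rule nn_integral_PiM_prod) (auto intro: prob_space_laplace scales_pos)
  also have "\<dots> = ennreal (1 / (1 - (u / real Lv)\<^sup>2))"
    using laplace_mgf[OF b12(1), of th] \<theta> \<theta>b uL by (simp only: prod.insert finite.emptyI empty_iff not_False_eq_True prod.empty mult_1_right)
  also have "ennreal (exp (- th * (5 * X)) * infl u) * ennreal (1 / (1 - (u / real Lv)\<^sup>2)) =
     ennreal (exp (- 5 * u * C\<^sup>2 / (4 * real Lv)) * (1 / (1 - (u / real Lv)\<^sup>2)) * infl u)"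
  proof -
    have "- th * (5 * X) = (- 5 * u) * X / b2" unfolding th_def by simp
    also have "\<dots> = - 5 * u * C\<^sup>2 / (4 * real Lv)" by (rule X_div_b2)
    finally have *: "- th * (5 * X) = \<dots>" .
    show ?thesis unfolding * using infl_nonneg[OF u(1,2)] by (subst ennreal_mult'[symmetric]) (auto simp: mult_ac)
  qed
  finally show ?thesis by (simp add: xi_intervals)
qed

lemma emeasure_xi_tail:
  assumes j: "j < hz" and ne: "intervals m j \<noteq> {}" and u: "0 < u" "u \<le> 1" "u = 1 \<Longrightarrow> Lv \<le> 2"
  shows "emeasure TM {w. 7 * X < \<bar>xi hz w m j\<bar>} \<le> ennreal (2 * (exp (- 7 * u * C\<^sup>2 / (4 * real Lv)) * infl u))"
proof -
  let ?B = "ennreal (exp (- 7 * u * C\<^sup>2 / (4 * real Lv)) * infl u)"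
  have e: "- (u / b2) * (7 * X) = - 7 * u * C\<^sup>2 / (4 * real Lv)"
  proof -
    have "- (u / b2) * (7 * X) = (- 7 * u) * X / b2" by simp
    also have "\<dots> = - 7 * u * C\<^sup>2 / (4 * real Lv)" by (rule X_div_b2)
    finally show ?thesis .
  qed
  let ?A = "\<lambda>\<sigma>::real. {y. 7 * X < (\<Sum>q\<in>intervals m j. \<sigma> * y q)}"
  have A: "?A \<sigma> \<in> sets lap2" for \<sigma>
  proof -
    have "{y \<in> space lap2. 7 * X < (\<Sum>q\<in>intervals m j. \<sigma> * y q)} \<in> sets lap2" by measurable
    thus ?thesis by simp
  qed
  have t: "emeasure TM {w. snd (snd w) \<in> ?A \<sigma>} \<le> ?B" if "\<sigma> = 1 \<or> \<sigma> = -1" for \<sigma>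
    unfolding emeasure_TM_lap2[OF A] using xi_tail[OF j ne u that, of "7 * X"] unfolding e .
  have m: "{w. snd (snd w) \<in> ?A \<sigma>} \<in> sets TM" for \<sigma>
  proof -
    have "{w \<in> space TM. 7 * X < \<sigma> * xi hz w m j} \<in> sets TM" by measurable
    thus ?thesis by (simp add: xi_intervals sum_distrib_left)
  qed
  have "{w. 7 * X < \<bar>xi hz w m j\<bar>} = {w. snd (snd w) \<in> ?A 1} \<union> {w. snd (snd w) \<in> ?A (- 1)}"
    by (auto simp: xi_intervals sum_negf)
  hence "emeasure TM {w. 7 * X < \<bar>xi hz w m j\<bar>} \<le> emeasure TM {w. snd (snd w) \<in> ?A 1} + emeasure TM {w. snd (snd w) \<in> ?A (- 1)}"
    using m by (simp only: emeasure_subadditive)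
  also have "\<dots> \<le> ?B + ?B" by (intro add_mono t) auto
  also have "\<dots> = ennreal (2 * (exp (- 7 * u * C\<^sup>2 / (4 * real Lv)) * infl u))"
    using infl_nonneg[OF u(1,2)] by (subst ennreal_plus[symmetric]) auto
  finally show ?thesis .
qed

lemma noise_fail_sets: "{w. noise_fail m q w} \<in> sets TM"
proof -
  have "{w \<in> space TM. noise_fail m q w} \<in> sets TM" by measurable
  thus ?thesis by simp
qed

text \<open>With one level no dyadic interval is used before the last phase, so the prefix noise
  vanishes.\<close>

lemma emeasure_noise_fail_1:
  assumes "Lv = 1" "q \<in> {1..hz}"
  shows "emeasure TM {w. noise_fail m q w} \<le> ennreal (exp (- 5 * C\<^sup>2 / 4) / 2)"
proof -
  have "q - 1 < hz" using assms(2) by auto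
  from card_intervals[OF this, of m] have "intervals m (q - 1) = {}" using assms(1) by simp
  hence "xi hz w m (q - 1) = 0" for w by (simp add: xi_intervals)
  hence "{w. noise_fail m q w} = {w. 5 * X < lapT w m q}"
    using Csk_ge1 by (auto simp: noise_fail_def)
  thus ?thesis using lapT_tail[of 5 m q] by simp
qed

lemma emeasure_noise_fail_2:
  assumes q: "q \<in> {1..hz}" and L: "2 \<le> Lv" and u: "0 < u" "u \<le> 1" "u = 1 \<Longrightarrow> Lv \<le> 2"
  shows "emeasure TM {w. noise_fail m q w} \<le> ennreal (exp (- 5 * C\<^sup>2 / 4) / 2 +
    exp (- 5 * u * C\<^sup>2 / (4 * real Lv)) * (1 / (1 - (u / real Lv)\<^sup>2)) * infl u +
    2 * (exp (- 7 * u * C\<^sup>2 / (4 * real Lv)) * infl u))" (is "_ \<le> ennreal (?a + ?b + ?c)")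
proof -
  let ?j = "q - 1"
  have j: "?j < hz" using q by auto
  have uL: "(u / real Lv)\<^sup>2 \<le> 1"
  proof -
    have "u / real Lv \<le> 1" "0 \<le> u / real Lv" using u L by (auto simp: divide_le_eq)
    thus ?thesis by (simp only: power_le_one)
  qed
  have nn: "0 \<le> ?b" "0 \<le> ?c" using infl_nonneg[OF u(1,2)] uL by auto
  show ?thesis
  proof (cases "intervals m ?j = {}")
    case True
    hence "xi hz w m ?j = 0" for w by (simp add: xi_intervals)
    hence "{w. noise_fail m q w} = {w. 5 * X < lapT w m q}"
      using Csk_ge1 by (auto simp: noise_fail_def)
    hence "emeasure TM {w. noise_fail m q w} \<le> ennreal ?a" using lapT_tail[of 5 m q] by simp
    also have "\<dots> \<le> ennreal (?a + ?b + ?c)" using nn by (intro ennreal_leI) linarith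
    finally show ?thesis .
  next
    case False
    let ?A = "{w. 5 * X < lapT w m q}" and ?B = "{w. 5 * X < lapT w m q - xi hz w m ?j}"
    let ?D = "{w. 7 * X < \<bar>xi hz w m ?j\<bar>}"
    have "{w \<in> space TM. 5 * X < lapT w m q} \<in> sets TM"
      "{w \<in> space TM. 5 * X < lapT w m q - xi hz w m ?j} \<in> sets TM"
      "{w \<in> space TM. 7 * X < \<bar>xi hz w m ?j\<bar>} \<in> sets TM"
      by measurable
    hence m: "?A \<in> sets TM" "?B \<in> sets TM" "?D \<in> sets TM" by simp_all
    have "{w. noise_fail m q w} = ?A \<union> ?B \<union> ?D" by (auto simp: noise_fail_def)
    hence "emeasure TM {w. noise_fail m q w} \<le> emeasure TM (?A \<union> ?B) + emeasure TM ?D"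
      using emeasure_subadditive[of "?A \<union> ?B" TM ?D] m by simp
    also have "\<dots> \<le> (emeasure TM ?A + emeasure TM ?B) + emeasure TM ?D"
      by (intro add_mono emeasure_subadditive m order_refl)
    also have "\<dots> \<le> (ennreal ?a + ennreal ?b) + ennreal ?c"
      using lapT_tail[of 5 m q] emeasure_diff_tail[OF j False u L, of q] emeasure_xi_tail[OF j False u]
      by (intro add_mono) auto
    also have "\<dots> = ennreal (?a + ?b + ?c)"
      using nn by (subst ennreal_plus[symmetric], simp, simp, subst ennreal_plus[symmetric]) auto
    finally show ?thesis .
  qed
qed

subsection \<open>Most rounds are long\<close>

lemma long_round_meas [measurable]: "Measurable.pred TM (\<lambda>w. long_round w m)"
  unfolding long_round_def that_def by measurable

text \<open>Markov's inequality for a product over the independent threshold noises of all rounds in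
  \<open>A\<close>. In the applications \<open>f\<close> is an indicator or an exponential.\<close>

lemma short_rounds_prod:
  fixes f :: "real \<Rightarrow> ennreal"
  assumes fm: "f \<in> borel_measurable borel" and A: "finite A"
    and le: "\<And>w m. \<not> long_round w m \<Longrightarrow> 1 \<le> c * (\<Prod>q\<in>{1..hz}. f (lapT w m q))"
  shows "emeasure TM {w. \<forall>m\<in>A. \<not> long_round w m} \<le> (c * (\<integral>\<^sup>+x. f x \<partial>laplace b1) ^ hz) ^ card A"
proof -
  let ?E = "{w. \<forall>m\<in>A. \<not> long_round w m}"
  interpret H: prob_space thr_measure by (rule prob_space_thr_measure)
  interpret B: prob_space "lap1 \<Otimes>\<^sub>M lap2" by (rule prob_space_lap)
  interpret L2: prob_space lap2 by (rule prob_lap)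
  note [measurable] = fm
  have "{w \<in> space TM. \<forall>m\<in>A. \<not> long_round w m} \<in> sets TM"
    using A by measurable
  hence E: "?E \<in> sets TM" by simp
  let ?g = "\<lambda>x :: nat \<times> nat \<Rightarrow> real. \<Prod>p\<in>A \<times> {1..hz}. f (x p)"
  have "emeasure TM ?E = (\<integral>\<^sup>+w. indicator ?E w \<partial>TM)" by (rule nn_integral_indicator[OF E, symmetric])
  also have "\<dots> \<le> (\<integral>\<^sup>+w. c ^ card A * ?g (fst (snd w)) \<partial>TM)"
  proof (intro nn_integral_mono)
    fix w
    show "indicator ?E w \<le> c ^ card A * ?g (fst (snd w))"
    proof (cases "w \<in> ?E")
      case True
      have "1 \<le> (\<Prod>m\<in>A. c * (\<Prod>q\<in>{1..hz}. f (lapT w m q)))"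
        using True by (intro one_le_prod_ennreal le) auto
      also have "\<dots> = c ^ card A * (\<Prod>m\<in>A. \<Prod>q\<in>{1..hz}. f (lapT w m q))" by (simp add: prod.distrib)
      also have "(\<Prod>m\<in>A. \<Prod>q\<in>{1..hz}. f (lapT w m q)) = ?g (fst (snd w))"
        by (subst prod.cartesian_product) (rule prod.cong, auto)
      finally show ?thesis using True by simp
    qed simp
  qed
  also have "\<dots> = (\<integral>\<^sup>+h. (\<integral>\<^sup>+v. c ^ card A * ?g (fst v) \<partial>(lap1 \<Otimes>\<^sub>M lap2)) \<partial>thr_measure)"
    unfolding tape_measure_eq by (subst B.nn_integral_fst[symmetric]) simp_all
  also have "\<dots> = (\<integral>\<^sup>+v. c ^ card A * ?g (fst v) \<partial>(lap1 \<Otimes>\<^sub>M lap2))"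
    by (simp only: nn_integral_const H.emeasure_space_1 mult_1_right)
  also have "\<dots> = (\<integral>\<^sup>+x. (\<integral>\<^sup>+y. c ^ card A * ?g x \<partial>lap2) \<partial>lap1)"
    by (subst L2.nn_integral_fst[symmetric]) simp_all
  also have "\<dots> = (\<integral>\<^sup>+x. c ^ card A * ?g x \<partial>lap1)"
    by (simp only: nn_integral_const L2.emeasure_space_1 mult_1_right)
  also have "\<dots> = c ^ card A * (\<integral>\<^sup>+x. ?g x \<partial>lap1)"
    by (rule nn_integral_cmult) measurable
  also have "(\<integral>\<^sup>+x. ?g x \<partial>lap1) = (\<Prod>p\<in>A \<times> {1..hz}. \<integral>\<^sup>+x. f x \<partial>laplace b1)"
    by (rule nn_integral_PiM_prod) (use A in \<open>auto intro: prob_space_laplace scales_pos\<close>)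
  also have "c ^ card A * \<dots> = (c * (\<integral>\<^sup>+x. f x \<partial>laplace b1) ^ hz) ^ card A"
    by (simp add: card_cartesian_product power_mult_distrib power_mult[symmetric] mult.commute)
  finally show ?thesis .
qed

text \<open>Fewer than \<open>g\<close> long rounds among \<open>2 * g\<close> leave
  \<open>g\<close> short ones, and there are at most \<open>4 ^ g\<close> ways to choose these.
  Fixing the set beforehand avoids any reference to which rounds are actually played.\<close>

lemma few_long_rounds:
  assumes \<rho>: "\<And>A. finite A \<Longrightarrow> emeasure TM {w. \<forall>m\<in>A. \<not> long_round w m} \<le> ennreal \<rho> ^ card A" "0 \<le> \<rho>"
  shows "emeasure TM {w. card {m. m < 2 * g \<and> long_round w m} < g} \<le> ennreal ((4 * \<rho>) ^ g)"
proof -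
  let ?P = "{A. A \<subseteq> {..<2 * g} \<and> card A = g}"
  have fin: "finite ?P" by (rule finite_subset[of _ "Pow {..<2 * g}"]) auto
  have finP: "finite A" if "A \<in> ?P" for A
    using that finite_subset[of A "{..<2 * g}"] by simp
  have E: "{w. \<forall>m\<in>A. \<not> long_round w m} \<in> sets TM" if "finite A" for A
  proof -
    have "{w \<in> space TM. \<forall>m\<in>A. \<not> long_round w m} \<in> sets TM" using that by measurable
    thus ?thesis by simp
  qed
  have "{w. card {m. m < 2 * g \<and> long_round w m} < g} \<subseteq> (\<Union>A\<in>?P. {w. \<forall>m\<in>A. \<not> long_round w m})"
  proof
    fix w assume "w \<in> {w. card {m. m < 2 * g \<and> long_round w m} < g}"
    hence lt: "card {m. m < 2 * g \<and> long_round w m} < g" by simp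
    let ?S = "{..<2 * g} - {m. m < 2 * g \<and> long_round w m}"
    have "card ?S = 2 * g - card {m. m < 2 * g \<and> long_round w m}"
      by (subst card_Diff_subset) auto
    hence "g \<le> card ?S" using lt by simp
    then obtain A where "A \<subseteq> ?S" "card A = g" by (rule obtain_subset_with_card_n)
    thus "w \<in> (\<Union>A\<in>?P. {w. \<forall>m\<in>A. \<not> long_round w m})" by (intro UN_I[of A]) auto
  qed
  hence "emeasure TM {w. card {m. m < 2 * g \<and> long_round w m} < g} \<le>
      emeasure TM (\<Union>A\<in>?P. {w. \<forall>m\<in>A. \<not> long_round w m})"
    by (rule emeasure_mono, intro sets.finite_UN fin E finP)
  also have "\<dots> \<le> (\<Sum>A\<in>?P. emeasure TM {w. \<forall>m\<in>A. \<not> long_round w m})"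
    by (rule emeasure_subadditive_finite[OF fin]) (intro image_subsetI E finP)
  also have "\<dots> \<le> (\<Sum>A\<in>?P. ennreal \<rho> ^ g)"
  proof (intro sum_mono)
    fix A assume A: "A \<in> ?P"
    from \<rho>(1)[OF finP[OF A]] A show "emeasure TM {w. \<forall>m\<in>A. \<not> long_round w m} \<le> ennreal \<rho> ^ g" by simp
  qed
  also have "\<dots> = ennreal (real (card ?P) * \<rho> ^ g)"
    using \<rho>(2) by (simp add: ennreal_power ennreal_mult ennreal_of_nat_eq_real_of_nat)
  also have "\<dots> \<le> ennreal ((4 * \<rho>) ^ g)"
  proof (rule ennreal_leI)
    have "card ?P \<le> card (Pow {..<2 * g})" by (rule card_mono) auto
    also have "\<dots> = 4 ^ g" by (simp add: card_Pow power_mult)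
    finally have "real (card ?P) \<le> real (4 ^ g)" by (rule of_nat_mono)
    hence "real (card ?P) \<le> 4 ^ g" by simp
    thus "real (card ?P) * \<rho> ^ g \<le> (4 * \<rho>) ^ g"
      unfolding power_mult_distrib using \<rho>(2) by (intro mult_right_mono) auto
  qed
  finally show ?thesis .
qed

text \<open>With a single phase, a short round means that one Laplace variable is below
  \<open>- (2 * sk * (C - sk))\<close>. The factor 1/2 of the exact tail is kept; it turns the 4 of
  \<open>few_long_rounds\<close> into 2.\<close>

lemma short_rounds_1:
  assumes h: "hz = 1" and C: "sk \<le> C"
  shows "emeasure TM {w. card {m. m < 2 * g \<and> long_round w m} < g} \<le>
    ennreal ((2 * exp (- (C * (C - sk) / 2))) ^ g)"
proof -
  let ?s = "2 * sk * (C - sk)"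
  let ?f = "indicator {..< - ?s} :: real \<Rightarrow> ennreal"
  have s0: "0 \<le> ?s" using C sk_ge1 by simp
  have int: "(\<integral>\<^sup>+x. ?f x \<partial>laplace b1) \<le> ennreal (exp (- (C * (C - sk) / 2)) / 2)"
  proof -
    have "(\<integral>\<^sup>+x. ?f x \<partial>laplace b1) = (\<integral>\<^sup>+x. ?f (- x) \<partial>laplace b1)"
      by (rule nn_integral_laplace_minus[symmetric]) simp
    also have "\<dots> = (\<integral>\<^sup>+x. indicator {?s<..} x \<partial>laplace b1)"
      by (intro nn_integral_cong) (auto simp: indicator_def)
    also have "\<dots> = emeasure (laplace b1) {?s<..}" by simp
    also have "\<dots> \<le> ennreal (exp (- ?s / b1) / 2)" by (rule laplace_tail[OF scales_pos(1) s0])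
    also have "- ?s / b1 = - (C * (C - sk) / 2)"
      using sk_ge1 by (simp add: priv_def field_simps)
    finally show ?thesis .
  qed
  have "emeasure TM {w. \<forall>m\<in>A. \<not> long_round w m} \<le> ennreal (exp (- (C * (C - sk) / 2)) / 2) ^ card A"
    if "finite A" for A
  proof -
    have "emeasure TM {w. \<forall>m\<in>A. \<not> long_round w m} \<le> (1 * (\<integral>\<^sup>+x. ?f x \<partial>laplace b1) ^ hz) ^ card A"
    proof (rule short_rounds_prod[OF _ that])
      fix w m assume "\<not> long_round w m"
      hence "that w m 1 < 2 * real k" by (simp add: long_round_def h)
      moreover have "- ?s = 2 * (sk * sk) - 2 * C * sk"
        by (simp only: right_diff_distrib minus_diff_eq mult_ac)
      hence "- ?s = 2 * real k - 2 * C * sk" by (simp only: sk_sq)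
      ultimately have "lapT w m 1 < - ?s" by (simp only: that_def; linarith)
      thus "1 \<le> 1 * (\<Prod>q\<in>{1..hz}. ?f (lapT w m q))" by (simp add: h)
    qed simp
    also have "\<dots> \<le> ennreal (exp (- (C * (C - sk) / 2)) / 2) ^ card A"
      unfolding h using int by (intro power_mono) auto
    finally show ?thesis .
  qed
  from few_long_rounds[OF this] show ?thesis by simp
qed

text \<open>A Chernoff bound at half the critical rate, where each phase contributes the factor 1/(1
  - 1/4) = 4/3.\<close>

lemma short_rounds_2:
  shows "emeasure TM {w. card {m. m < 2 * g \<and> long_round w m} < g} \<le>
    ennreal ((4 * (exp (- ((C\<^sup>2 * real hz - C * sk) / 4)) * (4 / 3) ^ hz)) ^ g)"
proof -
  let ?\<theta> = "1 / (2 * b1)"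
  let ?f = "\<lambda>x. ennreal (exp (- ?\<theta> * x))"
  let ?s = "2 * C * sk * real hz - 2 * real k"
  have b1: "0 < b1" by (rule scales_pos)
  have int: "(\<integral>\<^sup>+x. ?f x \<partial>laplace b1) = ennreal (4 / 3)"
  proof -
    have "\<bar>- ?\<theta>\<bar> * b1 < 1" using b1 eps_pos by simp
    from laplace_mgf[OF b1 this] have "(\<integral>\<^sup>+x. ?f x \<partial>laplace b1) = ennreal (1 / (1 - (- ?\<theta> * b1)\<^sup>2))" .
    moreover have "- ?\<theta> * b1 = - (1 / 2)" using eps_pos by simp
    ultimately show ?thesis using eps_pos by (simp add: power2_eq_square)
  qed
  have ex: "?\<theta> * ?s = (C\<^sup>2 * real hz - C * sk) / 4"
  proof -
    have "?\<theta> * ?s = C / sk * (2 * C * sk * real hz - 2 * (sk * sk)) / 8" by (simp add: priv_def)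
    also have "\<dots> = (C\<^sup>2 * real hz - C * sk) / 4" using sk_ge1 by (simp add: power2_eq_square field_simps)
    finally show ?thesis .
  qed
  have "emeasure TM {w. \<forall>m\<in>A. \<not> long_round w m} \<le>
      ennreal (exp (- ((C\<^sup>2 * real hz - C * sk) / 4)) * (4 / 3) ^ hz) ^ card A"
    if "finite A" for A
  proof -
    have "emeasure TM {w. \<forall>m\<in>A. \<not> long_round w m} \<le>
        (ennreal (exp (- (?\<theta> * ?s))) * (\<integral>\<^sup>+x. ?f x \<partial>laplace b1) ^ hz) ^ card A"
    proof (rule short_rounds_prod[OF _ that])
      fix w m assume "\<not> long_round w m"
      hence "(\<Sum>q\<in>{1..hz}. that w m q) < 2 * real k" by (simp add: long_round_def)
      hence "(\<Sum>q\<in>{1..hz}. lapT w m q) < - ?s" by (simp add: that_def sum.distrib algebra_simps)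
      hence "?\<theta> * (\<Sum>q\<in>{1..hz}. lapT w m q) \<le> ?\<theta> * (- ?s)"
        using eps_pos by (intro mult_left_mono) auto
      hence "?\<theta> * (\<Sum>q\<in>{1..hz}. lapT w m q) \<le> - (?\<theta> * ?s)" by (simp only: mult_minus_right)
      hence "0 \<le> - (?\<theta> * ?s) + - ?\<theta> * (\<Sum>q\<in>{1..hz}. lapT w m q)"
        by (simp only: mult_minus_left; linarith)
      hence le: "1 \<le> exp (- (?\<theta> * ?s) + - ?\<theta> * (\<Sum>q\<in>{1..hz}. lapT w m q))"
        by (simp only: one_le_exp_iff)
      have "(\<Prod>q\<in>{1..hz}. ?f (lapT w m q)) = ennreal (exp (- ?\<theta> * (\<Sum>q\<in>{1..hz}. lapT w m q)))"
        by (subst prod_ennreal) (simp_all add: exp_sum[symmetric] sum_distrib_left)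
      hence "ennreal (exp (- (?\<theta> * ?s))) * (\<Prod>q\<in>{1..hz}. ?f (lapT w m q)) =
         ennreal (exp (- (?\<theta> * ?s) + - ?\<theta> * (\<Sum>q\<in>{1..hz}. lapT w m q)))"
        by (simp only: exp_add) (simp add: ennreal_mult')
      thus "1 \<le> ennreal (exp (- (?\<theta> * ?s))) * (\<Prod>q\<in>{1..hz}. ?f (lapT w m q))"
        using le by (simp only: ennreal_1[symmetric] ennreal_leI)
    qed measurable
    also have "\<dots> = ennreal (exp (- ((C\<^sup>2 * real hz - C * sk) / 4)) * (4 / 3) ^ hz) ^ card A"
    proof -
      have "ennreal (4 / 3) ^ hz = ennreal ((4 / 3) ^ hz)" by (rule ennreal_power) simp
      hence "ennreal (exp v) * ennreal (4 / 3) ^ hz = ennreal (exp v * (4 / 3) ^ hz)" for v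
        by (simp only: ennreal_mult'[OF exp_ge_zero])
      thus ?thesis unfolding int ex by (simp only:)
    qed
    finally show ?thesis .
  qed
  from few_long_rounds[OF this] show ?thesis by simp
qed

end

subsection \<open>Estimates for the parameters\<close>

lemma exp_ge_power: "(1 + x / real n) ^ n \<le> exp x" if "0 \<le> x" "1 \<le> n" for x :: real
proof -
  have "(1 + x / real n) ^ n \<le> exp (x / real n) ^ n"
    using that by (intro power_mono exp_ge_add_one_self) auto
  also have "\<dots> = exp x" using that by (simp add: exp_of_nat_mult[symmetric])
  finally show ?thesis .
qed

text \<open>The values that occur in \<open>noise_budget\<close> and \<open>deviates_budget\<close>.
  The fraction 100/19 is \<open>1 / (1 - (9/10)^2)\<close>.\<close>

lemma exp_numeric_bounds: "27 \<le> exp (17/5 :: real)" "100/19 \<le> exp (17/10 :: real)" "3 \<le> exp (19/10 :: real)"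
  "11 \<le> exp (266/100 :: real)" "100 \<le> exp (6 :: real)" "24 \<le> exp (44/10 :: real)"
proof -
  show "27 \<le> exp (17/5 :: real)"
    by (rule order_trans[OF _ exp_ge_power[of _ 64]]) (auto simp: power_divide)
  show "100/19 \<le> exp (17/10 :: real)"
    by (rule order_trans[OF _ exp_ge_power[of _ 64]]) (auto simp: power_divide)
  show "3 \<le> exp (19/10 :: real)"
    by (rule order_trans[OF _ exp_ge_power[of _ 8]]) (auto simp: power_divide)
  show "11 \<le> exp (266/100 :: real)"
    by (rule order_trans[OF _ exp_ge_power[of _ 16]]) (auto simp: power_divide)
  show "100 \<le> exp (6 :: real)"
    by (rule order_trans[OF _ exp_ge_power[of _ 16]]) (auto simp: power_divide)
  show "24 \<le> exp (44/10 :: real)"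
    by (rule order_trans[OF _ exp_ge_power[of _ 16]]) (auto simp: power_divide)
qed

lemma powr_three_halves:
  fixes x :: real
  assumes "0 \<le> x" shows "x powr (3/2) = x * sqrt x"
proof (cases "x = 0")
  case False
  hence "x powr (3/2) = x powr (1 + 1/2)" by simp
  also have "\<dots> = x * sqrt x" using False assms by (simp only: powr_add powr_half_sqrt) simp
  finally show ?thesis .
qed simp

lemma powr_three_halves_ge:
  fixes x c r :: real
  assumes "c \<le> x" "0 \<le> r" "r\<^sup>2 \<le> c" shows "x * r \<le> x powr (3/2)"
proof -
  have x: "0 \<le> x" using assms by (smt (verit) zero_le_power2)
  have "r \<le> sqrt x" using assms by (intro real_le_rsqrt) simp
  thus ?thesis unfolding powr_three_halves[OF x] using x by (intro mult_left_mono)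
qed

lemma two_powr_eq_exp: "2 powr x = exp (x * ln (2::real))"
  by (simp add: powr_def)

lemma le_two_powr_half: "t \<le> 2 powr (t / 2)" if "4 \<le> t" for t :: real
proof -
  have "2 powr (t / 2) = 2 powr 2 * 2 powr ((t - 4) / 2)"
    by (subst powr_add[symmetric]) (simp add: field_simps)
  also have "2 powr 2 = (4 :: real)" by simp
  also have "2 powr ((t - 4) / 2) = exp ((t - 4) / 2 * ln 2)" by (rule two_powr_eq_exp)
  finally have e: "2 powr (t / 2) = 4 * exp ((t - 4) / 2 * ln 2)" .
  have "(t - 4) / 2 * (2 / 3) \<le> (t - 4) / 2 * ln 2"
    using that ln2_ge_two_thirds by (intro mult_left_mono) auto
  moreover have "1 + (t - 4) / 2 * ln 2 \<le> exp ((t - 4) / 2 * ln 2)" by (rule exp_ge_add_one_self)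
  ultimately show ?thesis unfolding e using that by argo
qed

text \<open>For \<open>l = log 2 sk\<close> the right-hand side is \<open>k\<close>; this is how the
  polylogarithmic factor of \<open>C\<close> is absorbed in \<open>C_le\<close>.\<close>

lemma three_halves_le_four_powr: "l powr (3/2) + 1 \<le> 2 powr (2 * l)" if "0 \<le> l" for l :: real
proof -
  have "sqrt l \<le> (1 + l) / 2"
    using that arith_geo_mean_sqrt[of 1 l] by simp
  hence "l * sqrt l \<le> l * ((1 + l) / 2)" using that by (intro mult_left_mono)
  hence "l powr (3/2) \<le> (l + l\<^sup>2) / 2" unfolding powr_three_halves[OF that] by (simp add: power2_eq_square algebra_simps)
  moreover have "1 + 2 * l * ln 2 + (2 * l * ln 2)\<^sup>2 / 2 \<le> exp (2 * l * ln 2)"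
    using that by (intro exp_lower_Taylor_quadratic) simp
  moreover have "2 * l * (2 / 3) \<le> 2 * l * ln 2"
    using that ln2_ge_two_thirds by (intro mult_left_mono) auto
  moreover have "(2 * l * (2 / 3))\<^sup>2 \<le> (2 * l * ln 2)\<^sup>2"
    using that ln2_ge_two_thirds by (intro power_mono mult_left_mono) auto
  moreover have "(2 * l * (2 / 3))\<^sup>2 = 16 / 9 * l\<^sup>2" by (simp add: power2_eq_square)
  ultimately show ?thesis unfolding two_powr_eq_exp using that zero_le_power2[of l] by argo
qed

text \<open>The hypothesis \<open>big\<close> is the case in which a round may occur at all;
  otherwise every item is forwarded and \<open>ok_small\<close> applies.\<close>

locale budget = tracking_full +
  fixes \<delta> :: real
  assumes \<alpha>_less: "\<alpha> < 1" and \<delta>: "0 < \<delta>" "\<delta> < 1" and N2: "2 \<le> N"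
    and C_eq: "C = C_param k \<alpha> \<delta> N" and big: "8 * C * sqrt (real k) \<le> \<alpha> * real N"
begin

definition "lk = log 2 sk"
definition "wk = lk powr (3/2) + 1"
definition "lN = log 2 (real N)"
definition "Q = 8 * sk * lN / (\<alpha> * \<delta>)"
definition "tQ = log 2 Q"

lemma lk0: "0 \<le> lk" using sk_ge1 by (simp add: lk_def)
lemma wk1: "1 \<le> wk" by (simp add: wk_def)
lemma lN1: "1 \<le> lN" using N2 by (simp add: lN_def)

lemma sk_le_inv: "sk \<le> 1 / \<alpha>"
  using \<alpha>_sk \<alpha>_pos by (simp add: pos_le_divide_eq mult.commute)

lemma Q_ge: "8 * real k * lN / \<delta> \<le> Q"
proof -
  have "sk * (8 * sk * lN / \<delta>) \<le> 1 / \<alpha> * (8 * sk * lN / \<delta>)"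
    using sk_le_inv \<delta> lN1 sk_ge1 by (intro mult_right_mono) auto
  also have "\<dots> = Q" by (simp add: Q_def)
  also have "sk * (8 * sk * lN / \<delta>) = 8 * (sk * sk) * lN / \<delta>" by (simp only: mult_ac times_divide_eq_right)
  finally show ?thesis by (simp only: sk_sq)
qed

lemma Q_ge': "c \<le> lN \<Longrightarrow> 0 \<le> c \<Longrightarrow> 8 * c * real k \<le> Q"
proof -
  assume c: "c \<le> lN" "0 \<le> c"
  have "8 * c * real k \<le> 8 * real k * lN" using mult_right_mono[OF c(1), of "real k"] by (simp add: mult_ac)
  also have "\<dots> \<le> 8 * real k * lN / \<delta>"
    unfolding pos_le_divide_eq[OF \<delta>(1)] by (rule mult_left_le) (use \<delta> lN1 in auto)
  also have "\<dots> \<le> Q" by (rule Q_ge)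
  finally show ?thesis .
qed

lemma k1: "1 \<le> real k" using k_pos by simp

lemma Q8: "8 \<le> Q" using Q_ge'[of 1] lN1 k1 by linarith

lemma Cs: "C\<^sup>2 = wk * tQ"
proof -
  have "0 \<le> tQ" using Q8 by (simp add: tQ_def)
  hence "0 \<le> wk * tQ" using wk1 by (intro mult_nonneg_nonneg) auto
  moreover have "C = sqrt (wk * tQ)"
    unfolding C_eq C_param_def wk_def lk_def tQ_def Q_def lN_def ..
  ultimately show ?thesis by simp
qed

lemma log2_ge: "0 < x \<Longrightarrow> 2 ^ p \<le> x ^ q \<Longrightarrow> 1 \<le> q \<Longrightarrow> real p / real q \<le> log 2 x"
proof -
  assume x: "0 < x" "2 ^ p \<le> x ^ q" "1 \<le> q"
  have "(0::real) < 2 ^ p" by simp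
  have "log 2 (2 ^ p) \<le> log 2 (x ^ q)"
    by (rule log_mono[OF _ \<open>0 < 2 ^ p\<close> x(2)]) simp
  moreover have "log 2 (2 ^ p) = real p * log 2 2" by (rule log_nat_power) simp
  moreover have "log 2 (x ^ q) = real q * log 2 x" by (rule log_nat_power[OF less_imp_le[OF x(1)]])
  ultimately have "real p \<le> log 2 x * real q" by (simp add: mult.commute)
  thus ?thesis using x(3) by (subst pos_divide_le_eq) simp_all
qed

lemma tQ_le_Cs: "tQ \<le> C\<^sup>2"
proof -
  have "0 \<le> tQ" using Q8 by (simp add: tQ_def)
  hence "1 * tQ \<le> wk * tQ" by (rule mult_right_mono[OF wk1])
  thus ?thesis by (simp add: Cs)
qed

lemma N_ge: "8 * C \<le> real N"
proof -
  have "8 * C * 1 \<le> 8 * C * sk" using C_ge1 sk_ge1 by (intro mult_left_mono) auto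
  also have "\<dots> \<le> \<alpha> * real N" by (rule big)
  also have "\<dots> \<le> 1 * real N" using \<alpha>_less by (intro mult_right_mono) auto
  finally show ?thesis by simp
qed

lemma C_sq_less: "0 \<le> c \<Longrightarrow> c\<^sup>2 \<le> C\<^sup>2 \<Longrightarrow> c \<le> C"
  using C_ge1 by (elim power2_le_imp_le) simp

lemma tQ_ge_log: "0 < x \<Longrightarrow> x \<le> Q \<Longrightarrow> log 2 x \<le> tQ"
  unfolding tQ_def by (subst log_le_cancel_iff) auto

text \<open>A bootstrap: \<open>big\<close> forces \<open>N\<close> to be at least
  \<open>8 * C\<close>, a larger \<open>N\<close> enlarges \<open>Q\<close> and with it
  \<open>C\<close>, and this enlarges \<open>N\<close> again. Two passes suffice.\<close>

lemma lN4: "4 \<le> lN"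
proof -
  have "3 \<le> log 2 (8 :: real)" using log2_ge[of 8 3 1] by simp
  hence "3 \<le> tQ" using tQ_ge_log[of 8] Q8 by linarith
  hence "3 \<le> C\<^sup>2" using tQ_le_Cs by linarith
  hence "17/10 \<le> C" by - (rule C_sq_less, simp, simp add: power_divide)
  hence "136/10 \<le> real N" using N_ge by linarith
  hence "log 2 (136/10) \<le> lN" unfolding lN_def by (subst log_le_cancel_iff) auto
  moreover have "15/4 \<le> log 2 (136/10 :: real)" using log2_ge[of "136/10" 15 4] by (simp add: power_divide)
  ultimately have l1: "15/4 \<le> lN" by linarith
  have "30 \<le> Q" using Q_ge'[OF l1] k1 by linarith
  moreover have "49/10 \<le> log 2 (30 :: real)" using log2_ge[of 30 49 10] by simp
  ultimately have "49/10 \<le> tQ" using tQ_ge_log[of 30] by linarith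
  hence "49/10 \<le> C\<^sup>2" using tQ_le_Cs by linarith
  hence "22/10 \<le> C" by - (rule C_sq_less, simp, simp add: power_divide)
  hence "16 \<le> real N" using N_ge by linarith
  hence "log 2 16 \<le> lN" unfolding lN_def by (subst log_le_cancel_iff) auto
  moreover have "4 \<le> log 2 (16 :: real)" using log2_ge[of 16 4 1] by simp
  ultimately show ?thesis by linarith
qed

lemma Q32: "32 * real k / \<delta> \<le> Q"
proof -
  have "8 * real k * 4 / \<delta> \<le> 8 * real k * lN / \<delta>"
    using lN4 \<delta> by (intro divide_right_mono mult_left_mono) auto
  thus ?thesis using Q_ge by simp
qed

lemma log_k: "log 2 (real k) = 2 * lk"
proof -
  have "log 2 (sk * sk) = 2 * lk" using sk_ge1 by (subst log_mult) (auto simp: lk_def)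
  thus ?thesis by (simp only: sk_sq)
qed

lemma tQ_lk: "5 + 2 * lk \<le> tQ"
proof -
  have "log 2 (32 * real k) \<le> tQ" using Q_ge'[OF lN4] k1 by (intro tQ_ge_log) auto
  moreover have "log 2 (32 * real k) = log 2 32 + log 2 (real k)" using k1 by (subst log_mult) auto
  moreover have "5 \<le> log 2 (32 :: real)" using log2_ge[of 32 5 1] by simp
  ultimately show ?thesis by (simp add: log_k)
qed

lemma tQ5: "5 \<le> tQ" using tQ_lk lk0 by linarith
lemma Cs5: "5 \<le> C\<^sup>2" using tQ5 tQ_le_Cs by linarith
lemma C22: "223/100 \<le> C" using Cs5 by - (rule C_sq_less, simp, simp add: power_divide)

lemma Q_exp: "Q = exp (tQ * ln 2)"
proof -
  have "Q = 2 powr tQ" using Q8 by (simp add: tQ_def)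
  thus ?thesis by (simp only: two_powr_eq_exp)
qed

text \<open>In \<open>C\<^sup>2 = wk * tQ\<close> the first factor is at most \<open>k\<close> and
  the second at most \<open>2 powr (tQ / 2)\<close>. It is needed because the number of rounds
  itself contains \<open>C\<close>, whereas failure probabilities are measured in powers of
  \<open>Q\<close>.\<close>

lemma C_le: "C / sk \<le> 2 powr (tQ / 4)"
proof -
  have "2 powr (2 * lk) = (2 powr lk)\<^sup>2" by (simp add: power2_eq_square powr_add[symmetric])
  also have "2 powr lk = sk" using sk_ge1 by (simp add: lk_def)
  finally have "wk \<le> sk\<^sup>2" using three_halves_le_four_powr[OF lk0] by (simp add: wk_def)
  moreover have "tQ \<le> 2 powr (tQ / 2)" using tQ5 by (intro le_two_powr_half) simp
  moreover have "2 powr (tQ / 2) = (2 powr (tQ / 4))\<^sup>2"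
    by (simp add: power2_eq_square powr_add[symmetric])
  ultimately have "C\<^sup>2 \<le> sk\<^sup>2 * (2 powr (tQ / 4))\<^sup>2"
    unfolding Cs using wk1 tQ5 by (intro mult_mono) auto
  also have "\<dots> = (sk * 2 powr (tQ / 4))\<^sup>2" by (simp only: power_mult_distrib)
  finally have "C \<le> sk * 2 powr (tQ / 4)"
    by (rule power2_le_imp_le) (use sk_ge1 in simp)
  thus ?thesis using sk_ge1 by (subst pos_divide_le_eq) (auto simp: mult.commute)
qed

section \<open>Number of rounds and phases\<close>

definition "Y = C * lN / (\<alpha> * sk)"
text \<open>The number of long rounds needed to reach \<open>N\<close>. Dividing \<open>ln N\<close>
  by \<open>growth\<close> gives 16 ln 2 times \<open>Y\<close>, about 11.1; the rest of 11.45
  absorbs the rational bound for ln 2 and the loss from replacing \<open>ln (1 + growth)\<close> by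
  \<open>growth\<close>.\<close>

definition "g = nat \<lfloor>1145/100 * Y\<rfloor> + 1"

lemma Y_ge: "88/10 \<le> Y"
proof -
  have "22/10 * 4 \<le> C * lN" using C22 lN4 C_ge1 by (intro mult_mono) auto
  also have "\<dots> \<le> C * lN / (\<alpha> * sk)"
  proof -
    have p: "0 < \<alpha> * sk" using \<alpha>_pos sk_ge1 by (intro mult_pos_pos) auto
    show ?thesis
      unfolding pos_le_divide_eq[OF p] by (rule mult_left_le[OF \<alpha>_sk]) (use C_ge1 lN1 in auto)
  qed
  finally show ?thesis by (simp add: Y_def)
qed

lemma g_bounds: "1145/100 * Y < real g" "2 * real g \<le> 24 * Y" "100 \<le> g"
proof -
  have "real g = real_of_int \<lfloor>1145/100 * Y\<rfloor> + 1" using Y_ge by (simp add: g_def)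
  thus lo: "1145/100 * Y < real g" and "2 * real g \<le> 24 * Y" using Y_ge by linarith+
  show "100 \<le> g" using lo Y_ge by linarith
qed

lemma growth_pow: "real N < (1 + growth) ^ g"
proof -
  have C0: "0 < C" using C_ge1 by simp
  have gr: "0 < growth" using \<alpha>_pos sk_ge1 C0 by (intro divide_pos_pos mult_pos_pos) auto
  \<comment> \<open>As \<open>C\<close> is at least 22/10, growth stays below 10/352, so the
    logarithm keeps at least 342/352 of it.\<close>
  have "growth \<le> 1 / (16 * C)" using \<alpha>_sk C0 by (intro divide_right_mono) auto
  also have "\<dots> \<le> 1 / (352/10)" using C22 by (intro divide_left_mono) auto
  finally have gr2: "growth \<le> 10/352" by simp
  have "growth * (1 - growth) = growth - growth\<^sup>2" by (simp add: power2_eq_square algebra_simps)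
  also have "\<dots> \<le> ln (1 + growth)" using gr gr2 by (intro ln_one_plus_pos_lower_bound) auto
  finally have ln1: "growth * (1 - growth) \<le> ln (1 + growth)" .
  have "growth * (342/352) \<le> growth * (1 - growth)" using gr gr2 by (intro mult_left_mono) auto
  hence ln2: "growth * (342/352) \<le> ln (1 + growth)" using ln1 by linarith
  have Yg: "Y * growth = lN / 16"
    using \<alpha>_pos sk_ge1 C0 by (simp add: Y_def)
  have "ln (real N) = lN * ln 2" using N2 by (simp add: lN_def log_def)
  also have "\<dots> \<le> lN * (25/36)" using lN1 ln2_le_25_over_36 by (intro mult_left_mono) auto
  also have "\<dots> < 1145/100 * (lN / 16) * (342/352)" using lN1 by simp
  also have "\<dots> = 1145/100 * Y * (growth * (342/352))" unfolding Yg[symmetric] by simp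
  also have "\<dots> \<le> real g * ln (1 + growth)"
    using g_bounds(1) ln2 gr Y_ge by (intro mult_mono) auto
  also have "\<dots> = ln ((1 + growth) ^ g)" using gr by (simp add: ln_realpow)
  finally show ?thesis using N2 gr by (subst (asm) ln_less_cancel_iff) auto
qed

text \<open>The number of pairs of a round and a phase in the union bound. Since \<open>Q\<close>
  has \<delta> in its denominator, it is a multiple of \<open>Q * \<delta>\<close>, so failure
  probabilities of order \<open>1 / Q\<close> per pair are affordable.\<close>

lemma R_hz: "real (2 * g) * real hz \<le> 3 * (C / sk) * Q * \<delta>"
proof -
  have "real (2 * g) * real hz \<le> (24 * Y) * sk"
    using g_bounds(2) hz_le_sk Y_ge by (intro mult_mono) auto
  also have "\<dots> = 24 * C * lN / \<alpha>" using sk_ge1 by (simp add: Y_def)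
  also have "\<dots> = 3 * (C / sk) * Q * \<delta>" using sk_ge1 \<delta> by (simp add: Q_def)
  finally show ?thesis .
qed

text \<open>The constant 1737/2000 is a rational upper bound of 5/4 ln 2: one unit from
  \<open>Q = 2 powr tQ\<close> and a quarter from \<open>C_le\<close>.\<close>

lemma R_hz': "real (2 * g) * real hz \<le> 3 * exp (1737/2000 * tQ) * \<delta>"
proof -
  have "3 * (C / sk) * Q * \<delta> \<le> 3 * (2 powr (tQ / 4)) * Q * \<delta>"
    using C_le Q8 \<delta> by (intro mult_right_mono mult_left_mono) auto
  also have "2 powr (tQ / 4) = exp (tQ / 4 * ln 2)" by (rule two_powr_eq_exp)
  also have "3 * exp (tQ / 4 * ln 2) * Q * \<delta> = 3 * exp (tQ * (5/4 * ln 2)) * \<delta>"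
    unfolding Q_exp by (simp add: exp_add[symmetric] algebra_simps)
  also have "\<dots> \<le> 3 * exp (1737/2000 * tQ) * \<delta>"
  proof -
    have "tQ * (5/4 * ln 2) \<le> tQ * (1737/2000)"
      using tQ5 ln2_le_25_over_36 by (intro mult_left_mono) auto
    thus ?thesis using \<delta> by (simp add: mult.commute)
  qed
  finally show ?thesis using R_hz by linarith
qed

lemma Lv_lk: "real Lv - 1 \<le> lk"
proof -
  have h: "1 \<le> real hz" using hz_pos by simp
  have "real Lv - 1 = real_of_int \<lfloor>log 2 (real hz)\<rfloor>" using h by (simp add: bm_levels_def)
  also have "\<dots> \<le> log 2 (real hz)" by simp
  also have "\<dots> \<le> lk" unfolding lk_def by (rule log_mono) (use h hz_le_sk in simp_all)
  finally show ?thesis .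
qed

lemma wk_ge: "c \<le> lk \<Longrightarrow> 0 \<le> r \<Longrightarrow> r\<^sup>2 \<le> c \<Longrightarrow> c * r + 1 \<le> wk"
proof -
  assume c: "c \<le> lk" "0 \<le> r" "r\<^sup>2 \<le> c"
  have "c * r \<le> lk * r" using c by (intro mult_right_mono)
  also have "\<dots> \<le> lk powr (3/2)" by (rule powr_three_halves_ge[OF c])
  finally show ?thesis by (simp add: wk_def)
qed

section \<open>Budgets for noise, deviations and short rounds\<close>

lemma exp_mono_neg: "c * t0 \<le> c * t \<Longrightarrow> b \<le> exp (c * t0) \<Longrightarrow> 0 < b \<Longrightarrow> exp (- (c * t)) \<le> 1 / b" for c t t0 b :: real
proof -
  assume a: "c * t0 \<le> c * t" "b \<le> exp (c * t0)" "0 < b"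
  have "b \<le> exp (c * t)" using a(1,2) by (meson exp_le_cancel_iff order_trans)
  hence "1 / exp (c * t) \<le> 1 / b" using a(3) by (intro divide_left_mono) auto
  thus ?thesis by (simp add: exp_minus inverse_eq_divide)
qed

text \<open>Multiplied by \<open>R_hz'\<close> this is \<delta>/2. With at most two levels the rate
  is critical; with more levels \<open>u = 9/10\<close> is used, and the factors in
  \<open>infl\<close>, exponential in \<open>Lv\<close>, are paid by the exponent. The power 3/2 in
  \<open>C\<close> is what makes this possible: \<open>wk\<close> grows faster than
  \<open>Lv\<close>, and \<open>tQ\<close> is at least \<open>5 + 2 * lk\<close>.\<close>

lemma noise_budget: "q \<in> {1..hz} \<Longrightarrow>
  emeasure TM {w. noise_fail m q w} \<le> ennreal (exp (- (1737/2000 * tQ)) / 6)"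
proof -
  assume q: "q \<in> {1..hz}"
  consider "Lv = 1" | "Lv = 2" | "3 \<le> Lv" using bm_levels_pos[of hz] by linarith
  thus ?thesis
  proof cases
    case 1
    have "exp (- 5 * C\<^sup>2 / 4) / 2 \<le> exp (- (1737/2000 * tQ)) / 6"
    proof -
      \<comment> \<open>The coefficient 763/2000 is 5/4 - 1737/2000.\<close>
      have "exp (- 5 * C\<^sup>2 / 4) \<le> exp (- (1737/2000 * tQ) + - (763/2000 * tQ))"
        using tQ_le_Cs by simp
      also have "\<dots> = exp (- (1737/2000 * tQ)) * exp (- (763/2000 * tQ))" by (rule exp_add)
      also have "\<dots> \<le> exp (- (1737/2000 * tQ)) * (1 / 3)"
      proof (rule mult_left_mono)
        have "763/2000 * 5 \<le> 763/2000 * tQ" using tQ5 by simp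
        moreover have "3 \<le> exp (763/2000 * 5 :: real)"
          by (rule order_trans[OF exp_numeric_bounds(3)]) simp
        ultimately show "exp (- (763/2000 * tQ)) \<le> 1 / 3" by (intro exp_mono_neg[where ?t0.0 = 5]) auto
      qed simp
      finally show ?thesis by simp
    qed
    thus ?thesis using emeasure_noise_fail_1[OF 1 q, of m] by (meson ennreal_leI order_trans)
  next
    case 2
    have l1: "1 \<le> lk" using Lv_lk 2 by simp
    have w2: "2 \<le> wk" using wk_ge[of 1 1] l1 by simp
    have t7: "7 \<le> tQ" using tQ_lk l1 by linarith
    have C2: "2 * tQ \<le> C\<^sup>2" unfolding Cs using w2 tQ5 by (intro mult_right_mono) auto
    have e1: "exp (- (5/8 * C\<^sup>2)) \<le> exp (- (1737/2000 * tQ)) * (1/11)"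
    proof -
      have "exp (- (5/8 * C\<^sup>2)) \<le> exp (- (1737/2000 * tQ) + - (763/2000 * tQ))" using C2 by simp
      also have "\<dots> = exp (- (1737/2000 * tQ)) * exp (- (763/2000 * tQ))" by (rule exp_add)
      also have "exp (- (763/2000 * tQ)) \<le> 1 / 11"
      proof (rule exp_mono_neg[where ?t0.0 = 7])
        show "11 \<le> exp (763/2000 * 7 :: real)" by (rule order_trans[OF exp_numeric_bounds(4)]) simp
      qed (use t7 in auto)
      finally show ?thesis by (simp add: mult_left_mono)
    qed
    \<comment> \<open>Since \<open>C\<^sup>2\<close> is at least \<open>2 * tQ\<close>, the exponent
      is 7/4, and 1763/2000 is 7/4 - 1737/2000.\<close>
    have e2: "exp (- (7/8 * C\<^sup>2)) \<le> exp (- (1737/2000 * tQ)) * (1/100)"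
    proof -
      have "exp (- (7/8 * C\<^sup>2)) \<le> exp (- (1737/2000 * tQ) + - (1763/2000 * tQ))" using C2 by simp
      also have "\<dots> = exp (- (1737/2000 * tQ)) * exp (- (1763/2000 * tQ))" by (rule exp_add)
      also have "exp (- (1763/2000 * tQ)) \<le> 1 / 100"
      proof (rule exp_mono_neg[where ?t0.0 = 7])
        show "100 \<le> exp (1763/2000 * 7 :: real)" by (rule order_trans[OF exp_numeric_bounds(5)]) simp
      qed (use t7 in auto)
      finally show ?thesis by (simp add: mult_left_mono)
    qed
    have e3: "exp (- 5 * C\<^sup>2 / 4) \<le> exp (- (7/8 * C\<^sup>2))" by simp
    \<comment> \<open>With two levels the exponent in \<open>infl\<close> is 0, so the division by
      zero at \<open>u = 1\<close> has no effect.\<close>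
    have i1: "infl 1 = 1" unfolding infl_def 2 by simp
    have "emeasure TM {w. noise_fail m q w} \<le> ennreal (exp (- 5 * C\<^sup>2 / 4) / 2 +
      exp (- 5 * 1 * C\<^sup>2 / (4 * real Lv)) * (1 / (1 - (1 / real Lv)\<^sup>2)) * infl 1 +
      2 * (exp (- 7 * 1 * C\<^sup>2 / (4 * real Lv)) * infl 1))"
      by (rule emeasure_noise_fail_2[OF q]) (use 2 in auto)
    also have "exp (- 5 * C\<^sup>2 / 4) / 2 +
      exp (- 5 * 1 * C\<^sup>2 / (4 * real Lv)) * (1 / (1 - (1 / real Lv)\<^sup>2)) * infl 1 +
      2 * (exp (- 7 * 1 * C\<^sup>2 / (4 * real Lv)) * infl 1) =
      exp (- 5 * C\<^sup>2 / 4) / 2 + exp (- (5/8 * C\<^sup>2)) * (4/3) + 2 * exp (- (7/8 * C\<^sup>2))"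
      unfolding i1 2 by (simp add: power2_eq_square)
    also have "\<dots> \<le> exp (- (1737/2000 * tQ)) / 6"
      using e1 e2 e3 exp_gt_zero[of "- (1737/2000 * tQ)"] by linarith
    finally show ?thesis by (simp add: ennreal_leI)
  next
    case 3
    define n where "n = real Lv - 2"
    have n1: "1 \<le> n" using 3 by (simp add: n_def)
    have L: "real Lv = n + 2" by (simp add: n_def)
    have lkn: "n + 1 \<le> lk" using Lv_lk by (simp add: n_def)
    have tn: "7 + 2 * n \<le> tQ" using tQ_lk lkn by linarith
    \<comment> \<open>The term 17/10 for each of the \<open>n\<close> factors pays for
      \<open>infl\<close>, the term 17/5 for the numerical constants. For \<open>Lv = 3\<close> the
      square root of \<open>lk\<close> is bounded by 1414/1000, for more levels by 173/100.\<close>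
    have main: "1737/2000 * tQ + 17/5 + 17/10 * n \<le> 9/8 * C\<^sup>2 / real Lv"
    proof (cases "Lv = 3")
      case True
      have "2 * (1414/1000) + 1 \<le> wk" using lkn n1 by (intro wk_ge) (auto simp: power2_eq_square)
      hence w: "3828/1000 * tQ \<le> wk * tQ" using tQ5 by (intro mult_right_mono) auto
      have n: "n = 1" and L3: "real Lv = 3" using True by (simp_all add: n_def)
      show ?thesis unfolding Cs L3 n using w tn[unfolded n] by linarith
    next
      case False
      hence n2: "2 \<le> n" using 3 by (simp add: n_def)
      have "(n + 1) * (173/100) + 1 \<le> wk" using lkn n2 by (intro wk_ge) (auto simp: power2_eq_square)
      moreover have "154/100 * (x + 2) \<le> y" if "(x + 1) * (173/100) + 1 \<le> y" "2 \<le> x" for x y :: real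
        using that by (simp add: field_simps)
      ultimately have "154/100 * (n + 2) \<le> wk" using n2 by blast
      hence "154/100 * real Lv \<le> wk" by (simp only: L)
      hence "(154/100 * real Lv) * tQ \<le> C\<^sup>2" unfolding Cs using tQ5 by (intro mult_right_mono) auto
      hence "154/100 * tQ \<le> C\<^sup>2 / real Lv" using 3 by (subst pos_le_divide_eq) (auto simp: mult_ac)
      hence "9/8 * (154/100 * tQ) \<le> 9/8 * C\<^sup>2 / real Lv" by simp
      thus ?thesis using tn n2 by linarith
    qed
    \<comment> \<open>With this rate 5/4 becomes 9/8, and one moment generating factor is 100/19,
      which is at most \<open>exp (17/10)\<close>.\<close>
    let ?u = "9/10 :: real"
    let ?E = "exp (- (9/8 * C\<^sup>2 / real Lv))"
    let ?V = "exp (17/10 * n)"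
    have inf: "infl ?u \<le> ?V"
    proof -
      have "infl ?u = (100/19) ^ (Lv - 2)" by (simp add: infl_def power2_eq_square)
      also have "\<dots> \<le> exp (17/10) ^ (Lv - 2)" by (intro power_mono exp_numeric_bounds) simp
      also have "\<dots> = ?V" using 3 by (simp add: exp_of_nat_mult[symmetric] n_def mult.commute of_nat_diff)
      finally show ?thesis .
    qed
    have u1: "10/11 \<le> 1 - (?u / real Lv)\<^sup>2"
    proof -
      have "?u / real Lv \<le> ?u / 3" using 3 by (intro divide_left_mono) auto
      hence "(?u / real Lv)\<^sup>2 \<le> (?u / 3)\<^sup>2" by (intro power_mono) auto
      thus ?thesis by (simp add: power2_eq_square)
    qed
    have "1 / (1 - (?u / real Lv)\<^sup>2) \<le> 1 / (10/11)"
      by (rule divide_left_mono[OF u1]) (use u1 in auto)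
    hence u2: "1 / (1 - (?u / real Lv)\<^sup>2) \<le> 11/10" by simp
    have u0: "0 \<le> 1 / (1 - (?u / real Lv)\<^sup>2)" using u1 by (intro divide_nonneg_pos) linarith+
    have V1: "1 \<le> ?V" using n1 by simp
    have a1: "exp (- 5 * C\<^sup>2 / 4) / 2 \<le> ?E * ?V / 2"
    proof -
      have "C\<^sup>2 / real Lv \<le> C\<^sup>2 / 1" using 3 by (intro divide_left_mono) auto
      moreover have "9/8 * C\<^sup>2 / real Lv = 9/8 * (C\<^sup>2 / real Lv)" by simp
      ultimately have "9/8 * C\<^sup>2 / real Lv \<le> 5 * C\<^sup>2 / 4" using zero_le_power2[of C] by linarith
      hence "exp (- 5 * C\<^sup>2 / 4) \<le> ?E * 1" by simp
      also have "\<dots> \<le> ?E * ?V" by (intro mult_left_mono V1) simp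
      finally show ?thesis by simp
    qed
    have a2: "exp (- 5 * ?u * C\<^sup>2 / (4 * real Lv)) * (1 / (1 - (?u / real Lv)\<^sup>2)) * infl ?u \<le> ?E * (11/10) * ?V"
    proof -
      have e: "- 5 * ?u * C\<^sup>2 / (4 * real Lv) = - (9/8 * C\<^sup>2 / real Lv)" by simp
      have "0 \<le> infl ?u" by (rule infl_nonneg) auto
      thus ?thesis unfolding e
        by (intro mult_mono[OF mult_left_mono[OF u2] inf]) simp_all
    qed
    have a3: "2 * (exp (- 7 * ?u * C\<^sup>2 / (4 * real Lv)) * infl ?u) \<le> 2 * (?E * ?V)"
    proof -
      have "0 \<le> C\<^sup>2 / real Lv" by simp
      moreover have "- 7 * ?u * C\<^sup>2 / (4 * real Lv) = - (63/40) * (C\<^sup>2 / real Lv)"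
        "- (9/8 * C\<^sup>2 / real Lv) = - (9/8) * (C\<^sup>2 / real Lv)" by simp_all
      ultimately have "- 7 * ?u * C\<^sup>2 / (4 * real Lv) \<le> - (9/8 * C\<^sup>2 / real Lv)" by linarith
      hence "exp (- 7 * ?u * C\<^sup>2 / (4 * real Lv)) \<le> ?E" by (simp only: exp_le_cancel_iff)
      moreover have "0 \<le> infl ?u" by (rule infl_nonneg) auto
      ultimately show ?thesis using inf by (intro mult_left_mono mult_mono) simp_all
    qed
    have "emeasure TM {w. noise_fail m q w} \<le> ennreal (exp (- 5 * C\<^sup>2 / 4) / 2 +
      exp (- 5 * ?u * C\<^sup>2 / (4 * real Lv)) * (1 / (1 - (?u / real Lv)\<^sup>2)) * infl ?u +
      2 * (exp (- 7 * ?u * C\<^sup>2 / (4 * real Lv)) * infl ?u))"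
      by (rule emeasure_noise_fail_2[OF q]) (use 3 in auto)
    also have "\<dots> \<le> ennreal (exp (- (1737/2000 * tQ)) / 6)"
    proof (rule ennreal_leI)
      have "?E * ?V = exp (17/10 * n - 9/8 * C\<^sup>2 / real Lv)" by (simp add: exp_add[symmetric])
      also have "\<dots> \<le> exp (- (1737/2000 * tQ) + - (17/5))" using main by simp
      also have "\<dots> = exp (- (1737/2000 * tQ)) * exp (- (17/5))" by (rule exp_add)
      also have "\<dots> \<le> exp (- (1737/2000 * tQ)) * (1 / 27)"
      proof (rule mult_left_mono)
        have "1 / exp (17/5) \<le> 1 / (27 :: real)"
          using exp_numeric_bounds(1) by (intro divide_left_mono) auto
        thus "exp (- (17/5)) \<le> 1 / (27 :: real)" by (simp add: exp_minus inverse_eq_divide)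
      qed simp
      finally have "?E * ?V \<le> exp (- (1737/2000 * tQ)) * (1 / 27)" .
      \<comment> \<open>The three parts add up to (1/2 + 11/10 + 2)/27, which is less than
        1/6.\<close>
      thus "exp (- 5 * C\<^sup>2 / 4) / 2 +
        exp (- 5 * ?u * C\<^sup>2 / (4 * real Lv)) * (1 / (1 - (?u / real Lv)\<^sup>2)) * infl ?u +
        2 * (exp (- 7 * ?u * C\<^sup>2 / (4 * real Lv)) * infl ?u) \<le> exp (- (1737/2000 * tQ)) / 6"
        using a1 a2 a3 exp_gt_zero[of "- (1737/2000 * tQ)"] by linarith
    qed
    finally show ?thesis .
  qed
qed

text \<open>Another bootstrap: if \<open>C\<close> is below \<open>sk\<close>, a lower bound on
  \<open>C\<close> is one on \<open>sk\<close>, hence on \<open>lk\<close>, \<open>wk\<close> and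
  \<open>tQ\<close>, and so a better one on \<open>C\<close>. Starting from 223/100, four passes
  reach 7.\<close>

lemma large_C:
  assumes "C < sk"
  shows "7 \<le> C" "49/10 \<le> wk" "10 \<le> tQ"
proof -
  have lk: "real p / real q \<le> lk" if "2 ^ p \<le> v ^ q" "0 \<le> v" "v \<le> C" "1 \<le> q" for p q :: nat and v :: real
    unfolding lk_def
  proof (rule log2_ge)
    show "2 ^ p \<le> sk ^ q" using that assms by (intro order_trans[OF that(1)] power_mono) auto
  qed (use sk_ge1 that in auto)
  have up: "c \<le> C" if "0 \<le> c" "c\<^sup>2 \<le> a * b" "0 \<le> a" "0 \<le> b" "a \<le> wk" "b \<le> tQ" for a b c
  proof (rule C_sq_less[OF that(1)])
    have "a * b \<le> C\<^sup>2" unfolding Cs using that wk1 by (intro mult_mono) auto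
    thus "c\<^sup>2 \<le> C\<^sup>2" using that by linarith
  qed
  have l1: "1 \<le> lk" using lk[of 1 2 1] C22 by simp
  have "2 \<le> wk" using wk_ge[of 1 1] l1 by simp
  hence c1: "37/10 \<le> C" using tQ_lk l1 by (intro up[of _ 2 7]) (auto simp: power_divide)
  have l2: "3/2 \<le> lk" using lk[of 3 "37/10" 2] c1 by (simp add: power_divide)
  have "28/10 \<le> wk" using wk_ge[of "3/2" "12/10"] l2 by (simp add: power_divide)
  hence c2: "47/10 \<le> C" using tQ_lk l2 by (intro up[of _ "28/10" 8]) (auto simp: power_divide)
  have l3: "2 \<le> lk" using lk[of 2 4 1] c2 by simp
  have "38/10 \<le> wk" using wk_ge[of 2 "14/10"] l3 by (simp add: power_divide)
  hence c3: "58/10 \<le> C" using tQ_lk l3 by (intro up[of _ "38/10" 9]) (auto simp: power_divide)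
  have l4: "5/2 \<le> lk" using lk[of 5 "58/10" 2] c3 by (simp add: power_divide)
  show w: "49/10 \<le> wk" using wk_ge[of "5/2" "158/100"] l4 by (simp add: power_divide)
  show t: "10 \<le> tQ" using tQ_lk l4 by simp
  show "7 \<le> C" using w t by (intro up[of _ "49/10" 10]) auto
qed

text \<open>The tilt is \<open>eps\<close>. As \<open>eps \<le> 1\<close>, bias and variance cost at
  most (1/2 + 1/8) times \<open>eps\<^sup>2\<close> per site, together 5/8 of
  \<open>C\<^sup>2\<close>, while the gain is \<open>C\<^sup>2 - C\<close>; the term
  \<open>C\<close> comes from the leaked blocks.\<close>

lemma deviates_budget:
  assumes c: "C < sk"
  shows "emeasure TM {w. deviates X m j w} \<le> ennreal (1 / (12 * Q))"
proof -
  note b = large_C[OF c]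
  have e1: "eps \<le> 1" using c sk_ge1 by (simp add: priv_def)
  have e0: "0 \<le> eps" using eps_pos by simp
  let ?kap = "5/8 * eps\<^sup>2"
  have "exp eps \<le> 1 + eps + eps\<^sup>2" using e0 e1 by (rule exp_bound)
  moreover have "eps\<^sup>2 \<le> eps" using e0 e1 by (simp add: power2_eq_square mult_left_le)
  ultimately have "exp eps - 1 \<le> 2 * eps" by linarith
  hence "eps * (exp eps - 1) \<le> eps * (2 * eps)" using e0 by (rule mult_left_mono)
  hence kap: "eps * (exp eps - 1) / 4 + eps\<^sup>2 / 8 \<le> ?kap" by (simp add: power2_eq_square)
  have ek: "eps\<^sup>2 * real k = C\<^sup>2"
    using sk_ge1 by (simp add: priv_def power_divide)
  have eh: "eps * (X - real hz) \<ge> C\<^sup>2 - C"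
  proof -
    have "eps * real hz \<le> eps * sk" using e0 hz_le_sk by (intro mult_left_mono)
    also have "\<dots> = C" using sk_ge1 by (simp add: priv_def)
    finally show ?thesis using X_eps by (simp add: right_diff_distrib mult.commute)
  qed
  have C7: "C \<le> C\<^sup>2 / 7" using b(1) by (simp add: power2_eq_square)
  have "49/10 * tQ \<le> wk * tQ" using b by (intro mult_right_mono) auto
  hence Ct: "49/10 * tQ \<le> C\<^sup>2" by (simp only: Cs)
  have l2: "tQ * ln 2 \<le> tQ * (25/36)" using b ln2_le_25_over_36 by (intro mult_left_mono) auto
  \<comment> \<open>With \<open>C \<le> C\<^sup>2 / 7\<close> at least 13/56 of
    \<open>C\<^sup>2\<close> remains, and this exceeds 1.13 times \<open>tQ\<close>, whereas ln 2
    times \<open>tQ\<close> plus 4.4 is needed.\<close>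
  have "?kap * real k - eps * (X - real hz) \<le> - (tQ * ln 2) + - (44/10)"
    using ek eh C7 Ct l2 b(3) by linarith
  hence "exp (?kap * real k - eps * (X - real hz)) \<le> exp (- (tQ * ln 2) + - (44/10))" by (simp only: exp_le_cancel_iff)
  also have "\<dots> = exp (- (44/10)) / Q" unfolding Q_exp exp_add exp_minus[of "tQ * ln 2"] by (simp only: divide_inverse mult.commute)
  also have "\<dots> \<le> (1 / 24) / Q"
  proof (intro divide_right_mono)
    have "1 / exp (44/10) \<le> 1 / (24 :: real)" using exp_numeric_bounds(6) by (intro divide_left_mono) auto
    thus "exp (- (44/10)) \<le> 1 / (24 :: real)" by (simp add: exp_minus inverse_eq_divide)
  qed (use Q8 in simp)
  finally have "2 * exp (?kap * real k - eps * (X - real hz)) \<le> 1 / (12 * Q)" by simp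
  thus ?thesis
    using emeasure_deviates[OF eps_pos kap, of X m j] by (meson ennreal_leI order_trans)
qed

lemma rounds_budget:
  "emeasure TM {w. card {m. m < 2 * g \<and> long_round w m} < g} \<le> ennreal (\<delta> / 4)"
proof -
  \<comment> \<open>As \<open>g\<close> is at least 100, a base slightly below 1 suffices: the power
    is at most \<open>exp (- (2 * C\<^sup>2))\<close>, hence at most \<open>1 / Q\<close>.\<close>
  have fin: "ennreal (v ^ g) \<le> ennreal (\<delta> / 4)" if v: "0 \<le> v" "v \<le> exp (- (2/100 * C\<^sup>2))" for v
  proof (rule ennreal_leI)
    have "v ^ g \<le> exp (- (2/100 * C\<^sup>2)) ^ g" using v by (intro power_mono)
    also have "\<dots> = exp (real g * (- (2/100 * C\<^sup>2)))" by (simp only: exp_of_nat_mult)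
    also have "\<dots> \<le> exp (- (tQ * ln 2))"
    proof -
      have "100 * (2/100 * C\<^sup>2) \<le> real g * (2/100 * C\<^sup>2)"
        using g_bounds(3) by (intro mult_right_mono) auto
      moreover have "tQ * ln 2 \<le> tQ * 1" using tQ5 ln_2_less_1 by (intro mult_left_mono) auto
      ultimately have "real g * (- (2/100 * C\<^sup>2)) \<le> - (tQ * ln 2)" using tQ_le_Cs tQ5 by linarith
      thus ?thesis by (simp only: exp_le_cancel_iff)
    qed
    also have "\<dots> = 1 / Q" unfolding Q_exp by (simp add: exp_minus inverse_eq_divide)
    also have "\<dots> \<le> \<delta> / 4"
    proof -
      have "32 * 1 / \<delta> \<le> 32 * real k / \<delta>" using k1 \<delta> by (intro divide_right_mono) auto
      hence "32 / \<delta> \<le> Q" using Q32 by simp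
      hence "32 \<le> Q * \<delta>" using \<delta> by (simp add: pos_divide_le_eq)
      thus ?thesis using Q8 by (simp add: field_simps)
    qed
    finally show "v ^ g \<le> \<delta> / 4" .
  qed
  have ln2: "ln (2::real) \<le> 25/36" by (rule ln2_le_25_over_36)
  show ?thesis
  proof (cases "hz = 1")
    case True
    have "sk < 2" using True unfolding horizon_def by linarith
    hence "sk * sk < 2 * 2" using sk_ge1 by (intro mult_strict_mono) auto
    hence "real k < 4" by (simp only: sk_sq)
    hence k3: "k \<le> 3" by simp
    \<comment> \<open>A single phase means that \<open>k\<close> is at most 3. For
      \<open>k = 1\<close> the general bound on \<open>C\<close> suffices; for 2 and 3 the larger
      \<open>tQ\<close> improves it.\<close>
    have main: "C * (2/100 * C + sk / 2) + 25/36 \<le> C\<^sup>2 / 2 \<and> sk \<le> C"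
    proof (cases "k = 1")
      case True
      hence s: "sk = 1" by simp
      have "223/100 * (57/100) \<le> C * (48/100 * C - 1/2)" using C22 by (intro mult_mono) auto
      thus ?thesis unfolding s using C22 by (simp add: power2_eq_square algebra_simps)
    next
      case False
      hence "2 \<le> real k" using k_pos by simp
      hence "log 2 2 \<le> log 2 (real k)" by (intro log_mono) auto
      hence "6 \<le> tQ" using tQ_lk log_k by simp
      hence "6 \<le> C\<^sup>2" using tQ_le_Cs by linarith
      hence c: "2449/1000 \<le> C" by - (rule C_sq_less, simp, simp add: power_divide)
      have "real k \<le> (17321/10000)\<^sup>2" using k3 by (simp add: power_divide)
      hence s: "sk \<le> 17321/10000" by (intro real_le_lsqrt) auto
      have "2449/1000 * (309/1000) \<le> C * (48/100 * C - sk / 2)" using c s by (intro mult_mono) auto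
      thus ?thesis using c s by (simp add: power2_eq_square algebra_simps)
    qed
    have "2 * exp (- (C * (C - sk) / 2)) = exp (ln 2) * exp (- (C * (C - sk) / 2))" by simp
    also have "\<dots> = exp (ln 2 + - (C * (C - sk) / 2))" by (rule exp_add[symmetric])
    also have "\<dots> \<le> exp (- (2/100 * C\<^sup>2))"
      using main ln2 by (simp add: power2_eq_square algebra_simps)
    finally have "2 * exp (- (C * (C - sk) / 2)) \<le> exp (- (2/100 * C\<^sup>2))" .
    from fin[OF _ this] show ?thesis
      using short_rounds_1[OF True, of g] main by (meson order_trans exp_ge_zero mult_nonneg_nonneg zero_le_numeral)
  next
    case False
    hence h2: "2 \<le> real hz" using hz_pos by simp
    have sk2: "2 \<le> sk" using h2 hz_le_sk by linarith
    have "log 2 2 \<le> lk" unfolding lk_def using sk2 by (intro log_mono) auto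
    hence l1: "1 \<le> lk" by simp
    have "2 * 7 \<le> wk * tQ" using wk_ge[of 1 1] l1 tQ_lk by (intro mult_mono) auto
    hence "14 \<le> C\<^sup>2" by (simp add: Cs)
    hence c: "374/100 \<le> C" by - (rule C_sq_less, simp, simp add: power_divide)
    have "sk < real hz + 1" unfolding horizon_def using sk_ge1 by linarith
    \<comment> \<open>With at least two phases, rounding the horizon down loses at most a factor
      3/2.\<close>
    hence s: "sk \<le> 3/2 * real hz" using h2 by linarith
    have "374/100 * (52/100) \<le> C * (24/100 * C - 375/1000)" using c by (intro mult_mono) auto
    hence "2 * (161/100) \<le> real hz * (C * (24/100 * C - 375/1000) - 1/3)" using h2 by (intro mult_mono) auto
    moreover have "C * sk \<le> C * (3/2 * real hz)" using s c by (intro mult_left_mono) auto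
    moreover have "2 * (1/100 * C\<^sup>2) \<le> real hz * (1/100 * C\<^sup>2)" using h2 by (intro mult_right_mono) auto
    moreover have "real hz * (C * (24/100 * C - 375/1000) - 1/3) =
        24/100 * (C\<^sup>2 * real hz) - 1/4 * (C * (3/2 * real hz)) - real hz / 3"
      by (simp add: power2_eq_square algebra_simps)
    ultimately have main: "50/36 + real hz / 3 - (C\<^sup>2 * real hz - C * sk) / 4 \<le> - (2/100 * C\<^sup>2)"
      by (simp add: mult.commute) argo
    have four: "4 = exp (2 * ln (2::real))" by (simp add: exp_of_nat_mult[of 2, simplified] power2_eq_square exp_double)
    have "(4/3 :: real) ^ hz \<le> exp (1/3) ^ hz"
      using exp_ge_add_one_self[of "1/3 :: real"] by (intro power_mono) auto
    also have "\<dots> = exp (real hz * (1/3))" by (simp only: exp_of_nat_mult)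
    finally have "4 * (exp (- ((C\<^sup>2 * real hz - C * sk) / 4)) * (4 / 3) ^ hz) \<le>
       exp (2 * ln 2) * (exp (- ((C\<^sup>2 * real hz - C * sk) / 4)) * exp (real hz * (1/3)))"
      unfolding four[symmetric] by (intro mult_left_mono) auto
    also have "\<dots> = exp (2 * ln 2 + real hz / 3 - (C\<^sup>2 * real hz - C * sk) / 4)"
      by (simp add: exp_add[symmetric])
    also have "\<dots> \<le> exp (- (2/100 * C\<^sup>2))"
      using main ln2 by (simp only: exp_le_cancel_iff; linarith)
    finally have "4 * (exp (- ((C\<^sup>2 * real hz - C * sk) / 4)) * (4 / 3) ^ hz) \<le> exp (- (2/100 * C\<^sup>2))" .
    from fin[OF _ this] show ?thesis
      using short_rounds_2[of g] by (rule order_trans[rotated]) simp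
  qed
qed

end

section \<open>Good runs and the union bound\<close>

context tracking_full
begin

definition ok :: "tape \<Rightarrow> nat \<Rightarrow> bool" where
  "ok w t \<longleftrightarrow> \<bar>answer (conf w t) - real (total k (conf w t))\<bar> \<le> \<alpha> * real (total k (conf w t)) \<and>
     real (words (conf w t)) \<le> 172 * (C * sk * log 2 (real N) / \<alpha>)"

lemma ok_idle:
  assumes b: "blen (conf w t) = 0" and N: "2 \<le> N"
  shows "ok w t"
proof -
  let ?s = "conf w t"
  have I: "inv w ?s" by (rule inv_conf)
  have a: "answer ?s = real (start_count ?s)" "words ?s = start_count ?s"
    using I b by (simp_all add: inv_def)
  have t: "total k ?s = start_count ?s" using idle_or_in_round(3)[OF b] by (simp add: total_def)
  have lN: "1 \<le> log 2 (real N)" using N by simp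
  have "real (words ?s) \<le> 8 * (C * sk) / \<alpha>"
    using blen_zero_start[OF b] \<alpha>_pos unfolding a by (simp add: pos_le_divide_eq mult_ac)
  also have "\<dots> \<le> 172 * (C * sk / \<alpha> * log 2 (real N))"
  proof -
    have p: "0 \<le> C * sk / \<alpha>" using Csk_ge1 \<alpha>_pos by (intro divide_nonneg_pos) auto
    have "C * sk / \<alpha> * 1 \<le> C * sk / \<alpha> * log 2 (real N)" using lN p by (rule mult_left_mono)
    thus ?thesis using p by simp
  qed
  finally show ?thesis using a t \<alpha>_pos by (simp add: ok_def mult_ac)
qed

text \<open>A positive block length needs a count of at least \<open>8 * C * sk / \<alpha>\<close>,
  which is out of reach, so the server is exact throughout.\<close>

lemma ok_small:
  assumes "\<alpha> * real N < 8 * C * sk" "2 \<le> N"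
  shows "ok w t"
proof (rule ok_idle[OF _ assms(2)])
  show "blen (conf w t) = 0"
  proof (rule ccontr)
    assume "blen (conf w t) \<noteq> 0"
    hence b: "1 \<le> blen (conf w t)" by simp
    have p: "0 < 8 * C * sk" using Csk_ge1 by linarith
    have "1 * (8 * C * sk) \<le> real (blen (conf w t)) * (8 * C * sk)" using b p by (intro mult_right_mono) auto
    also have "\<dots> \<le> \<alpha> * real (start_count (conf w t))" by (rule block_len_bounds(1)[OF b])
    also have "\<dots> \<le> \<alpha> * real N"
      using start_le_total[of "conf w t"] total_le_N[of w t] \<alpha>_pos by (intro mult_left_mono) auto
    finally show False using assms by simp
  qed
qed

end

context budget
begin

text \<open>Deviations are included only for \<open>C < sk\<close>; otherwise the number of sites
  bounds them and they contribute nothing to the failure probability.\<close>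

definition failure :: "tape set" where
  "failure = {w. card {m. m < 2 * g \<and> long_round w m} < g} \<union>
     (\<Union>(m, q)\<in>{..<2 * g} \<times> {1..hz}. {w. noise_fail m q w} \<union> (if C < sk then {w. deviates X m q w} else {}))"

lemma ok_unless_failure:
  assumes g: "good_thr w" and f: "w \<notin> failure"
  shows "ok w t"
proof (cases "blen (conf w t) = 0")
  case True
  thus ?thesis using N2 by (rule ok_idle)
next
  case False
  hence b: "1 \<le> blen (conf w t)" by simp
  have gr: "0 \<le> growth" using \<alpha>_pos sk_ge1 C_ge1 by (intro divide_nonneg_pos mult_nonneg_nonneg) auto
  have "g \<le> card {m. m < 2 * g \<and> long_round w m}" using f by (auto simp: failure_def)
  hence "(1 + growth) ^ g \<le> (1 + growth) ^ card {m. m < 2 * g \<and> long_round w m}"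
    using gr by (intro power_increasing) auto
  hence many: "real N < (1 + growth) ^ card {m. m < 2 * g \<and> long_round w m}"
    using growth_pow by linarith
  have R: "rnd (conf w t) < 2 * g" for t
    using g_bounds(3) by (intro rnd_less[OF g _ many]) simp
  have nf: "\<not> noise_fail m q w" and dv: "\<not> deviates X m q w \<or> \<not> C < sk"
    if "m < 2 * g" "q \<in> {1..hz}" for m q
    using f that by (auto simp: failure_def split: if_splits)
  let ?m = "rnd (conf w t)" and ?j = "phase (conf w t)"
  have j: "?j \<in> {1..hz}" using inv_conf[of w t] by (simp add: inv_def)
  have "\<not> bad ?m ?j w t"
  proof (rule never_bad[OF g])
    show "\<not> deviates X ?m ?j w \<or> real k \<le> X"
    proof (cases "C < sk")
      case True
      thus ?thesis using dv[OF R[of t] j] by simp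
    next
      case False
      hence "sk * sk \<le> C * sk" using sk_ge1 by (intro mult_right_mono) auto
      thus ?thesis by simp
    qed
  qed (use nf[OF R[of t] j] in \<open>auto simp: noise_fail_def\<close>)
  hence acc: "\<bar>answer (conf w t) - real (total k (conf w t))\<bar> \<le> \<alpha> * real (total k (conf w t))"
    using b by (simp add: bad_def)
  have lap: "lapT w m q \<le> 5 * X" if "m < 2 * g" "q \<in> {1..hz}" for m q
    using nf[OF that] by (simp add: noise_fail_def)
  define Z where "Z = C * sk * lN / \<alpha>"
  have W: "real (words (conf w t)) \<le> (8 * X / \<alpha> + 1 + real k) + 5 * real k * real ?m +
    pot * ln (real (start_count (conf w t))) + real (received w (conf w t))"
    by (rule words_bound[OF g lap R b])
  have Xa: "X / \<alpha> \<le> Z"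
  proof -
    have p: "0 \<le> X / \<alpha>" using Csk_ge1 \<alpha>_pos by (intro divide_nonneg_pos) auto
    have "X / \<alpha> * 1 \<le> X / \<alpha> * lN" by (rule mult_left_mono[OF lN1 p])
    thus ?thesis by (simp add: Z_def mult_ac)
  qed
  have kX: "C * real k \<le> X / \<alpha>"
  proof -
    have "X * sk \<le> X * (1 / \<alpha>)" using sk_le_inv Csk_ge1 by (intro mult_left_mono) auto
    moreover have "X * sk = C * (sk * sk)" by (simp only: mult_ac)
    ultimately show ?thesis by (simp only: sk_sq) simp
  qed
  have k1': "real k \<le> C * real k" using mult_right_mono[OF C_ge1, of "real k"] by simp
  have w1: "8 * X / \<alpha> + 1 + real k \<le> 10 * Z"
  proof -
    have "8 * X / \<alpha> = 8 * (X / \<alpha>)" by simp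
    thus ?thesis using Xa kX k1' k1 by linarith
  qed
  have w2: "5 * real k * real ?m \<le> 120 * Z"
  proof -
    have "real ?m \<le> 24 * Y" using R[of t] g_bounds(2) by linarith
    hence "5 * real k * real ?m \<le> 5 * (sk * sk) * (24 * Y)" unfolding sk_sq by (intro mult_left_mono) auto
    also have "\<dots> = 120 * Z" using sk_ge1 \<alpha>_pos by (simp only: Y_def Z_def) (simp add: field_simps)
    finally show ?thesis .
  qed
  have w3: "pot * ln (real (start_count (conf w t))) \<le> 34 * Z"
  proof -
    have "real (start_count (conf w t)) \<le> real N" using start_le_total[of "conf w t"] total_le_N[of w t] by simp
    hence "ln (real (start_count (conf w t))) \<le> ln (real N)"
      using block_len_bounds(3)[OF b] by (intro ln_mono) auto
    also have "ln (real N) = lN * ln 2" using N2 by (simp add: lN_def log_def)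
    also have "\<dots> \<le> lN * 1" using lN1 ln_2_less_1 by (intro mult_left_mono) auto
    finally have "pot * ln (real (start_count (conf w t))) \<le> pot * lN"
      using Csk_ge1 \<alpha>_pos by (intro mult_left_mono divide_nonneg_pos) auto
    thus ?thesis by (simp add: Z_def mult_ac)
  qed
  have w4: "real (received w (conf w t)) \<le> 8 * Z"
    using received_le[OF lap R, of t] kX Xa by (simp add: mult.assoc; linarith)
  \<comment> \<open>172 = 10 + 120 + 34 + 8: forwarding, restarts, bits of finished rounds and bits
    of the current round.\<close>
  have "real (words (conf w t)) \<le> 172 * Z" using W w1 w2 w3 w4 by linarith
  thus ?thesis using acc by (simp add: ok_def Z_def lN_def)
qed

text \<open>The union runs over \<open>2 * g\<close> rounds and all phases, whether or not they are
  played. On good runs fewer than \<open>2 * g\<close> rounds occur, so this covers every phase of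
  the run.\<close>

lemma emeasure_failure: "failure \<in> sets TM" "emeasure TM failure \<le> ennreal \<delta>"
proof -
  let ?I = "{..<2 * g} \<times> {1..hz}"
  let ?D = "\<lambda>m q. if C < sk then {w. deviates X m q w} else {}"
  let ?B = "\<lambda>(m, q). {w. noise_fail m q w} \<union> ?D m q"
  let ?A = "{w. card {m. m < 2 * g \<and> long_round w m} < g}"
  have D: "?D m q \<in> sets TM" for m q
  proof -
    have "{w \<in> space TM. deviates X m q w} \<in> sets TM" by measurable
    thus ?thesis by simp
  qed
  have B: "?B p \<in> sets TM" for p using noise_fail_sets D by (cases p) auto
  have A: "?A \<in> sets TM"
  proof -
    have eq: "real (card {m. m < 2 * g \<and> long_round w m}) = (\<Sum>m<2 * g. if long_round w m then 1 else 0)" for w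
      by (simp add: sum.If_cases Int_def)
    have "{w \<in> space TM. (\<Sum>m<2 * g. if long_round w m then 1 else 0) < real g} \<in> sets TM" by measurable
    thus ?thesis unfolding eq[symmetric] by simp
  qed
  have U: "(\<Union>p\<in>?I. ?B p) \<in> sets TM" using B by (intro sets.finite_UN) auto
  show "failure \<in> sets TM" unfolding failure_def using A U by (intro sets.Un) auto
  let ?pn = "exp (- (1737/2000 * tQ)) / 6" and ?pd = "if C < sk then 1 / (12 * Q) else 0"
  have Bp: "emeasure TM (?B p) \<le> ennreal (?pn + ?pd)" if p: "p \<in> ?I" for p
  proof -
    obtain m q where pq: "p = (m, q)" "m < 2 * g" "q \<in> {1..hz}" using p by auto
    have "emeasure TM (?B p) \<le> emeasure TM {w. noise_fail m q w} + emeasure TM (?D m q)"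
      using emeasure_subadditive[OF noise_fail_sets D] by (simp add: pq)
    also have "\<dots> \<le> ennreal ?pn + ennreal ?pd"
      using deviates_budget[of m q] by (intro add_mono noise_budget[OF pq(3)]) auto
    also have "\<dots> = ennreal (?pn + ?pd)" using Q8 by (subst ennreal_plus[symmetric]) auto
    finally show ?thesis .
  qed
  have "emeasure TM (\<Union>p\<in>?I. ?B p) \<le> (\<Sum>p\<in>?I. emeasure TM (?B p))"
    using B by (intro emeasure_subadditive_finite) auto
  also have "\<dots> \<le> (\<Sum>p\<in>?I. ennreal (?pn + ?pd))" by (intro sum_mono Bp)
  also have "\<dots> = ennreal (real (2 * g) * real hz * (?pn + ?pd))"
  proof -
    have "(\<Sum>p\<in>?I. ennreal (?pn + ?pd)) = ennreal (real (card ?I)) * ennreal (?pn + ?pd)"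
      by (simp only: sum_constant ennreal_of_nat_eq_real_of_nat)
    also have "\<dots> = ennreal (real (card ?I) * (?pn + ?pd))"
      by (rule ennreal_mult[symmetric]) (use Q8 in auto)
    also have "real (card ?I) = real (2 * g) * real hz" by (simp add: card_cartesian_product)
    finally show ?thesis .
  qed
  also have "\<dots> \<le> ennreal (3/4 * \<delta>)"
  proof (rule ennreal_leI)
    have "real (2 * g) * real hz * ?pn \<le> 3 * exp (1737/2000 * tQ) * \<delta> * ?pn"
      by (intro mult_right_mono R_hz') simp
    also have "\<dots> = 3 / 6 * \<delta> * (exp (1737/2000 * tQ) * exp (- (1737/2000 * tQ)))" by simp
    also have "\<dots> = \<delta> / 2" by (simp add: exp_minus)
    finally have 1: "real (2 * g) * real hz * ?pn \<le> \<delta> / 2" .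
    have 2: "real (2 * g) * real hz * ?pd \<le> \<delta> / 4"
    proof (cases "C < sk")
      case True
      have "C / sk \<le> 1" using True sk_ge1 by simp
      hence "3 * (C / sk) * Q * \<delta> \<le> 3 * 1 * Q * \<delta>"
        using Q8 \<delta> by (intro mult_right_mono mult_left_mono) auto
      hence "real (2 * g) * real hz \<le> 3 * Q * \<delta>" using R_hz by simp
      hence "real (2 * g) * real hz * (1 / (12 * Q)) \<le> 3 * Q * \<delta> * (1 / (12 * Q))"
        using Q8 by (intro mult_right_mono) auto
      also have "\<dots> = \<delta> / 4" using Q8 by simp
      finally show ?thesis using True by simp
    qed (use \<delta> in simp)
    show "real (2 * g) * real hz * (?pn + ?pd) \<le> 3/4 * \<delta>"
      using 1 2 by (simp only: distrib_left; linarith)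
  qed
  finally have Ub: "emeasure TM (\<Union>p\<in>?I. ?B p) \<le> ennreal (3/4 * \<delta>)" .
  have "emeasure TM failure \<le> emeasure TM ?A + emeasure TM (\<Union>p\<in>?I. ?B p)"
    unfolding failure_def using A U by (rule emeasure_subadditive)
  also have "\<dots> \<le> ennreal (\<delta> / 4) + ennreal (3/4 * \<delta>)" by (intro add_mono rounds_budget Ub)
  also have "\<dots> = ennreal \<delta>" using \<delta> by (subst ennreal_plus[symmetric]) auto
  finally show "emeasure TM failure \<le> ennreal \<delta>" .
qed

lemma ok_probability: "emeasure TM {w. \<not> (\<forall>t. ok w t)} \<le> ennreal \<delta>"
proof -
  have "AE w in TM. w \<in> {w. \<not> (\<forall>t. ok w t)} \<longrightarrow> w \<in> failure"
    using AE_good_thr by eventually_elim (use ok_unless_failure in blast)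
  hence "emeasure TM {w. \<not> (\<forall>t. ok w t)} \<le> emeasure TM failure"
    by (rule emeasure_mono_AE[OF _ emeasure_failure(1)])
  thus ?thesis using emeasure_failure(2) by (rule order_trans)
qed

end

lemma C_param_ge1:
  assumes "1 \<le> k" "0 < \<alpha>" "\<alpha> < 1" "0 < \<delta>" "\<delta> < 1" "2 \<le> N"
  shows "1 \<le> C_param k \<alpha> \<delta> N"
proof -
  have s: "1 \<le> sqrt (real k)" and l: "1 \<le> log 2 (real N)" using assms by auto
  have "\<alpha> * \<delta> \<le> 1 * 1" using assms by (intro mult_mono) auto
  hence a: "0 < \<alpha> * \<delta>" "\<alpha> * \<delta> \<le> 1" using assms by auto
  have "1 * 1 \<le> sqrt (real k) * log 2 (real N)" using s l by (intro mult_mono) auto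
  hence "8 * (\<alpha> * \<delta>) \<le> 8 * sqrt (real k) * log 2 (real N)" using a by linarith
  hence "8 \<le> 8 * sqrt (real k) * log 2 (real N) / (\<alpha> * \<delta>)" using a by (simp add: pos_le_divide_eq)
  hence "log 2 2 \<le> log 2 (8 * sqrt (real k) * log 2 (real N) / (\<alpha> * \<delta>))" by (intro log_mono) auto
  hence "1 * 1 \<le> (log 2 (sqrt (real k)) powr (3/2) + 1) * log 2 (8 * sqrt (real k) * log 2 (real N) / (\<alpha> * \<delta>))"
    by (intro mult_mono) auto
  thus ?thesis unfolding C_param_def by simp
qed

theorem theorem1:
  shows "\<exists>K::real. K > 0 \<and>
    (\<forall>(k::nat) (\<alpha>::real) (\<delta>::real) (N::nat) (S::real measure) adv.
       k \<ge> 1 \<longrightarrow> 0 < \<alpha> \<longrightarrow> \<alpha> < 1 \<longrightarrow> real k \<le> 1 / \<alpha>\<^sup>2 \<longrightarrow> 0 < \<delta> \<longrightarrow> \<delta> < 1 \<longrightarrow> N \<ge> 2 \<longrightarrow>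
       adversary k N S adv \<longrightarrow>
       (let C = C_param k \<alpha> \<delta> N in
          \<P>((z, \<omega>) in S \<Otimes>\<^sub>M tape_measure k C.
              \<forall>t. \<bar>answer (run_conf k \<alpha> C adv z \<omega> t) - real (run_items k \<alpha> C adv z \<omega> t)\<bar>
                    \<le> \<alpha> * real (run_items k \<alpha> C adv z \<omega> t) \<and>
                  real (words (run_conf k \<alpha> C adv z \<omega> t))
                    \<le> K * (C * sqrt (real k) * log 2 (real N) / \<alpha>))
            \<ge> 1 - \<delta>))"
proof (intro exI[of _ 172] conjI allI impI)
  fix k :: nat and \<alpha> \<delta> :: real and N :: nat and S :: "real measure" and adv
  assume k: "k \<ge> 1" and \<alpha>: "0 < \<alpha>" "\<alpha> < 1" and ka: "real k \<le> 1 / \<alpha>\<^sup>2" and \<delta>: "0 < \<delta>" "\<delta> < 1"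
    and N: "N \<ge> 2" and A: "adversary k N S adv"
  define C where "C = C_param k \<alpha> \<delta> N"
  have C1: "1 \<le> C" unfolding C_def by (rule C_param_ge1[OF k \<alpha> \<delta> N])
  interpret S: prob_space S using A by (simp add: adversary_def)
  have "sets S = sets borel" using A by (simp add: adversary_def)
  hence sp: "space S = UNIV" using sets_eq_imp_space_eq by fastforce
  \<comment> \<open>The coins are independent of the tape, so they are fixed here and the bound is
    proved for every value.\<close>
  have T: "tracking_full k \<alpha> C adv z S N" for z
  proof unfold_locales
    show "adv t (z, h) = Some i \<Longrightarrow> i < k" for t h i using A unfolding adversary_def by blast
    show "adv t \<in> S \<Otimes>\<^sub>M history_space t \<rightarrow>\<^sub>M count_space UNIV" for t using A unfolding adversary_def by blast
    show "N \<le> item_count h t \<Longrightarrow> adv t (z, h) = None" for t h using A unfolding adversary_def by blast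
    show "z \<in> space S" by (simp add: sp)
  qed (use k \<alpha> C1 ka in auto)
  let ?TM = "tape_measure k C" and ?M = "S \<Otimes>\<^sub>M tape_measure k C"
  interpret T0: tracking_full k \<alpha> C adv 0 S N by (rule T)
  interpret TM: prob_space ?TM by (rule T0.prob_space_TM)
  interpret P: pair_prob_space S ?TM ..
  let ?ok = "\<lambda>z w t. tracking_full.ok k \<alpha> C adv z N w t"
  have okiff: "?ok z w t \<longleftrightarrow> \<bar>answer (run_conf k \<alpha> C adv z w t) - real (run_items k \<alpha> C adv z w t)\<bar>
        \<le> \<alpha> * real (run_items k \<alpha> C adv z w t) \<and>
      real (words (run_conf k \<alpha> C adv z w t)) \<le> 172 * (C * sqrt (real k) * log 2 (real N) / \<alpha>)" for z w t
  proof -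
    interpret tracking_full k \<alpha> C adv z S N by (rule T)
    show ?thesis
      using card_items[of w t] by (simp add: ok_def conf_def run_items_def hist_def)
  qed
  have bound: "emeasure ?TM {w. \<not> (\<forall>t. ?ok z w t)} \<le> ennreal \<delta>" for z
  proof -
    interpret tracking_full k \<alpha> C adv z S N by (rule T)
    show ?thesis
    proof (cases "8 * C * sqrt (real k) \<le> \<alpha> * real N")
      case True
      interpret budget k \<alpha> C adv z S N \<delta>
        by unfold_locales (use \<alpha> \<delta> N True C_def in auto)
      show ?thesis by (rule ok_probability)
    next
      case False
      hence "ok w t" for w t using N by (intro ok_small) auto
      thus ?thesis by simp
    qed
  qed
  let ?G = "{x \<in> space ?M. \<forall>t. ?ok (fst x) (snd x) t}"
  have advm: "adv t \<in> S \<Otimes>\<^sub>M history_space t \<rightarrow>\<^sub>M count_space UNIV" for t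
    by (rule T0.adv_meas)
  have G: "?G \<in> sets ?M"
  \<comment> \<open>Only here is the run considered as a function of coins and tape jointly.\<close>
  proof -
    have mc: "meas_conf ?M (\<lambda>x. run_conf k \<alpha> C adv (fst x) (snd x) t)" for t
      unfolding run_conf_def by (rule T0.meas_run(1)[OF measurable_snd measurable_fst advm])
    note [measurable] = meas_confD[OF mc]
    have [measurable]: "(\<lambda>x. real (total k (run_conf k \<alpha> C adv (fst x) (snd x) t))) \<in> borel_measurable ?M" for t
      by (rule measurable_compose[OF T0.meas_total[OF measurable_snd mc]]) simp
    have "run_items k \<alpha> C adv z w t = total k (run_conf k \<alpha> C adv z w t)" for z w t
    proof -
      interpret tracking_full k \<alpha> C adv z S N by (rule T)
      show ?thesis using card_items[of w t] by (simp add: conf_def run_items_def hist_def)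
    qed
    thus ?thesis unfolding okiff by simp
  qed
  \<comment> \<open>Integrating over the coins: every section of the complement has probability at
    most \<delta>.\<close>
  have "emeasure ?M (space ?M - ?G) = (\<integral>\<^sup>+z. emeasure ?TM (Pair z -` (space ?M - ?G)) \<partial>S)"
    by (rule TM.emeasure_pair_measure_alt) (use G in auto)
  also have "\<dots> \<le> (\<integral>\<^sup>+z. ennreal \<delta> \<partial>S)"
  proof (rule nn_integral_mono)
    fix z
    have "Pair z -` (space ?M - ?G) = {w. \<not> (\<forall>t. ?ok z w t)}"
      by (auto simp: space_pair_measure sp)
    thus "emeasure ?TM (Pair z -` (space ?M - ?G)) \<le> ennreal \<delta>" using bound by simp
  qed
  also have "\<dots> = ennreal \<delta>" by (simp add: S.emeasure_space_1)
  finally have "P.prob (space ?M - ?G) \<le> \<delta>"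
    using \<delta> by (simp add: P.emeasure_eq_measure)
  hence "1 - \<delta> \<le> P.prob ?G" using G by (simp add: P.prob_compl)
  moreover have "?G = {(z, \<omega>). (z, \<omega>) \<in> space ?M \<and>
      (\<forall>t. \<bar>answer (run_conf k \<alpha> C adv z \<omega> t) - real (run_items k \<alpha> C adv z \<omega> t)\<bar>
        \<le> \<alpha> * real (run_items k \<alpha> C adv z \<omega> t) \<and>
      real (words (run_conf k \<alpha> C adv z \<omega> t)) \<le> 172 * (C * sqrt (real k) * log 2 (real N) / \<alpha>))}"
    unfolding okiff by (auto simp only: case_prod_beta mem_Collect_eq prod.collapse fst_conv snd_conv)
  ultimately show "let C = C_param k \<alpha> \<delta> N in
      \<P>((z, \<omega>) in S \<Otimes>\<^sub>M tape_measure k C.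
          \<forall>t. \<bar>answer (run_conf k \<alpha> C adv z \<omega> t) - real (run_items k \<alpha> C adv z \<omega> t)\<bar>
                \<le> \<alpha> * real (run_items k \<alpha> C adv z \<omega> t) \<and>
              real (words (run_conf k \<alpha> C adv z \<omega> t))
                \<le> 172 * (C * sqrt (real k) * log 2 (real N) / \<alpha>))
        \<ge> 1 - \<delta>"
    unfolding Let_def C_def[symmetric] by (simp only:)
qed simp

end
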